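(* Let $l$, $t$, $d_0,\dots,d_l$ and $a_1,\dots,a_l$ be positive integers. Suppose that $t\ge 3$, that $a_i\ge 2$ for all $i$, and that for some $\delta\ge 2$ it holds that $d_i=\delta$ for all $0<i<l$ and $d_0,d_l\ge\delta$. Then the dimension of the neuromanifold $\mathcal{M}_{\mathbf{d},\mathbf{a}}$ is $$2\alpha_1d_0-\alpha_1^2+\delta(d_0+d_l)-\delta^2-l+\sum_{1<i\le l}(2\alpha_i\delta-\alpha_i^2),$$ where $\alpha_i=\min\{a_i,d_{i-1}\}$.
   Context: For $1\le i\le l$ let $Q_i,K_i\in\mathbb{R}^{a_i\times d_{i-1}}$ and $V_i\in\mathbb{R}^{d_i\times d_{i-1}}$, and let $\varphi_{W_i}\colon\mathbb{R}^{d_{i-1}\times t}\to\mathbb{R}^{d_i\times t}$, $\varphi_{W_i}(X)=V_iXX^\top K_i^\top Q_iX$. The deep lightning self-attention network with weights $\mathbf{W}=(Q_i,K_i,V_i)_{1\le i\le l}$ is $\varphi_{\mathbf{W}}=\varphi_{W_l}\circ\cdots\circ\varphi_{W_1}\colon\mathbb{R}^{d_0\times t}\to\mathbb{R}^{d_l\times t}$. With $\mathbf{d}=(d_0,\dots,d_l)$ and $\mathbf{a}=(a_1,\dots,a_l)$, the neuromanifold $\mathcal{M}_{\mathbf{d},\mathbf{a}}$ is the set of all $\varphi_{\mathbf{W}}$ as $\mathbf{W}$ ranges over all real weights. It is a semi-algebraic subset of the finite-dimensional real vector space of maps $\mathbb{R}^{d_0\times t}\to\mathbb{R}^{d_l\times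 t}$ whose output coordinates are homogeneous polynomials of degree $3^l$. Dimension is meant in the sense of (semi-)algebraic geometry, i.e. the dimension of the Zariski closure.
   Formalization: For l = 1 the formal statement also requires δ = min{d_0, d_1}: there δ is otherwise free while the formula depends on it (l = 1, d_0 = d_1 = 3, a_1 = 2, t = 3 gives 15 for δ = 2 and 16 for δ = 3); nothing changes for l ≥ 2. *)

theory Defs
  imports
    "Jordan_Normal_Form.Matrix"
    "HOL-Library.Extended_Nat"
    "HOL-Library.Multiset"
    "HOL-Analysis.Abstract_Topology"
begin

definition irreducible_in :: "'a topology \<Rightarrow> 'a set \<Rightarrow> bool" where
  "irreducible_in T Z \<longleftrightarrow>
     Z \<subseteq> topspace T \<and> Z \<noteq> {} \<and>
     (\<forall>A B. closedin T A \<longrightarrow> closedin T B \<longrightarrow> Z \<subseteq> A \<union> B \<longrightarrow> Z \<subseteq> A \<or> Z \<subseteq> B)"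

(* Supremum of the lengths n of chains Z 0 < Z 1 < ... < Z n of irreducible closed sets.
   The value for the empty space is 0. *)
definition krull_dimension :: "'a topology \<Rightarrow> enat" where
  "krull_dimension T =
     Sup {enat n | n. \<exists>Z. (\<forall>i\<le>n. closedin T (Z i) \<and> irreducible_in T (Z i)) \<and>
                         (\<forall>i<n. Z i \<subset> Z (Suc i))}"

(* A multiset M over {..<m} \<times> {..<n} stands for the monomial in the entries of an
   m x n matrix in which the entry p has exponent count M p. *)
definition homogeneous_form :: "nat \<Rightarrow> nat \<Rightarrow> nat \<Rightarrow> (real mat \<Rightarrow> real) \<Rightarrow> bool" where
  "homogeneous_form m n k f \<longleftrightarrow>
     (\<exists>c. \<forall>X\<in>carrier_mat m n.
        f X = (\<Sum>M | size M = k \<and> set_mset M \<subseteq> {..<m} \<times> {..<n}. c M * (\<Prod>p\<in>#M. X $$ p)))"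

(* Maps are extensional, so that equality of elements is equality of maps on m x n matrices. *)
definition hom_poly_maps ::
    "nat \<Rightarrow> nat \<Rightarrow> nat \<Rightarrow> nat \<Rightarrow> nat \<Rightarrow> (real mat \<Rightarrow> real mat) set" where
  "hom_poly_maps m n r s k =
     {F \<in> carrier_mat m n \<rightarrow>\<^sub>E carrier_mat r s.
        \<forall>i<r. \<forall>j<s. homogeneous_form m n k (\<lambda>X. F X $$ (i, j))}"

(* Linear functionals on a vector space V of maps with domain D and pointwise operations. *)
definition linear_functional_on ::
    "real mat set \<Rightarrow> (real mat \<Rightarrow> real mat) set \<Rightarrow> ((real mat \<Rightarrow> real mat) \<Rightarrow> real) \<Rightarrow> bool" where
  "linear_functional_on D V L \<longleftrightarrow>
     (\<forall>F\<in>V. \<forall>G\<in>V. L (\<lambda>X\<in>D. F X + G X) = L F + L G) \<and>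
     (\<forall>c. \<forall>F\<in>V. L (\<lambda>X\<in>D. c \<cdot>\<^sub>m F X) = c * L F)"

(* Real polynomial functions on V, generated by constants and linear functionals as in
   real_polynomial_function of HOL-Analysis; only the values on V are relevant. *)
inductive_set polynomial_functions ::
    "real mat set \<Rightarrow> (real mat \<Rightarrow> real mat) set \<Rightarrow> ((real mat \<Rightarrow> real mat) \<Rightarrow> real) set"
  for D V where
  const: "(\<lambda>_. c) \<in> polynomial_functions D V"
| linear: "linear_functional_on D V L \<Longrightarrow> L \<in> polynomial_functions D V"
| add: "p \<in> polynomial_functions D V \<Longrightarrow> q \<in> polynomial_functions D V \<Longrightarrow>
    (\<lambda>F. p F + q F) \<in> polynomial_functions D V"
| mult: "p \<in> polynomial_functions D V \<Longrightarrow> q \<in> polynomial_functions D V \<Longrightarrow>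
    (\<lambda>F. p F * q F) \<in> polynomial_functions D V"

definition zero_locus ::
    "(real mat \<Rightarrow> real mat) set \<Rightarrow> ((real mat \<Rightarrow> real mat) \<Rightarrow> real) set \<Rightarrow>
     (real mat \<Rightarrow> real mat) set" where
  "zero_locus V P = {F \<in> V. \<forall>p\<in>P. p F = 0}"

definition zariski_topology ::
    "real mat set \<Rightarrow> (real mat \<Rightarrow> real mat) set \<Rightarrow> (real mat \<Rightarrow> real mat) topology" where
  "zariski_topology D V =
     topology (\<lambda>U. \<exists>P\<subseteq>polynomial_functions D V. U = V - zero_locus V P)"

lemma istopology_zariski:
  "istopology (\<lambda>U. \<exists>P\<subseteq>polynomial_functions D V. U = V - zero_locus V P)"
  (is "istopology ?open")
  unfolding istopology_def
proof (intro conjI allI impI)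
  fix S T assume "?open S" "?open T"
  then obtain P Q where PQ: "P \<subseteq> polynomial_functions D V" "Q \<subseteq> polynomial_functions D V"
    and ST: "S = V - zero_locus V P" "T = V - zero_locus V Q" by blast
  let ?R = "(\<lambda>(p, q) F. p F * q F) ` (P \<times> Q)"
  have "?R \<subseteq> polynomial_functions D V"
  proof clarify
    fix p q assume "p \<in> P" "q \<in> Q"
    then show "(\<lambda>F. p F * q F) \<in> polynomial_functions D V"
      using PQ by (intro polynomial_functions.mult) blast+
  qed
  moreover have "S \<inter> T = V - zero_locus V ?R"
  proof (intro Set.set_eqI iffI)
    fix F assume "F \<in> S \<inter> T"
    then obtain p q where "F \<in> V" "p \<in> P" "q \<in> Q" "p F \<noteq> 0" "q F \<noteq> 0"
      unfolding ST zero_locus_def by blast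
    then show "F \<in> V - zero_locus V ?R" by (force simp: zero_locus_def)
  next
    fix F assume "F \<in> V - zero_locus V ?R"
    then obtain p q where "F \<in> V" "p \<in> P" "q \<in> Q" "p F * q F \<noteq> 0"
      by (auto simp: zero_locus_def)
    then show "F \<in> S \<inter> T" unfolding ST zero_locus_def by auto
  qed
  ultimately show "?open (S \<inter> T)" by blast
next
  fix K assume "\<forall>U\<in>K. ?open U"
  then obtain P where P: "\<And>U. U \<in> K \<Longrightarrow> P U \<subseteq> polynomial_functions D V"
    "\<And>U. U \<in> K \<Longrightarrow> U = V - zero_locus V (P U)" by metis
  have "F \<in> U \<longleftrightarrow> F \<in> V - zero_locus V (P U)" if "U \<in> K" for F U
    using P(2)[OF that] by (rule arg_cong[where f = "\<lambda>A. F \<in> A"])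
  then have "\<Union>K = V - zero_locus V (\<Union>U\<in>K. P U)"
    unfolding zero_locus_def by blast
  moreover have "(\<Union>U\<in>K. P U) \<subseteq> polynomial_functions D V" using P(1) by blast
  ultimately show "?open (\<Union>K)" by blast
qed

lemma openin_zariski:
  "openin (zariski_topology D V) U \<longleftrightarrow>
     (\<exists>P\<subseteq>polynomial_functions D V. U = V - zero_locus V P)"
  by (simp add: zariski_topology_def istopology_zariski)

lemma topspace_zariski: "topspace (zariski_topology D V) = V"
proof
  show "topspace (zariski_topology D V) \<subseteq> V"
    unfolding topspace_def by (auto simp: openin_zariski)
  have "V = V - zero_locus V {\<lambda>_. 1}" by (simp add: zero_locus_def)
  moreover have "{\<lambda>_. 1} \<subseteq> polynomial_functions D V"
    using polynomial_functions.const[of 1] by simp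
  ultimately have "openin (zariski_topology D V) V"
    unfolding openin_zariski by blast
  then show "V \<subseteq> topspace (zariski_topology D V)" by (rule openin_subset)
qed

lemma closedin_zariski:
  "closedin (zariski_topology D V) Z \<longleftrightarrow>
     (\<exists>P\<subseteq>polynomial_functions D V. Z = zero_locus V P)"
proof -
  have "Z \<subseteq> V \<and> V - Z = V - zero_locus V P \<longleftrightarrow> Z = zero_locus V P" for P
    unfolding zero_locus_def by blast
  then show ?thesis
    unfolding closedin_def topspace_zariski openin_zariski by blast
qed

definition zariski_closure_dimension ::
    "real mat set \<Rightarrow> (real mat \<Rightarrow> real mat) set \<Rightarrow> (real mat \<Rightarrow> real mat) set \<Rightarrow> enat" where
  "zariski_closure_dimension D V S =
     krull_dimension (subtopology (zariski_topology D V)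
       (Abstract_Topology.closure_of (zariski_topology D V) S))"

definition attention_layer :: "real mat \<Rightarrow> real mat \<Rightarrow> real mat \<Rightarrow> real mat \<Rightarrow> real mat" where
  "attention_layer Q K V X =
     V * X * transpose_mat X * transpose_mat K * Q * X"

primrec attention_network ::
    "(nat \<Rightarrow> real mat) \<Rightarrow> (nat \<Rightarrow> real mat) \<Rightarrow> (nat \<Rightarrow> real mat) \<Rightarrow> nat \<Rightarrow> real mat \<Rightarrow> real mat" where
  "attention_network Q K V 0 X = X"
| "attention_network Q K V (Suc i) X =
     attention_layer (Q (Suc i)) (K (Suc i)) (V (Suc i)) (attention_network Q K V i X)"

definition neuromanifold ::
    "nat \<Rightarrow> nat \<Rightarrow> (nat \<Rightarrow> nat) \<Rightarrow> (nat \<Rightarrow> nat) \<Rightarrow> (real mat \<Rightarrow> real mat) set" where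
  "neuromanifold l t d a =
     {\<lambda>X\<in>carrier_mat (d 0) t. attention_network Q K V l X | Q K V.
        \<forall>i\<in>{1..l}. Q i \<in> carrier_mat (a i) (d (i - 1)) \<and>
                   K i \<in> carrier_mat (a i) (d (i - 1)) \<and>
                   V i \<in> carrier_mat (d i) (d (i - 1))}"

definition neuromanifold_dimension :: "nat \<Rightarrow> nat \<Rightarrow> (nat \<Rightarrow> nat) \<Rightarrow> (nat \<Rightarrow> nat) \<Rightarrow> enat" where
  "neuromanifold_dimension l t d a =
     zariski_closure_dimension (carrier_mat (d 0) t)
       (hom_poly_maps (d 0) t (d l) t (3 ^ l)) (neuromanifold l t d a)"

end

theory Submission
  imports Defs "HOL-Computational_Algebra.Polynomial" "Jordan_Normal_Form.Determinant"
begin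

text \<open>Since \<open>\<phi>\<^bsub>W\<^esub>\<close> is invariant under changes of basis of the hidden spaces and under rescaling the
  attention matrix \<open>A\<^sub>i = K\<^sub>i\<^sup>T Q\<^sub>i\<close> against \<open>V\<^sub>i\<close>, generic weights can be brought into a normal form with as many
  free coordinates as the claimed dimension, so the normal forms are dense in the neuromanifold.
  The number of coordinates bounds the Krull dimension by counting monomials: a chain of irreducible
  closed sets of length \<open>k\<close> yields \<open>k\<close> algebraically independent functions on the image.
  Conversely, if the parametrisation is an immersion at one point, then the closures of the images of a
  flag of affine subspaces through that point form a strict chain.

  Immersivity is checked at \<open>A\<^sub>i = diag(1, \<dots>, 1, 0, \<dots>, 0)\<close>. On the columns \<open>x\<close> and \<open>\<epsilon> y\<close>, the outputs
  have leading terms \<open>u\<close> and \<open>\<epsilon> v\<close> with \<open>(x\<^sup>T A\<^sub>1 x) v = (x\<^sup>T A\<^sub>1 y) u\<close>. Hence an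
  infinitesimal deformation of the weights that does not move the network deforms \<open>A\<^sub>1\<close> by a multiple of
  itself, so not at all by the normalisation. The first layer then is fixed, and it
  can be peeled off because at the base point it maps onto almost all pairs of columns.\<close>

section \<open>Polynomial functions and algebraic independence\<close>

text \<open>The number 2 \<alpha> d - \<alpha>^2 is the dimension of the set of square matrices of
  size d and rank at most \<alpha>. The rescaling takes off one parameter per layer, and the l - 1
  hidden changes of basis take \<delta>^2 each off the sum of the \<open>d i * d (i - 1)\<close>,
  which leaves \<delta> (d 0 + d l) - \<delta>^2. Dimension is the length of chains of real Zariski
  closed sets, so no tangent space computes it directly. Both bounds pass through independence of
  polynomial functions on a set: a relation among them is itself a polynomial function, so it holds
  on a set exactly when it holds on the closure. The obstacle to rigidity is that all layers move at
  once. As \<epsilon> tends to 0, the first layer makes the two columns collinear, and the later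
  layers preserve the ratio. The ratio of the outputs then depends on the first attention matrix
  alone, which isolates it; the positive semidefinite base point keeps the quantities that have to
  be cancelled nonzero.\<close>

inductive_set polynomial_on :: "'i set \<Rightarrow> (('i \<Rightarrow> real) \<Rightarrow> real) set" for I where
  const: "(\<lambda>_. c) \<in> polynomial_on I"
| coord: "i \<in> I \<Longrightarrow> (\<lambda>x. x i) \<in> polynomial_on I"
| add: "f \<in> polynomial_on I \<Longrightarrow> g \<in> polynomial_on I \<Longrightarrow> (\<lambda>x. f x + g x) \<in> polynomial_on I"
| mult: "f \<in> polynomial_on I \<Longrightarrow> g \<in> polynomial_on I \<Longrightarrow> (\<lambda>x. f x * g x) \<in> polynomial_on I"

lemma polynomial_on_cmult: "f \<in> polynomial_on I \<Longrightarrow> (\<lambda>x. c * f x) \<in> polynomial_on I"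
  by (intro polynomial_on.mult polynomial_on.const)

lemma polynomial_on_sum:
  assumes "\<And>a. a \<in> A \<Longrightarrow> f a \<in> polynomial_on I"
  shows "(\<lambda>x. \<Sum>a\<in>A. f a x) \<in> polynomial_on I"
  using assms
  by (induction A rule: infinite_finite_induct) (auto intro: polynomial_on.intros)

lemma polynomial_on_prod:
  assumes "\<And>a. a \<in> A \<Longrightarrow> f a \<in> polynomial_on I"
  shows "(\<lambda>x. \<Prod>a\<in>A. f a x) \<in> polynomial_on I"
  using assms
  by (induction A rule: infinite_finite_induct) (auto intro: polynomial_on.intros)

lemma polynomial_on_subst:
  assumes "f \<in> polynomial_on I" and "\<And>i. i \<in> I \<Longrightarrow> g i \<in> polynomial_on J"
  shows "(\<lambda>x. f (\<lambda>i. g i x)) \<in> polynomial_on J"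
  using assms(1)
proof induction
  case (const c)
  then show ?case by (rule polynomial_on.const)
next
  case (coord i)
  then show ?case using assms(2) by simp
next
  case (add f g)
  then show ?case by (intro polynomial_on.add)
next
  case (mult f g)
  then show ?case by (intro polynomial_on.mult)
qed

lemma polynomial_on_univariate:
  assumes "f \<in> polynomial_on I" and "\<And>i. i \<in> I \<Longrightarrow> \<exists>p. \<forall>\<tau>. g i \<tau> = poly p \<tau>"
  shows "\<exists>p. \<forall>\<tau>. f (\<lambda>i. g i \<tau>) = poly p \<tau>"
  using assms(1)
proof induction
  case (const c)
  have "\<forall>\<tau>. c = poly [:c:] \<tau>" by simp
  then show ?case by blast
next
  case (coord i)
  then show ?case using assms(2) by simp
next
  case (add f h)
  then show ?case by (metis poly_add)
next
  case (mult f h)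
  then show ?case by (metis poly_mult)
qed

text \<open>Here \<open>\<gamma>\<close> is the gradient of \<open>f\<close> at \<open>w\<close>. The curves that detect algebraic independence have
  high order \<open>W\<close> at \<open>w\<close>, and then the remainder is negligible.\<close>

definition has_jet :: "'i set \<Rightarrow> ('i \<Rightarrow> real) \<Rightarrow> (('i \<Rightarrow> real) \<Rightarrow> real) \<Rightarrow> ('i \<Rightarrow> real) \<Rightarrow> bool" where
  "has_jet I w f \<gamma> \<longleftrightarrow> (\<forall>W \<sigma>. (\<forall>i\<in>I. monom 1 W dvd \<sigma> i) \<longrightarrow>
     (\<exists>r. \<forall>\<tau>. f (\<lambda>i. w i + poly (\<sigma> i) \<tau>) =
        poly ([:f w:] + (\<Sum>i\<in>I. smult (\<gamma> i) (\<sigma> i)) + monom 1 (2 * W) * r) \<tau>))"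

lemma has_jetD:
  assumes "has_jet I w f \<gamma>" "\<forall>i\<in>I. monom 1 W dvd \<sigma> i"
  shows "\<exists>r. \<forall>\<tau>. f (\<lambda>i. w i + poly (\<sigma> i) \<tau>) =
    poly ([:f w:] + (\<Sum>i\<in>I. smult (\<gamma> i) (\<sigma> i)) + monom 1 (2 * W) * r) \<tau>"
  using assms(1)[unfolded has_jet_def, THEN spec, THEN spec, THEN mp, OF assms(2)] .

lemma has_jet_const: "has_jet I w (\<lambda>_. c) (\<lambda>_. 0)"
  unfolding has_jet_def by (intro allI impI exI[of _ 0]) simp

lemma has_jet_coord:
  assumes "finite I" "k \<in> I"
  shows "has_jet I w (\<lambda>x. x k) (\<lambda>i. of_bool (i = k))"
  unfolding has_jet_def
proof (intro allI impI exI[of _ 0])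
  fix W \<tau> and \<sigma> :: "'a \<Rightarrow> real poly"
  have "(\<Sum>i\<in>I. smult (of_bool (i = k)) (\<sigma> i)) = (\<Sum>i\<in>I. if i = k then \<sigma> i else 0)"
    by (intro sum.cong) auto
  then show "w k + poly (\<sigma> k) \<tau> =
      poly ([:w k:] + (\<Sum>i\<in>I. smult (of_bool (i = k)) (\<sigma> i)) + monom 1 (2 * W) * 0) \<tau>"
    using assms by simp
qed

lemma has_jet_add:
  assumes "has_jet I w f \<gamma>" "has_jet I w g \<gamma>'"
  shows "has_jet I w (\<lambda>x. f x + g x) (\<lambda>i. \<gamma> i + \<gamma>' i)"
  unfolding has_jet_def
proof (intro allI impI)
  fix W and \<sigma> :: "'a \<Rightarrow> real poly" assume d: "\<forall>i\<in>I. monom 1 W dvd \<sigma> i"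
  obtain r where r: "\<forall>\<tau>. f (\<lambda>i. w i + poly (\<sigma> i) \<tau>) =
      poly ([:f w:] + (\<Sum>i\<in>I. smult (\<gamma> i) (\<sigma> i)) + monom 1 (2 * W) * r) \<tau>"
    using has_jetD[OF assms(1) d] by (elim exE)
  obtain r' where r': "\<forall>\<tau>. g (\<lambda>i. w i + poly (\<sigma> i) \<tau>) =
      poly ([:g w:] + (\<Sum>i\<in>I. smult (\<gamma>' i) (\<sigma> i)) + monom 1 (2 * W) * r') \<tau>"
    using has_jetD[OF assms(2) d] by (elim exE)
  show "\<exists>r. \<forall>\<tau>. f (\<lambda>i. w i + poly (\<sigma> i) \<tau>) + g (\<lambda>i. w i + poly (\<sigma> i) \<tau>) = poly
      ([:f w + g w:] + (\<Sum>i\<in>I. smult (\<gamma> i + \<gamma>' i) (\<sigma> i)) + monom 1 (2 * W) * r) \<tau>"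
    by (rule exI[of _ "r + r'"])
      (simp only: r r', simp add: poly_sum sum.distrib distrib_left distrib_right)
qed

text \<open>The only cross term that is not visibly part of the remainder is the product of the two
  linear parts, and each of these is divisible by \<tau>^W.\<close>

lemma has_jet_mult:
  assumes "has_jet I w f \<gamma>" "has_jet I w g \<gamma>'"
  shows "has_jet I w (\<lambda>x. f x * g x) (\<lambda>i. g w * \<gamma> i + f w * \<gamma>' i)"
  unfolding has_jet_def
proof (intro allI impI)
  fix W and \<sigma> :: "'a \<Rightarrow> real poly" assume d: "\<forall>i\<in>I. monom 1 W dvd \<sigma> i"
  define A where "A = (\<Sum>i\<in>I. smult (\<gamma> i) (\<sigma> i))"
  define A' where "A' = (\<Sum>i\<in>I. smult (\<gamma>' i) (\<sigma> i))"
  obtain r where r: "\<forall>\<tau>. f (\<lambda>i. w i + poly (\<sigma> i) \<tau>) = poly ([:f w:] + A + monom 1 (2 * W) * r) \<tau>"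
    unfolding A_def using has_jetD[OF assms(1) d] by (elim exE)
  obtain r' where r': "\<forall>\<tau>. g (\<lambda>i. w i + poly (\<sigma> i) \<tau>) = poly ([:g w:] + A' + monom 1 (2 * W) * r') \<tau>"
    unfolding A'_def using has_jetD[OF assms(2) d] by (elim exE)
  have "monom 1 W dvd A" "monom 1 W dvd A'"
    unfolding A_def A'_def using d by (auto intro!: dvd_sum dvd_smult)
  then obtain B B' where B: "A = monom 1 W * B" "A' = monom 1 W * B'" by (auto simp: dvd_def)
  have AA: "poly A \<tau> * poly A' \<tau> = \<tau> ^ (2 * W) * (poly B \<tau> * poly B' \<tau>)" for \<tau>
    unfolding B mult_2 power_add by (simp add: poly_monom mult_ac)
  have S: "poly (\<Sum>i\<in>I. smult (g w * \<gamma> i + f w * \<gamma>' i) (\<sigma> i)) \<tau> = g w * poly A \<tau> + f w * poly A' \<tau>" for \<tau>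
    by (simp add: A_def A'_def poly_sum sum_distrib_left sum.distrib distrib_right mult.assoc)
  define R where "R = B * B' + r * ([:g w:] + A' + monom 1 (2 * W) * r') + r' * ([:f w:] + A)"
  have "poly ([:f w:] + A + monom 1 (2 * W) * r) \<tau> * poly ([:g w:] + A' + monom 1 (2 * W) * r') \<tau> =
      f w * g w + (g w * poly A \<tau> + f w * poly A' \<tau>) + \<tau> ^ (2 * W) * poly R \<tau>" for \<tau>
  proof -
    have "(f w + poly A \<tau> + \<tau> ^ (2 * W) * poly r \<tau>) * (g w + poly A' \<tau> + \<tau> ^ (2 * W) * poly r' \<tau>) =
        f w * g w + (g w * poly A \<tau> + f w * poly A' \<tau>) + poly A \<tau> * poly A' \<tau> +
        \<tau> ^ (2 * W) * (poly r \<tau> * (g w + poly A' \<tau> + \<tau> ^ (2 * W) * poly r' \<tau>) + poly r' \<tau> * (f w + poly A \<tau>))"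
      by (simp only: algebra_simps)
    then show ?thesis unfolding AA R_def by (simp add: poly_monom distrib_left)
  qed
  then show "\<exists>r. \<forall>\<tau>. f (\<lambda>i. w i + poly (\<sigma> i) \<tau>) * g (\<lambda>i. w i + poly (\<sigma> i) \<tau>) = poly
      ([:f w * g w:] + (\<Sum>i\<in>I. smult (g w * \<gamma> i + f w * \<gamma>' i) (\<sigma> i)) + monom 1 (2 * W) * r) \<tau>"
    by (intro exI[of _ R]) (simp only: r r' S poly_add poly_mult poly_monom, simp)
qed

text \<open>This is the case W = 1 along a straight line: modulo \<tau>^2 the expansion is the
  directional derivative. It links the gradients to the immersion hypothesis.\<close>

lemma has_jet_deriv:
  assumes "has_jet I w f \<gamma>"
  shows "((\<lambda>s. f (\<lambda>i. w i + s * v i)) has_real_derivative (\<Sum>i\<in>I. \<gamma> i * v i)) (at 0)"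
proof -
  have d: "\<forall>i\<in>I. monom 1 1 dvd [:0, v i:]" by (simp add: monom_1_dvd_iff' coeff_pCons)
  obtain r where r: "\<forall>\<tau>. f (\<lambda>i. w i + poly [:0, v i:] \<tau>) =
      poly ([:f w:] + (\<Sum>i\<in>I. smult (\<gamma> i) [:0, v i:]) + monom 1 (2 * 1) * r) \<tau>"
    using has_jetD[OF assms d] by (elim exE)
  define q where "q = [:f w:] + (\<Sum>i\<in>I. smult (\<gamma> i) [:0, v i:]) + monom 1 (2 * 1) * r"
  have "poly (pderiv q) 0 = coeff q 1" by (simp add: poly_0_coeff_0 coeff_pderiv)
  also have "\<dots> = (\<Sum>i\<in>I. \<gamma> i * v i)"
    unfolding q_def by (simp add: coeff_sum coeff_monom_mult coeff_pCons)
  finally have "((\<lambda>s. poly q s) has_real_derivative (\<Sum>i\<in>I. \<gamma> i * v i)) (at 0)"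
    using poly_DERIV[of q 0] by simp
  moreover have "(\<lambda>s. poly q s) = (\<lambda>s. f (\<lambda>i. w i + s * v i))"
    using r unfolding q_def by (simp add: fun_eq_iff)
  ultimately show ?thesis by simp
qed

lemma polynomial_on_has_jet:
  assumes "finite I" "f \<in> polynomial_on I"
  shows "\<exists>\<gamma>. has_jet I w f \<gamma>"
  using assms(2)
  by induction (blast intro: has_jet_const has_jet_coord[OF assms(1)] has_jet_add has_jet_mult)+

section \<open>Linear algebra over finite index sets\<close>

lemma exists_linear_relation:
  fixes M :: "'a \<Rightarrow> 'b \<Rightarrow> real"
  assumes "finite B" "finite A" "card B < card A"
  shows "\<exists>c. (\<exists>a\<in>A. c a \<noteq> 0) \<and> (\<forall>b\<in>B. (\<Sum>a\<in>A. c a * M a b) = 0)"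
  using assms
proof (induction B arbitrary: A M rule: finite_induct)
  case empty
  then obtain a where "a \<in> A" by fastforce
  then show ?case by (auto intro!: exI[of _ "\<lambda>_. 1"])
next
  case (insert b B)
  show ?case
  proof (cases "\<forall>a\<in>A. M a b = 0")
    case True
    from insert.IH[of A M] insert.prems insert.hyps obtain c
      where "\<exists>a\<in>A. c a \<noteq> 0" "\<forall>b\<in>B. (\<Sum>a\<in>A. c a * M a b) = 0" by auto
    with True show ?thesis by (intro exI[of _ c]) auto
  next
    case False
    then obtain a0 where a0: "a0 \<in> A" "M a0 b \<noteq> 0" by blast
    \<comment> \<open>Row operations with pivot row \<open>a0\<close> clear column \<open>b\<close>;
      a relation among the remaining rows then determines the coefficient - \<open>s\<close> of the
      pivot row.\<close>
    define M' where "M' a b' = M a b' - M a b / M a0 b * M a0 b'" for a b'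
    have "card B < card (A - {a0})" using a0 insert.prems insert.hyps by simp
    from insert.IH[OF _ this, of M'] insert.prems obtain c where
      c: "\<exists>a\<in>A - {a0}. c a \<noteq> 0" "\<forall>b'\<in>B. (\<Sum>a\<in>A - {a0}. c a * M' a b') = 0" by auto
    define s where "s = (\<Sum>a\<in>A - {a0}. c a * (M a b / M a0 b))"
    define c' where "c' a = (if a = a0 then - s else c a)" for a
    have split: "(\<Sum>a\<in>A. c' a * M a b') = (\<Sum>a\<in>A - {a0}. c a * M a b') - s * M a0 b'" for b'
      using a0 insert.prems by (simp add: sum.remove[of A a0] c'_def)
    have "(\<Sum>a\<in>A. c' a * M a b') = 0" if "b' \<in> insert b B" for b'
    proof (cases "b' = b")
      case True
      have "s * M a0 b = (\<Sum>a\<in>A - {a0}. c a * M a b)"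
        unfolding s_def sum_distrib_right using a0 by (intro sum.cong) auto
      then show ?thesis using split True by simp
    next
      case False
      with that c(2) have "0 = (\<Sum>a\<in>A - {a0}. c a * M' a b')" by simp
      also have "\<dots> = (\<Sum>a\<in>A - {a0}. c a * M a b') - s * M a0 b'"
        unfolding s_def M'_def sum_distrib_right by (simp add: sum_subtractf algebra_simps)
      finally show ?thesis using split by simp
    qed
    moreover have "\<exists>a\<in>A. c' a \<noteq> 0" using c(1) by (auto simp: c'_def)
    ultimately show ?thesis by blast
  qed
qed

text \<open>A subspace of a finite-dimensional space with zero annihilator is the whole space, so it
  contains the coordinate functionals. The annihilator is the form in which an immersion supplies
  the hypothesis: \<open>U\<close> will consist of gradients, and \<open>v\<close> of a direction
  that none of them detects.\<close>

lemma exists_dual_basis: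
  fixes U :: "('i \<Rightarrow> real) set"
  assumes "finite I"
    and add: "\<And>u v. u \<in> U \<Longrightarrow> v \<in> U \<Longrightarrow> (\<lambda>i. u i + v i) \<in> U"
    and scale: "\<And>c u. u \<in> U \<Longrightarrow> (\<lambda>i. c * u i) \<in> U"
    and zero: "(\<lambda>_. 0) \<in> U"
    and nondeg: "\<And>v. (\<And>u. u \<in> U \<Longrightarrow> (\<Sum>i\<in>I. u i * v i) = 0) \<Longrightarrow> \<forall>i\<in>I. v i = 0"
  shows "\<exists>e. \<forall>j\<in>I. e j \<in> U \<and> (\<forall>i\<in>I. e j i = of_bool (i = j))"
  using assms(1) nondeg
proof (induction I rule: finite_induct)
  case empty
  then show ?case by simp
next
  case (insert k I)
  have diff: "(\<lambda>i. u i - c * v i) \<in> U" if "u \<in> U" "v \<in> U" for u v c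
    using add[OF that(1) scale[OF that(2), of "-c"]] by simp
  have sums: "(\<lambda>i. \<Sum>j\<in>J. c j * e j i) \<in> U" if "finite J" "\<And>j. j \<in> J \<Longrightarrow> e j \<in> U"
    for J :: "'i set" and c e
    using that by (induction J rule: finite_induct) (auto intro!: zero add scale)
  have "\<forall>i\<in>I. v i = 0" if v: "\<And>u. u \<in> U \<Longrightarrow> (\<Sum>i\<in>I. u i * v i) = 0" for v
  proof -
    have "\<forall>i\<in>insert k I. (if i = k then 0 else v i) = 0"
    proof (rule insert.prems)
      fix u assume "u \<in> U"
      have "(\<Sum>i\<in>I. u i * (if i = k then 0 else v i)) = (\<Sum>i\<in>I. u i * v i)"
        using insert.hyps by (intro sum.cong) auto
      then show "(\<Sum>i\<in>insert k I. u i * (if i = k then 0 else v i)) = 0"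
        using insert.hyps v[OF \<open>u \<in> U\<close>] by simp
    qed
    then show ?thesis using insert.hyps by (metis insertCI)
  qed
  then obtain e where e: "\<forall>j\<in>I. e j \<in> U \<and> (\<forall>i\<in>I. e j i = of_bool (i = j))"
    using insert.IH by blast
  have proj: "(\<Sum>j\<in>I. u j * e j i) = u i" if "i \<in> I" for u i
  proof -
    have "(\<Sum>j\<in>I. u j * e j i) = (\<Sum>j\<in>I. if j = i then u j else 0)"
      using e that by (intro sum.cong) auto
    then show ?thesis using that insert.hyps by simp
  qed
  have "\<exists>u0\<in>U. (\<forall>i\<in>I. u0 i = 0) \<and> u0 k \<noteq> 0"
  proof (rule ccontr)
    assume no: "\<not> ?thesis"
    \<comment> \<open>If every element of \<open>U\<close> that vanishes on \<open>I\<close> also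
      vanishes at \<open>k\<close>, then \<open>u k\<close> is the combination of the
      \<open>u i\<close> with coefficients \<open>e i k\<close>, and this nonzero vector lies in the
      annihilator.\<close>
    define v where "v i = (if i = k then 1 else - e i k)" for i
    have "(\<Sum>i\<in>insert k I. u i * v i) = 0" if "u \<in> U" for u
    proof -
      have "(\<lambda>i. \<Sum>j\<in>I. u j * e j i) \<in> U" using e insert.hyps by (intro sums) auto
      from diff[OF that this, of 1]
      have "(\<lambda>i. u i - (\<Sum>j\<in>I. u j * e j i)) \<in> U" by simp
      moreover have "\<forall>i\<in>I. u i - (\<Sum>j\<in>I. u j * e j i) = 0" by (simp add: proj)
      ultimately have "\<not> u k - (\<Sum>j\<in>I. u j * e j k) \<noteq> 0" using no
        by (metis (no_types, lifting))
      then have "u k = (\<Sum>j\<in>I. u j * e j k)" by simp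
      moreover have "(\<Sum>i\<in>I. u i * v i) = (\<Sum>i\<in>I. - (u i * e i k))"
        using insert.hyps by (intro sum.cong) (auto simp: v_def)
      ultimately show ?thesis using insert.hyps by (simp add: v_def sum_negf)
    qed
    from insert.prems[OF this] show False by (auto simp: v_def)
  qed
  then obtain u0 where u0: "u0 \<in> U" "\<forall>i\<in>I. u0 i = 0" "u0 k \<noteq> 0" by blast
  define ek where "ek = (\<lambda>i. 1 / u0 k * u0 i)"
  have ek: "ek \<in> U" "\<forall>i\<in>I. ek i = 0" "ek k = 1"
    using u0 scale[OF u0(1), of "1 / u0 k"] by (auto simp: ek_def)
  define e' where "e' j = (if j = k then ek else (\<lambda>i. e j i - e j k * ek i))" for j
  have "\<forall>j\<in>insert k I. e' j \<in> U \<and> (\<forall>i\<in>insert k I. e' j i = of_bool (i = j))"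
    using e ek insert.hyps by (auto simp: e'_def intro!: diff)
  then show ?case by blast
qed


section \<open>Counting monomials in a box of exponents\<close>

text \<open>Bounding each exponent separately, instead of the total degree, makes the number of
  monomials exactly (e + 1)^card I.\<close>

definition box_poly :: "'i set \<Rightarrow> nat \<Rightarrow> (('i \<Rightarrow> real) \<Rightarrow> real) \<Rightarrow> bool" where
  "box_poly I e f \<longleftrightarrow>
     (\<exists>c. \<forall>x. f x = (\<Sum>m\<in>I \<rightarrow>\<^sub>E {..e}. c m * (\<Prod>i\<in>I. x i ^ m i)))"

lemma box_poly_mono:
  assumes "finite I" "box_poly I e f" "e \<le> e'"
  shows "box_poly I e' f"
proof -
  obtain c where c: "\<And>x. f x = (\<Sum>m\<in>I \<rightarrow>\<^sub>E {..e}. c m * (\<Prod>i\<in>I. x i ^ m i))"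
    using assms(2) unfolding box_poly_def by blast
  have sub: "(I \<rightarrow>\<^sub>E {..e}) \<subseteq> (I \<rightarrow>\<^sub>E {..e'})"
    using assms(3) by (intro PiE_mono) auto
  have "f x = (\<Sum>m\<in>I \<rightarrow>\<^sub>E {..e'}. (if m \<in> I \<rightarrow>\<^sub>E {..e} then c m else 0) * (\<Prod>i\<in>I. x i ^ m i))" for x
    unfolding c by (rule sum.mono_neutral_cong_left)
      (use sub assms(1) in \<open>auto intro!: finite_PiE\<close>)
  then show ?thesis unfolding box_poly_def by (intro exI[of _ "\<lambda>m. if m \<in> I \<rightarrow>\<^sub>E {..e} then c m else 0"]) blast
qed

lemma box_poly_add:
  assumes "box_poly I e f" "box_poly I e g"
  shows "box_poly I e (\<lambda>x. f x + g x)"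
proof -
  obtain c c' where c: "\<And>x. f x = (\<Sum>m\<in>I \<rightarrow>\<^sub>E {..e}. c m * (\<Prod>i\<in>I. x i ^ m i))"
    "\<And>x. g x = (\<Sum>m\<in>I \<rightarrow>\<^sub>E {..e}. c' m * (\<Prod>i\<in>I. x i ^ m i))"
    using assms unfolding box_poly_def by blast
  show ?thesis unfolding box_poly_def
    by (intro exI[of _ "\<lambda>m. c m + c' m"]) (simp add: c sum.distrib distrib_right)
qed

lemma box_poly_mult:
  assumes I: "finite I" and "box_poly I e f" "box_poly I e' g"
  shows "box_poly I (e + e') (\<lambda>x. f x * g x)"
proof -
  define mon where "mon m x = (\<Prod>i\<in>I. x i ^ m i)" for m and x :: "'a \<Rightarrow> real"
  obtain c c' where c: "\<And>x. f x = (\<Sum>m\<in>I \<rightarrow>\<^sub>E {..e}. c m * mon m x)"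
    "\<And>x. g x = (\<Sum>m\<in>I \<rightarrow>\<^sub>E {..e'}. c' m * mon m x)"
    using assms(2,3) unfolding box_poly_def mon_def by blast
  define S where "S = (I \<rightarrow>\<^sub>E {..e}) \<times> (I \<rightarrow>\<^sub>E {..e'})"
  define T where "T = (I \<rightarrow>\<^sub>E {..e + e'})"
  define h where "h = (\<lambda>(m, m'). \<lambda>i\<in>I. m i + m' i :: nat)"
  define C where "C M = (\<Sum>p\<in>{p \<in> S. h p = M}. c (fst p) * c' (snd p))" for M
  have fin: "finite S" "finite T" unfolding S_def T_def using I by (auto intro!: finite_PiE)
  have hST: "h ` S \<subseteq> T"
    unfolding S_def T_def h_def by (auto simp: PiE_iff Pi_iff intro!: add_mono)
  have mon: "mon (h p) x = mon (fst p) x * mon (snd p) x" for p x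
    unfolding mon_def h_def by (simp add: prod.distrib[symmetric] power_add split: prod.split)
  have "f x * g x = (\<Sum>M\<in>T. C M * mon M x)" for x
  proof -
    have "f x * g x = (\<Sum>p\<in>S. c (fst p) * c' (snd p) * mon (h p) x)"
      unfolding c sum_product S_def sum.cartesian_product mon
      by (intro sum.cong) (auto simp: ac_simps)
    also have "\<dots> = (\<Sum>M\<in>T. \<Sum>p\<in>{p \<in> S. h p = M}. c (fst p) * c' (snd p) * mon (h p) x)"
      by (rule sum.group[symmetric]) (use fin hST in auto)
    also have "\<dots> = (\<Sum>M\<in>T. C M * mon M x)"
      unfolding C_def sum_distrib_right by (intro sum.cong) auto
    finally show ?thesis .
  qed
  then show ?thesis unfolding box_poly_def T_def mon_def by blast
qed

lemma box_poly_const: "finite I \<Longrightarrow> box_poly I 0 (\<lambda>_. c)"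
proof -
  assume I: "finite I"
  have 0: "(I \<rightarrow>\<^sub>E {..0::nat}) = {\<lambda>i\<in>I. 0}"
    by (auto simp: PiE_iff extensional_def fun_eq_iff)
  show ?thesis unfolding box_poly_def 0 using I
    by (intro exI[of _ "\<lambda>_. c"]) simp
qed

lemma box_poly_coord:
  assumes "finite I" "i \<in> I"
  shows "box_poly I 1 (\<lambda>x. x i)"
proof -
  define m0 where "m0 = (\<lambda>j\<in>I. of_bool (j = i) :: nat)"
  have "m0 \<in> I \<rightarrow>\<^sub>E {..1}" by (auto simp: m0_def)
  moreover have "(\<Prod>j\<in>I. x j ^ m0 j) = x i" for x :: "'a \<Rightarrow> real"
  proof -
    have "(\<Prod>j\<in>I. x j ^ m0 j) = (\<Prod>j\<in>I. if j = i then x j else 1)"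
      by (intro prod.cong) (auto simp: m0_def)
    then show ?thesis using assms by simp
  qed
  ultimately have *: "x i = (\<Sum>m\<in>I \<rightarrow>\<^sub>E {..1}. of_bool (m = m0) * (\<Prod>j\<in>I. x j ^ m j))" for x :: "'a \<Rightarrow> real"
    using assms(1) by (subst sum.remove[of _ m0]) (auto intro!: finite_PiE)
  show ?thesis unfolding box_poly_def by (intro exI allI) (rule *)
qed

lemma polynomial_on_box:
  assumes "finite I" "f \<in> polynomial_on I"
  shows "\<exists>e. box_poly I e f"
  using assms(2)
proof induction
  case (const c)
  then show ?case using box_poly_const[OF assms(1)] by blast
next
  case (coord i)
  then show ?case using box_poly_coord[OF assms(1)] by blast
next
  case (add f g)
  then obtain e e' where "box_poly I e f" "box_poly I e' g" by blast
  then have "box_poly I (e + e') f" "box_poly I (e + e') g"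
    using box_poly_mono[OF assms(1)] by auto
  then show ?case using box_poly_add by blast
next
  case (mult f g)
  then show ?case using box_poly_mult[OF assms(1)] by blast
qed

lemma box_poly_power:
  assumes "finite I" "box_poly I e f"
  shows "box_poly I (n * e) (\<lambda>x. f x ^ n)"
proof (induction n)
  case 0
  then show ?case using box_poly_const[OF assms(1), of 1] by simp
next
  case (Suc n)
  from box_poly_mult[OF assms(1,2) Suc] show ?case by (simp add: ac_simps)
qed

lemma box_poly_monomial:
  assumes "finite I" "\<And>j. j < k \<Longrightarrow> box_poly I e (f j)" "\<And>j. j < k \<Longrightarrow> m j < D"
  shows "box_poly I (k * (D * e)) (\<lambda>x. \<Prod>j<k. f j x ^ m j)"
  using assms(2,3)
proof (induction k)
  case 0
  then show ?case using box_poly_const[OF assms(1), of 1] by simp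
next
  case (Suc k)
  have "box_poly I (m k * e) (\<lambda>x. f k x ^ m k)"
    using Suc.prems by (intro box_poly_power assms(1)) auto
  moreover have "m k * e \<le> D * e" using Suc.prems(2)[of k] by simp
  ultimately have "box_poly I (D * e) (\<lambda>x. f k x ^ m k)"
    using box_poly_mono[OF assms(1)] by blast
  from box_poly_mult[OF assms(1) Suc.IH this] Suc.prems show ?case
    by (simp add: add.commute)
qed

text \<open>Exponent vectors are functions supported on the first \<open>k\<close> indices.\<close>

definition algebraically_independent_on ::
    "nat \<Rightarrow> (nat \<Rightarrow> 'x \<Rightarrow> real) \<Rightarrow> 'x set \<Rightarrow> bool" where
  "algebraically_independent_on k f Z \<longleftrightarrow>
     (\<forall>S c. finite S \<longrightarrow> S \<subseteq> {m. \<forall>j\<ge>k. m j = (0::nat)} \<longrightarrow>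
        (\<forall>x\<in>Z. (\<Sum>m\<in>S. c m * (\<Prod>j<k. f j x ^ m j)) = (0::real)) \<longrightarrow> (\<forall>m\<in>S. c m = 0))"

lemma algebraically_independent_onD:
  assumes "algebraically_independent_on k f Z" "finite S" "S \<subseteq> {m. \<forall>j\<ge>k. m j = 0}"
    and "\<And>x. x \<in> Z \<Longrightarrow> (\<Sum>m\<in>S. c m * (\<Prod>j<k. f j x ^ m j)) = 0" and "m \<in> S"
  shows "c m = 0"
  using assms unfolding algebraically_independent_on_def by blast

text \<open>There are \<open>D ^ k\<close> monomials of degree less than \<open>D\<close> in each of the \<open>k\<close> functions, but
  they lie in a space of dimension \<open>O(D ^ card I)\<close>.\<close>

lemma algebraically_independent_on_range_le:
  fixes \<psi> :: "('i \<Rightarrow> real) \<Rightarrow> 'x"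
  assumes I: "finite I" and poly: "\<And>j. j < k \<Longrightarrow> (\<lambda>x. f j (\<psi> x)) \<in> polynomial_on I"
    and indep: "algebraically_independent_on k f (range \<psi>)"
  shows "k \<le> card I"
proof (rule ccontr)
  assume "\<not> k \<le> card I"
  then have k: "card I < k" by simp
  have "\<forall>j. \<exists>e. j < k \<longrightarrow> box_poly I e (\<lambda>x. f j (\<psi> x))"
    using polynomial_on_box[OF I poly] by blast
  then obtain E where E: "\<And>j. j < k \<Longrightarrow> box_poly I (E j) (\<lambda>x. f j (\<psi> x))" by metis
  define e where "e = (\<Sum>j<k. E j)"
  have e: "box_poly I e (\<lambda>x. f j (\<psi> x))" if "j < k" for j
    using that by (intro box_poly_mono[OF I E]) (auto simp: e_def intro!: member_le_sum)
  \<comment> \<open>\<open>D\<close> has to exceed (k e + 1)^card I: the box then contains at most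
    D^card I (k e + 1)^card I < D^(card I + 1) \<le> D^k monomials, fewer than the D^k products of
    the functions.\<close>
  define D where "D = Suc ((k * e + 1) ^ card I)"
  define S where "S = {m :: nat \<Rightarrow> nat. (\<forall>j<k. m j < D) \<and> (\<forall>j\<ge>k. m j = 0)}"
  define T where "T = (I \<rightarrow>\<^sub>E {..k * (D * e)})"
  define mon where "mon m x = (\<Prod>i\<in>I. x i ^ m i)" for m and x :: "'i \<Rightarrow> real"
  \<comment> \<open>Vectors in \<open>S\<close> are 0 from \<open>k\<close> on, whereas the
    extensional functions are \<open>undefined\<close> there; the bijection only exchanges the
    default value.\<close>
  have bij: "bij_betw (\<lambda>m. \<lambda>j\<in>{..<k}. m j) S ({..<k} \<rightarrow>\<^sub>E {..<D})"
  proof (rule bij_betw_byWitness[where f' = "\<lambda>m j. if j < k then m j else 0"])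
    show "\<forall>m\<in>S. (\<lambda>j. if j < k then (\<lambda>j\<in>{..<k}. m j) j else 0) = m"
    proof (intro ballI ext)
      fix m j assume "m \<in> S"
      then show "(if j < k then (\<lambda>j\<in>{..<k}. m j) j else 0) = m j"
        unfolding S_def by (cases "j < k") simp_all
    qed
    show "\<forall>m\<in>{..<k} \<rightarrow>\<^sub>E {..<D}. (\<lambda>j\<in>{..<k}. if j < k then m j else 0) = m"
    proof (intro ballI ext)
      fix m j assume "m \<in> {..<k} \<rightarrow>\<^sub>E {..<D}"
      then show "(\<lambda>j\<in>{..<k}. if j < k then m j else 0) j = m j"
        using PiE_arb[of m "{..<k}" "\<lambda>_. {..<D}" j] by (cases "j < k") simp_all
    qed
    show "(\<lambda>m. \<lambda>j\<in>{..<k}. m j) ` S \<subseteq> {..<k} \<rightarrow>\<^sub>E {..<D}"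
      unfolding S_def by (intro image_subsetI restrict_PiE_iff[THEN iffD2]) simp
    show "(\<lambda>m j. if j < k then m j else 0) ` ({..<k} \<rightarrow>\<^sub>E {..<D}) \<subseteq> S"
    proof (intro image_subsetI)
      fix m assume m: "m \<in> {..<k} \<rightarrow>\<^sub>E {..<D}"
      have "m j < D" if "j < k" for j using PiE_mem[OF m, of j] that by simp
      then show "(\<lambda>j. if j < k then m j else 0) \<in> S" unfolding S_def by simp
    qed
  qed
  have finS: "finite S"
    using bij_betw_finite[OF bij] by (simp add: finite_PiE)
  have cardS: "card S = D ^ k"
    using bij_betw_same_card[OF bij] by (simp add: card_PiE)
  have finT: "finite T" and cardT: "card T = (k * (D * e) + 1) ^ card I"
    unfolding T_def using I by (auto simp: card_PiE finite_PiE)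
  have "card T \<le> (D * (k * e + 1)) ^ card I"
    unfolding cardT by (intro power_mono) (auto simp: D_def algebra_simps)
  also have "\<dots> = D ^ card I * (k * e + 1) ^ card I" by (rule power_mult_distrib)
  also have "\<dots> < D ^ card I * D" by (intro mult_strict_left_mono) (auto simp: D_def)
  also have "\<dots> = D ^ Suc (card I)" by simp
  also have "\<dots> \<le> D ^ k" using k by (intro power_increasing) (auto simp: D_def)
  finally have "card T < card S" using cardS by simp
  have "\<forall>m\<in>S. box_poly I (k * (D * e)) (\<lambda>x. \<Prod>j<k. f j (\<psi> x) ^ m j)"
    unfolding S_def using e I by (auto intro!: box_poly_monomial)
  then have "\<forall>m\<in>S. \<exists>c. \<forall>x. (\<Prod>j<k. f j (\<psi> x) ^ m j) = (\<Sum>b\<in>T. c b * mon b x)"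
    unfolding box_poly_def T_def mon_def by blast
  then obtain M where M: "\<And>m x. m \<in> S \<Longrightarrow> (\<Prod>j<k. f j (\<psi> x) ^ m j) = (\<Sum>b\<in>T. M m b * mon b x)"
    by metis
  obtain c where c: "\<exists>m\<in>S. c m \<noteq> 0" "\<forall>b\<in>T. (\<Sum>m\<in>S. c m * M m b) = 0"
    using exists_linear_relation[OF finT finS \<open>card T < card S\<close>, of M] by blast
  have "(\<Sum>m\<in>S. c m * (\<Prod>j<k. f j y ^ m j)) = 0" if "y \<in> range \<psi>" for y
  proof -
    from that obtain x where y: "y = \<psi> x" by blast
    have "(\<Sum>m\<in>S. c m * (\<Prod>j<k. f j y ^ m j)) = (\<Sum>m\<in>S. \<Sum>b\<in>T. c m * M m b * mon b x)"
      by (simp add: y M sum_distrib_left mult.assoc)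
    also have "\<dots> = (\<Sum>b\<in>T. (\<Sum>m\<in>S. c m * M m b) * mon b x)"
      by (subst sum.swap) (simp add: sum_distrib_right)
    finally show ?thesis using c(2) by simp
  qed
  moreover have "S \<subseteq> {m. \<forall>j\<ge>k. m j = 0}" by (auto simp: S_def)
  ultimately show False using algebraically_independent_onD[OF indep finS] c(1) by blast
qed

section \<open>Independence on affine slices\<close>

text \<open>The lowest digit is the residue modulo \<open>B\<close>, and dividing it off shifts the
  others. The digits will be the exponents of a monomial, which its weight thereby
  determines.\<close>

lemma base_expansion_unique:
  fixes m m' :: "nat \<Rightarrow> nat"
  assumes "\<And>j. j < k \<Longrightarrow> m j < B" "\<And>j. j < k \<Longrightarrow> m' j < B"
    and "(\<Sum>j<k. m j * B ^ j) = (\<Sum>j<k. m' j * B ^ j)" and "j < k"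
  shows "m j = m' j"
  using assms
proof (induction k arbitrary: m m' j)
  case 0
  then show ?case by simp
next
  case (Suc k)
  have split: "(\<Sum>j<Suc k. m j * B ^ j) = m 0 + B * (\<Sum>j<k. m (Suc j) * B ^ j)" for m
    by (subst sum.lessThan_Suc_shift) (simp add: sum_distrib_left ac_simps)
  have eq: "m 0 + B * (\<Sum>j<k. m (Suc j) * B ^ j) = m' 0 + B * (\<Sum>j<k. m' (Suc j) * B ^ j)"
    using Suc.prems(3) unfolding split .
  have lt: "m 0 < B" "m' 0 < B" using Suc.prems by auto
  have "(m 0 + B * (\<Sum>j<k. m (Suc j) * B ^ j)) mod B = (m' 0 + B * (\<Sum>j<k. m' (Suc j) * B ^ j)) mod B"
    using eq by simp
  then have m0: "m 0 = m' 0" using lt by simp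
  then have "(\<Sum>j<k. m (Suc j) * B ^ j) = (\<Sum>j<k. m' (Suc j) * B ^ j)" using eq lt by simp
  from Suc.IH[OF _ _ this] Suc.prems m0 show ?case by (cases j) auto
qed

lemma base_expansion_less:
  fixes m :: "nat \<Rightarrow> nat"
  assumes "\<And>j. j < k \<Longrightarrow> m j < B"
  shows "(\<Sum>j<k. m j * B ^ j) < B ^ k"
  using assms
proof (induction k)
  case 0
  then show ?case by simp
next
  case (Suc k)
  have "(\<Sum>j<Suc k. m j * B ^ j) < B ^ k + m k * B ^ k" using Suc by simp
  also have "\<dots> = Suc (m k) * B ^ k" by simp
  also have "\<dots> \<le> B * B ^ k" using Suc.prems[of k] by (intro mult_right_mono) auto
  finally show ?case by simp
qed

text \<open>On the curve whose \<open>j\<close>-th coordinate moves by \<open>\<tau> ^ (B ^ k + B ^ j)\<close> the second order terms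
  are negligible, and distinct monomials vanish to distinct orders at \<open>\<tau> = 0\<close>.\<close>

lemma algebraically_independent_on_slice:
  fixes \<psi> :: "(nat \<Rightarrow> real) \<Rightarrow> 'x" and w :: "nat \<Rightarrow> real"
  assumes "k \<le> n"
    and jet: "\<And>j W \<sigma>. j < k \<Longrightarrow> \<forall>i<n. monom 1 W dvd \<sigma> i \<Longrightarrow>
      \<exists>r. \<forall>\<tau>. f j (\<psi> (\<lambda>i. w i + poly (\<sigma> i) \<tau>)) = poly (\<sigma> j + monom 1 (2 * W) * r) \<tau>"
  shows "algebraically_independent_on k f (\<psi> ` {x. \<forall>i\<ge>k. x i = w i})"
  unfolding algebraically_independent_on_def
proof (intro allI impI ballI, rule ccontr)
  fix S c m1
  assume S: "finite S" "S \<subseteq> {m. \<forall>j\<ge>k. m j = (0::nat)}"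
    and rel: "\<forall>y\<in>\<psi> ` {x. \<forall>i\<ge>k. x i = w i}. (\<Sum>m\<in>S. c m * (\<Prod>j<k. f j y ^ m j)) = 0"
    and m1: "m1 \<in> S" "c m1 \<noteq> 0"
  define S' where "S' = {m \<in> S. c m \<noteq> 0}"
  have S': "finite S'" "m1 \<in> S'" "\<And>m. m \<in> S' \<Longrightarrow> \<forall>j\<ge>k. m j = 0"
    using S(1) m1 subsetD[OF S(2)] unfolding S'_def by simp_all
  \<comment> \<open>The sum bounds all exponents that occur, so they are digits in base
    \<open>B\<close>; the summand 2 also makes the powers of \<open>B\<close> strictly
    increasing.\<close>
  define B where "B = 2 + (\<Sum>m\<in>S'. \<Sum>j<k. m j)"
  have B: "m j < B" if "m \<in> S'" "j < k" for m j
  proof -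
    have "m j \<le> (\<Sum>j<k. m j)" using that by (intro member_le_sum) auto
    also have "\<dots> \<le> (\<Sum>m\<in>S'. \<Sum>j<k. m j)"
      by (rule member_le_sum[of m S' "\<lambda>m. \<Sum>j<k. m j"]) (use that S' in auto)
    finally show ?thesis by (simp add: B_def)
  qed
  \<comment> \<open>\<open>W\<close> exceeds every number with \<open>k\<close> digits in base
    \<open>B\<close>, so the order of vanishing of a monomial determines its digits modulo
    \<open>W\<close>. The order W + B^j of the j-th coordinate stays below the order 2 W of the
    remainder.\<close>
  define W where "W = B ^ k"
  define wt where "wt j = W + B ^ j" for j
  define \<sigma> where "\<sigma> j = (if j < k then monom 1 (wt j) else 0 :: real poly)" for j
  have dvd: "\<forall>i<n. monom 1 W dvd \<sigma> i"
  proof (intro allI impI)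
    fix i
    show "monom 1 W dvd \<sigma> i"
    proof (cases "i < k")
      case True
      then have "\<sigma> i = monom 1 W * monom 1 (B ^ i)" by (simp add: \<sigma>_def wt_def mult_monom)
      then show ?thesis by simp
    qed (simp add: \<sigma>_def)
  qed
  have "\<exists>u. (\<forall>\<tau>. f j (\<psi> (\<lambda>i. w i + poly (\<sigma> i) \<tau>)) = poly (monom 1 (wt j) * u) \<tau>) \<and> coeff u 0 = 1"
    if j: "j < k" for j
  proof -
    obtain r where r: "\<forall>\<tau>. f j (\<psi> (\<lambda>i. w i + poly (\<sigma> i) \<tau>)) = poly (\<sigma> j + monom 1 (2 * W) * r) \<tau>"
      using jet[OF j dvd] by (elim exE)
    have "B ^ j < W" unfolding W_def using j by (intro power_strict_increasing) (auto simp: B_def)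
    then have q: "2 * W = wt j + Suc (W - Suc (B ^ j))" unfolding wt_def by simp
    define q where "q = W - Suc (B ^ j)"
    have "monom 1 (2 * W) = monom 1 (wt j) * (monom 1 (Suc q) :: real poly)"
      unfolding mult_monom q q_def by simp
    then have split: "\<sigma> j + monom 1 (2 * W) * r = monom 1 (wt j) * (1 + monom 1 (Suc q) * r)"
      using j by (simp add: \<sigma>_def algebra_simps)
    have "coeff (1 + monom 1 (Suc q) * r) 0 = 1"
      by (simp add: coeff_mult)
    then show ?thesis by (intro exI[of _ "1 + monom 1 (Suc q) * r"] conjI r[unfolded split])
  qed
  then have "\<forall>j. \<exists>u. j < k \<longrightarrow> (\<forall>\<tau>. f j (\<psi> (\<lambda>i. w i + poly (\<sigma> i) \<tau>)) = poly (monom 1 (wt j) * u) \<tau>)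
      \<and> coeff u 0 = 1" by blast
  from choice[OF this] obtain u where
    u': "\<forall>j. j < k \<longrightarrow> (\<forall>\<tau>. f j (\<psi> (\<lambda>i. w i + poly (\<sigma> i) \<tau>)) = poly (monom 1 (wt j) * u j) \<tau>)
      \<and> coeff (u j) 0 = 1" by (elim exE)
  have u: "\<And>j \<tau>. j < k \<Longrightarrow> f j (\<psi> (\<lambda>i. w i + poly (\<sigma> i) \<tau>)) = poly (monom 1 (wt j) * u j) \<tau>"
    "\<And>j. j < k \<Longrightarrow> coeff (u j) 0 = 1"
    using u'[THEN spec, THEN mp] by (blast dest: conjunct1 conjunct2)+
  define ex where "ex m = (\<Sum>j<k. m j * wt j)" for m
  define U where "U m = (\<Prod>j<k. u j ^ m j)" for m :: "nat \<Rightarrow> nat"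
  have U0: "coeff (U m) 0 = 1" for m
  proof -
    have "coeff (U m) 0 = (\<Prod>j<k. coeff (u j) 0 ^ m j)"
      unfolding poly_0_coeff_0[symmetric] by (simp add: U_def poly_prod)
    then show ?thesis using u(2) by simp
  qed
  have ex_eq: "ex m = W * (\<Sum>j<k. m j) + (\<Sum>j<k. m j * B ^ j)" for m
    by (simp add: ex_def wt_def sum.distrib sum_distrib_left algebra_simps)
  have inj: "m = m'" if mm: "m \<in> S'" "m' \<in> S'" "ex m = ex m'" for m m'
  proof
    fix j
    have lt: "(\<Sum>j<k. m j * B ^ j) < W" "(\<Sum>j<k. m' j * B ^ j) < W"
      unfolding W_def using mm B by (auto intro!: base_expansion_less)
    have "ex m mod W = ex m' mod W" using mm(3) by simp
    then have "(\<Sum>j<k. m j * B ^ j) = (\<Sum>j<k. m' j * B ^ j)" using lt by (simp add: ex_eq)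
    then have "j < k \<Longrightarrow> m j = m' j"
      using base_expansion_unique[of k m B m' j] B mm(1,2) by blast
    then show "m j = m' j" using S'(3)[OF mm(1)] S'(3)[OF mm(2)] by (cases "j < k") auto
  qed
  define P where "P = (\<Sum>m\<in>S'. smult (c m) (monom 1 (ex m) * U m))"
  have "poly P \<tau> = 0" for \<tau>
  proof -
    have pw: "monom 1 a ^ b = (monom 1 (b * a) :: real poly)" for a b :: nat
      by (induction b) (auto simp: mult_monom one_pCons monom_0 add.commute)
    have mon: "(\<Prod>j<k. monom 1 (wt j) ^ m j) = (monom 1 (ex m) :: real poly)" for m
      unfolding ex_def pw
      by (induction k) (auto simp: mult_monom one_pCons monom_0)
    define y where "y = \<psi> (\<lambda>i. w i + poly (\<sigma> i) \<tau>)"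
    have "(\<Prod>j<k. f j y ^ m j) = poly (monom 1 (ex m) * U m) \<tau>" for m
    proof -
      have "(\<Prod>j<k. f j y ^ m j) = (\<Prod>j<k. poly ((monom 1 (wt j) * u j) ^ m j) \<tau>)"
        unfolding y_def by (intro prod.cong) (auto simp: u(1) poly_power)
      also have "\<dots> = poly (\<Prod>j<k. (monom 1 (wt j) * u j) ^ m j) \<tau>"
        by (simp only: poly_prod)
      also have "(\<Prod>j<k. (monom 1 (wt j) * u j) ^ m j) = monom 1 (ex m) * U m"
        by (simp only: power_mult_distrib prod.distrib mon U_def)
      finally show ?thesis .
    qed
    then have "poly P \<tau> = (\<Sum>m\<in>S'. c m * (\<Prod>j<k. f j y ^ m j))"
      by (simp add: P_def poly_sum)
    also have "\<dots> = (\<Sum>m\<in>S. c m * (\<Prod>j<k. f j y ^ m j))"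
      unfolding S'_def using S(1) by (intro sum.mono_neutral_left) auto
    also have "\<dots> = 0"
    proof (rule rel[rule_format])
      show "y \<in> \<psi> ` {x. \<forall>i\<ge>k. x i = w i}" unfolding y_def by (rule imageI) (simp add: \<sigma>_def)
    qed
    finally show ?thesis .
  qed
  then have P0: "P = 0" using poly_all_0_iff_0 by blast
  \<comment> \<open>Among the monomials along the curve the one of least order cannot be cancelled:
    the others have strictly larger order, and the constant coefficient of \<open>U m0\<close> is
    1.\<close>
  obtain m0 where m0: "m0 \<in> S'" "\<And>m. m \<in> S' \<Longrightarrow> ex m0 \<le> ex m"
    using S'(1,2) arg_min_if_finite[of S' ex] by (metis empty_iff not_le)
  have "coeff P (ex m0) = (\<Sum>m\<in>S'. if m = m0 then c m0 else 0)"
    unfolding P_def coeff_sum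
  proof (rule sum.cong)
    fix m assume m: "m \<in> S'"
    have "coeff (monom 1 (ex m) * U m) (ex m0) = (if ex m \<le> ex m0 then coeff (U m) (ex m0 - ex m) else 0)"
      by (simp add: coeff_monom_mult)
    then show "coeff (smult (c m) (monom 1 (ex m) * U m)) (ex m0) = (if m = m0 then c m0 else 0)"
      using m0(2)[OF m] inj[OF m m0(1)] U0[of m] by (cases "m = m0") auto
  qed simp
  also have "\<dots> = c m0" using S' m0 by simp
  finally show False using P0 m0 by (simp add: S'_def)
qed

section \<open>Krull dimension of the closure of a polynomial image\<close>

lemma polynomial_functions_sum:
  assumes "\<And>a. a \<in> A \<Longrightarrow> p a \<in> polynomial_functions D V"
  shows "(\<lambda>F. \<Sum>a\<in>A. p a F) \<in> polynomial_functions D V"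
  using assms
  by (induction A rule: infinite_finite_induct) (auto intro: polynomial_functions.intros)

lemma polynomial_functions_prod:
  assumes "\<And>a. a \<in> A \<Longrightarrow> p a \<in> polynomial_functions D V"
  shows "(\<lambda>F. \<Prod>a\<in>A. p a F) \<in> polynomial_functions D V"
  using assms
  by (induction A rule: infinite_finite_induct) (auto intro: polynomial_functions.intros)

lemma polynomial_functions_cmult:
  "p \<in> polynomial_functions D V \<Longrightarrow> (\<lambda>F. c * p F) \<in> polynomial_functions D V"
  by (intro polynomial_functions.mult polynomial_functions.const)

lemma polynomial_functions_power:
  assumes "p \<in> polynomial_functions D V"
  shows "(\<lambda>F. p F ^ n) \<in> polynomial_functions D V"
  using polynomial_functions_prod[of "{..<n}" "\<lambda>_. p" D V] assms by simp

lemma closure_of_zariski: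
  assumes "S \<subseteq> V"
  shows "zariski_topology D V closure_of S =
    {F \<in> V. \<forall>p\<in>polynomial_functions D V. (\<forall>G\<in>S. p G = 0) \<longrightarrow> p F = 0}" (is "?T closure_of S = ?R")
proof (rule closure_of_unique)
  show "S \<subseteq> ?R" using assms by auto
  show "closedin ?T ?R" unfolding closedin_zariski zero_locus_def
    by (rule exI[of _ "{p \<in> polynomial_functions D V. \<forall>G\<in>S. p G = 0}"]) auto
  show "?R \<subseteq> C" if C: "S \<subseteq> C" "closedin ?T C" for C
  proof -
    obtain P where "P \<subseteq> polynomial_functions D V" "C = zero_locus V P"
      using C(2) unfolding closedin_zariski by blast
    then show ?thesis using C(1) unfolding zero_locus_def by blast
  qed
qed

lemma irreducible_in_subtopology:
  assumes "closedin T C"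
  shows "irreducible_in (subtopology T C) Z \<longleftrightarrow> irreducible_in T Z \<and> Z \<subseteq> C"
proof (intro iffI conjI)
  have C: "C \<subseteq> topspace T" using assms by (rule closedin_subset)
  have top: "topspace (subtopology T C) = C" using C by auto
  {
    assume irr: "irreducible_in (subtopology T C) Z"
    then show Z: "Z \<subseteq> C" unfolding irreducible_in_def top by blast
    show "irreducible_in T Z"
      unfolding irreducible_in_def
    proof (intro conjI allI impI)
      show "Z \<subseteq> topspace T" using Z C by blast
      show "Z \<noteq> {}" using irr unfolding irreducible_in_def by blast
      fix A B assume AB: "closedin T A" "closedin T B" "Z \<subseteq> A \<union> B"
      have "closedin (subtopology T C) (A \<inter> C)" "closedin (subtopology T C) (B \<inter> C)"
        using AB assms by (auto simp: closedin_closed_subtopology)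
      moreover have "Z \<subseteq> (A \<inter> C) \<union> (B \<inter> C)" using AB Z by blast
      ultimately have "Z \<subseteq> A \<inter> C \<or> Z \<subseteq> B \<inter> C"
        using irr unfolding irreducible_in_def by blast
      then show "Z \<subseteq> A \<or> Z \<subseteq> B" by blast
    qed
  }
  assume "irreducible_in T Z \<and> Z \<subseteq> C"
  then show "irreducible_in (subtopology T C) Z"
    unfolding irreducible_in_def top closedin_closed_subtopology[OF assms] by blast
qed

lemma krull_dimension_closed_subspace:
  assumes "closedin T C"
  shows "krull_dimension (subtopology T C) =
    Sup {enat n | n. \<exists>Z. (\<forall>i\<le>n. closedin T (Z i) \<and> irreducible_in T (Z i) \<and> Z i \<subseteq> C) \<and>
                         (\<forall>i<n. Z i \<subset> Z (Suc i))}"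
  unfolding krull_dimension_def irreducible_in_subtopology[OF assms]
    closedin_closed_subtopology[OF assms] by (simp only: conj_ac conj_absorb conj_left_absorb)

text \<open>A function \<open>g\<close> vanishing on \<open>Z\<close> but not on \<open>Z'\<close> extends an independent family: the largest
  power of \<open>g\<close> can be split off a relation on \<open>Z'\<close>, after which the relation restricts to \<open>Z\<close>.\<close>

lemma algebraically_independent_on_extend:
  assumes Z: "closedin (zariski_topology D V) Z"
    and Z': "irreducible_in (zariski_topology D V) Z'" and "Z \<subset> Z'"
    and f: "\<And>j. j < k \<Longrightarrow> f j \<in> polynomial_functions D V"
    and indep: "algebraically_independent_on k f Z"
  shows "\<exists>g\<in>polynomial_functions D V. algebraically_independent_on (Suc k) (f(k := g)) Z'"
proof -
  have Z'V: "Z' \<subseteq> V" using Z' unfolding irreducible_in_def topspace_zariski by blast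
  obtain P where P: "P \<subseteq> polynomial_functions D V" "Z = zero_locus V P"
    using Z unfolding closedin_zariski by blast
  obtain F0 where F0: "F0 \<in> Z'" "F0 \<notin> Z" using \<open>Z \<subset> Z'\<close> by blast
  then obtain g where g: "g \<in> polynomial_functions D V" "g F0 \<noteq> 0" "\<And>F. F \<in> Z \<Longrightarrow> g F = 0"
    using P Z'V unfolding zero_locus_def by blast
  have "algebraically_independent_on (Suc k) (f(k := g)) Z'"
    unfolding algebraically_independent_on_def
  proof (intro allI impI ballI, rule ccontr)
    fix S c m1
    assume S: "finite S" "S \<subseteq> {m. \<forall>j\<ge>Suc k. m j = (0::nat)}"
      and rel: "\<forall>F\<in>Z'. (\<Sum>m\<in>S. c m * (\<Prod>j<Suc k. (f(k := g)) j F ^ m j)) = 0"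
      and m1: "m1 \<in> S" "c m1 \<noteq> 0"
    define S' where "S' = {m \<in> S. c m \<noteq> 0}"
    have S': "finite S'" "m1 \<in> S'" using S m1 unfolding S'_def by auto
    obtain m0 where m0: "m0 \<in> S'" "\<And>m. m \<in> S' \<Longrightarrow> m0 k \<le> m k"
      using S' arg_min_if_finite[of S' "\<lambda>m. m k"] by (metis empty_iff not_le)
    define r where "r = m0 k"
    define Q where "Q F = (\<Sum>m\<in>S'. c m * ((\<Prod>j<k. f j F ^ m j) * g F ^ (m k - r)))" for F
    have split: "g F ^ r * Q F = 0" if "F \<in> Z'" for F
    proof -
      have "g F ^ r * Q F = (\<Sum>m\<in>S'. c m * ((\<Prod>j<k. f j F ^ m j) * g F ^ m k))"
        unfolding Q_def sum_distrib_left
      proof (rule sum.cong)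
        fix m assume "m \<in> S'"
        then have "g F ^ m k = g F ^ r * g F ^ (m k - r)"
          using m0(2) unfolding r_def by (simp add: power_add[symmetric])
        then show "g F ^ r * (c m * ((\<Prod>j<k. f j F ^ m j) * g F ^ (m k - r))) =
          c m * ((\<Prod>j<k. f j F ^ m j) * g F ^ m k)" by (simp only: ac_simps)
      qed simp
      also have "\<dots> = (\<Sum>m\<in>S. c m * ((\<Prod>j<k. f j F ^ m j) * g F ^ m k))"
        unfolding S'_def using S(1) by (intro sum.mono_neutral_left) auto
      also have "\<dots> = (\<Sum>m\<in>S. c m * (\<Prod>j<Suc k. (f(k := g)) j F ^ m j))" by simp
      also have "\<dots> = 0" using rel that by blast
      finally show ?thesis .
    qed
    have "Q \<in> polynomial_functions D V" unfolding Q_def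
      using f g(1) by (intro polynomial_functions_sum polynomial_functions_cmult
          polynomial_functions.mult polynomial_functions_prod polynomial_functions_power) auto
    then have "closedin (zariski_topology D V) (zero_locus V {Q})"
      "closedin (zariski_topology D V) (zero_locus V {g})"
      unfolding closedin_zariski using g(1) by blast+
    moreover have "Z' \<subseteq> zero_locus V {Q} \<union> zero_locus V {g}"
      using split Z'V unfolding zero_locus_def by auto
    \<comment> \<open>Irreducibility replaces the cancellation of g^r: since \<open>g F0\<close> is
      nonzero, \<open>Z'\<close> has to lie in the zero locus of \<open>Q\<close>.\<close>
    ultimately have "Z' \<subseteq> zero_locus V {Q} \<or> Z' \<subseteq> zero_locus V {g}"
      using Z' unfolding irreducible_in_def by blast
    then have Q0: "Q F = 0" if "F \<in> Z'" for F
      using F0 g(2) that unfolding zero_locus_def by blast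
    define S0 where "S0 = {m \<in> S'. m k = r}"
    \<comment> \<open>On \<open>S0\<close> the last exponent is always \<open>r\<close>, so it can
      be forgotten; on \<open>Z\<close> all other terms still carry a factor \<open>g\<close> and
      vanish.\<close>
    define res where "res m = m(k := 0)" for m :: "nat \<Rightarrow> nat"
    have res: "inj_on res S0"
      unfolding inj_on_def S0_def res_def by (auto simp: fun_eq_iff split: if_splits) metis
    have "c ((\<lambda>m. m(k := r)) (res m0)) = 0"
    proof (rule algebraically_independent_onD[OF indep, of "res ` S0" "\<lambda>m. c (m(k := r))"])
      show "finite (res ` S0)" using S' by (simp add: S0_def)
      show "res ` S0 \<subseteq> {m. \<forall>j\<ge>k. m j = 0}"
        using S(2) by (auto simp: S0_def S'_def res_def subset_iff Suc_le_eq)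
      show "res m0 \<in> res ` S0" using m0(1) by (simp add: S0_def r_def)
      fix F assume F: "F \<in> Z"
      have "(\<Sum>m\<in>res ` S0. c (m(k := r)) * (\<Prod>j<k. f j F ^ m j)) =
          (\<Sum>m\<in>S0. c m * (\<Prod>j<k. f j F ^ m j))"
        unfolding sum.reindex[OF res]
      proof (rule sum.cong)
        fix m assume "m \<in> S0"
        then have "(res m)(k := r) = m" by (auto simp: S0_def res_def)
        then show "((\<lambda>m. c (m(k := r)) * (\<Prod>j<k. f j F ^ m j)) \<circ> res) m =
            c m * (\<Prod>j<k. f j F ^ m j)" by (simp add: res_def)
      qed simp
      also have "\<dots> = (\<Sum>m\<in>S0. c m * ((\<Prod>j<k. f j F ^ m j) * g F ^ (m k - r)))"
        by (simp add: S0_def)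
      also have "\<dots> = Q F"
        unfolding Q_def
      proof (rule sum.mono_neutral_left)
        show "\<forall>m\<in>S' - S0. c m * ((\<Prod>j<k. f j F ^ m j) * g F ^ (m k - r)) = 0"
        proof
          fix m assume "m \<in> S' - S0"
          then have "r < m k" using m0(2)[of m] unfolding S0_def r_def by auto
          then show "c m * ((\<Prod>j<k. f j F ^ m j) * g F ^ (m k - r)) = 0"
            using g(3)[OF F] by simp
        qed
      qed (use S' in \<open>auto simp: S0_def\<close>)
      also have "\<dots> = 0" using Q0 F \<open>Z \<subset> Z'\<close> by blast
      finally show "(\<Sum>m\<in>res ` S0. c (m(k := r)) * (\<Prod>j<k. f j F ^ m j)) = 0" .
    qed
    moreover have "(\<lambda>m. m(k := r)) (res m0) = m0" by (auto simp: res_def r_def)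
    ultimately show False using m0(1) by (simp add: S'_def)
  qed
  then show ?thesis using g(1) by blast
qed

lemma algebraically_independent_on_mono:
  assumes "algebraically_independent_on k f Z" "Z \<subseteq> Z'"
  shows "algebraically_independent_on k f Z'"
  unfolding algebraically_independent_on_def
proof (intro allI impI ballI)
  fix S c m
  assume S: "finite S" "S \<subseteq> {m. \<forall>j\<ge>k. m j = (0::nat)}" and m: "m \<in> S"
    and rel: "\<forall>x\<in>Z'. (\<Sum>m\<in>S. c m * (\<Prod>j<k. f j x ^ m j)) = 0"
  show "c m = 0"
    by (rule algebraically_independent_onD[OF assms(1) S _ m]) (rule rel[rule_format, OF subsetD[OF assms(2)]])
qed

text \<open>Otherwise some \<open>p\<close> and \<open>q\<close> defining \<open>A\<close> and
  \<open>B\<close> are nonzero at the images of two parameters \<open>x\<close> and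
  \<open>y\<close>. On the line through these parameters they become nonzero univariate polynomials
  whose product vanishes everywhere.\<close>

lemma irreducible_in_closure_image:
  fixes \<psi> :: "('i \<Rightarrow> real) \<Rightarrow> real mat \<Rightarrow> real mat"
  assumes \<psi>: "\<psi> ` L \<subseteq> V" and "L \<noteq> {}"
    and poly: "\<And>p. p \<in> polynomial_functions D V \<Longrightarrow> (\<lambda>x. p (\<psi> x)) \<in> polynomial_on I"
    and line: "\<And>x y \<tau>. x \<in> L \<Longrightarrow> y \<in> L \<Longrightarrow> (\<lambda>i. x i + \<tau> * (y i - x i)) \<in> L"
  shows "irreducible_in (zariski_topology D V) (zariski_topology D V closure_of (\<psi> ` L))"
    (is "irreducible_in ?T ?Z")
  unfolding irreducible_in_def
proof (intro conjI allI impI)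
  show "?Z \<subseteq> topspace ?T" by (rule closure_of_subset_topspace)
  have sub: "\<psi> ` L \<subseteq> ?Z" using \<psi> by (intro closure_of_subset) (simp add: topspace_zariski)
  then show "?Z \<noteq> {}" using \<open>L \<noteq> {}\<close> by blast
  fix A B assume AB: "closedin ?T A" "closedin ?T B" "?Z \<subseteq> A \<union> B"
  obtain P Q where P: "P \<subseteq> polynomial_functions D V" "A = zero_locus V P"
    and Q: "Q \<subseteq> polynomial_functions D V" "B = zero_locus V Q"
    using AB(1,2) unfolding closedin_zariski by blast
  show "?Z \<subseteq> A \<or> ?Z \<subseteq> B"
  proof (rule ccontr)
    assume "\<not> ?thesis"
    then have "\<not> \<psi> ` L \<subseteq> A" "\<not> \<psi> ` L \<subseteq> B"
      using closure_of_minimal[of _ A ?T] closure_of_minimal[of _ B ?T] AB by blast+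
    then obtain x y where xy: "x \<in> L" "\<psi> x \<notin> A" "y \<in> L" "\<psi> y \<notin> B" by blast
    then obtain p q where pq: "p \<in> P" "p (\<psi> x) \<noteq> 0" "q \<in> Q" "q (\<psi> y) \<noteq> 0"
      using P Q \<psi> unfolding zero_locus_def by blast
    define g where "g i \<tau> = x i + \<tau> * (y i - x i)" for i \<tau>
    have gpoly: "\<exists>p. \<forall>\<tau>. g i \<tau> = poly p \<tau>" for i
      by (rule exI[of _ "[:x i, y i - x i:]"]) (simp add: g_def)
    have "p \<in> polynomial_functions D V" "q \<in> polynomial_functions D V" using P Q pq by blast+
    note pq_in = this
    obtain a where a: "\<forall>\<tau>. p (\<psi> (\<lambda>i. g i \<tau>)) = poly a \<tau>"
      using polynomial_on_univariate[OF poly[OF pq_in(1)], where g = g, OF gpoly] by (elim exE)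
    obtain b where b: "\<forall>\<tau>. q (\<psi> (\<lambda>i. g i \<tau>)) = poly b \<tau>"
      using polynomial_on_univariate[OF poly[OF pq_in(2)], where g = g, OF gpoly] by (elim exE)
    note ab = a b
    have "poly a 0 \<noteq> 0" "poly b 1 \<noteq> 0"
      using pq ab(1)[rule_format, of 0] ab(2)[rule_format, of 1] by (simp_all add: g_def)
    then have "a * b \<noteq> 0" by auto
    moreover have "poly (a * b) \<tau> = 0" for \<tau>
    proof -
      have "(\<lambda>i. g i \<tau>) \<in> L" using line xy unfolding g_def by blast
      then have "\<psi> (\<lambda>i. g i \<tau>) \<in> A \<union> B" using AB(3) sub by blast
      then have "p (\<psi> (\<lambda>i. g i \<tau>)) = 0 \<or> q (\<psi> (\<lambda>i. g i \<tau>)) = 0"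
        using P Q pq unfolding zero_locus_def by blast
      then show ?thesis using ab by auto
    qed
    ultimately show False using poly_all_0_iff_0 by blast
  qed
qed

text \<open>By immersion the gradients at \<open>w\<close> of the pulled-back polynomial functions
  have zero annihilator. A dual basis of gradients yields functions whose pullbacks agree with the
  coordinates relative to \<open>w\<close> to first order. The chain consists of the closures of the
  images of the slices through \<open>w\<close> in which only the first \<open>k\<close> coordinates
  are free.\<close>

lemma zariski_closure_dimension_image:
  fixes \<psi> :: "(nat \<Rightarrow> real) \<Rightarrow> real mat \<Rightarrow> real mat" and w :: "nat \<Rightarrow> real"
  assumes \<psi>: "range \<psi> \<subseteq> V"
    and poly: "\<And>p. p \<in> polynomial_functions D V \<Longrightarrow> (\<lambda>x. p (\<psi> x)) \<in> polynomial_on {..<n}"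
    and immersion: "\<And>v. (\<And>p. p \<in> polynomial_functions D V \<Longrightarrow>
        ((\<lambda>s. p (\<psi> (\<lambda>i. w i + s * v i))) has_real_derivative 0) (at 0)) \<Longrightarrow> \<forall>i<n. v i = 0"
  shows "zariski_closure_dimension D V (range \<psi>) = enat n"
proof -
  define T where "T = zariski_topology D V"
  define C where "C = T closure_of (range \<psi>)"
  have closedC: "closedin T C" by (simp add: C_def)
  define L where "L k = {x. \<forall>i\<ge>k. x i = w i}" for k
  have clos: "T closure_of S = {F \<in> V. \<forall>p\<in>polynomial_functions D V. (\<forall>G\<in>S. p G = 0) \<longrightarrow> p F = 0}"
    if "S \<subseteq> V" for S unfolding T_def by (rule closure_of_zariski[OF that])
  \<comment> \<open>A relation among the \<open>f j\<close> is a single polynomial function, so it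
    vanishes on the closure as soon as it vanishes on \<open>S\<close>.\<close>
  have transfer: "algebraically_independent_on k f S"
    if SV: "S \<subseteq> V" and f: "\<And>j. j < k \<Longrightarrow> f j \<in> polynomial_functions D V"
      and ai: "algebraically_independent_on k f (T closure_of S)" for k f S
    unfolding algebraically_independent_on_def
  proof (intro allI impI ballI)
    fix M c m assume M: "finite M" "M \<subseteq> {m. \<forall>j\<ge>k. m j = (0::nat)}"
      "\<forall>x\<in>S. (\<Sum>m\<in>M. c m * (\<Prod>j<k. f j x ^ m j)) = 0" "m \<in> M"
    define q where "q F = (\<Sum>m\<in>M. c m * (\<Prod>j<k. f j F ^ m j))" for F
    have "q \<in> polynomial_functions D V"
      unfolding q_def using f by (intro polynomial_functions_sum polynomial_functions_cmult
          polynomial_functions_prod polynomial_functions_power) auto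
    moreover have "\<forall>G\<in>S. q G = 0" using M(3) unfolding q_def .
    ultimately have q0: "q F = 0" if "F \<in> T closure_of S" for F
      using that unfolding clos[OF SV] by blast
    show "c m = 0"
      by (rule algebraically_independent_onD[OF ai M(1,2) _ M(4)]) (rule q0[unfolded q_def])
  qed
  have upper: "N \<le> n" if Z: "\<And>i. i \<le> N \<Longrightarrow> closedin T (Z i) \<and> irreducible_in T (Z i) \<and> Z i \<subseteq> C"
      "\<And>i. i < N \<Longrightarrow> Z i \<subset> Z (Suc i)" for N Z
  proof -
    have "i \<le> N \<Longrightarrow> \<exists>f. (\<forall>j<i. f j \<in> polynomial_functions D V) \<and> algebraically_independent_on i f (Z i)" for i
    proof (induction i)
      case 0
      \<comment> \<open>The empty family is independent on \<open>Z 0\<close> because the empty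
        product is 1 and there is a point at which to evaluate it.\<close>
      have ne: "Z 0 \<noteq> {}" using Z(1)[of 0] unfolding irreducible_in_def by simp
      have "algebraically_independent_on 0 f (Z 0)" for f
        unfolding algebraically_independent_on_def
      proof (intro allI impI ballI)
        fix S :: "(nat \<Rightarrow> nat) set" and c m
        assume S: "finite S" "S \<subseteq> {m. \<forall>j\<ge>0. m j = 0}"
          and rel: "\<forall>x\<in>Z 0. (\<Sum>m\<in>S. c m * (\<Prod>j<0. f j x ^ m j)) = 0" and m: "m \<in> S"
        have "m' = (\<lambda>_. 0)" if "m' \<in> S" for m'
          using S(2) that by (auto simp: fun_eq_iff)
        then have "S = {m}" using m by blast
        then show "c m = 0" using rel ne by auto
      qed
      then show ?case by simp
    next
      case (Suc i)
      then obtain f where f: "\<forall>j<i. f j \<in> polynomial_functions D V"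
        "algebraically_independent_on i f (Z i)" by auto
      have "\<exists>g\<in>polynomial_functions D V. algebraically_independent_on (Suc i) (f(i := g)) (Z (Suc i))"
        by (rule algebraically_independent_on_extend[of D V "Z i"])
          (use f Z(1)[of i] Z(1)[of "Suc i"] Z(2)[of i] Suc.prems in \<open>auto simp: T_def\<close>)
      then obtain g where "g \<in> polynomial_functions D V"
        "algebraically_independent_on (Suc i) (f(i := g)) (Z (Suc i))" by blast
      moreover have "\<forall>j<Suc i. (f(i := g)) j \<in> polynomial_functions D V"
        using f(1) calculation(1) by (auto simp: less_Suc_eq)
      ultimately show ?case by blast
    qed
    then obtain f where f: "\<forall>j<N. f j \<in> polynomial_functions D V"
        "algebraically_independent_on N f (Z N)" by blast
    have "Z N \<subseteq> C" using Z(1) by blast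
    then have "algebraically_independent_on N f C"
      using algebraically_independent_on_mono[OF f(2)] by blast
    then have "algebraically_independent_on N f (range \<psi>)"
      unfolding C_def by (intro transfer[OF \<psi>]) (simp_all add: f(1))
    from algebraically_independent_on_range_le[OF _ _ this, of "{..<n}"] show "N \<le> n"
      using poly f(1) by simp
  qed
  obtain f where f: "\<And>j. j < n \<Longrightarrow> f j \<in> polynomial_functions D V"
    and jet: "\<And>j W \<sigma>. j < n \<Longrightarrow> \<forall>i<n. monom 1 W dvd \<sigma> i \<Longrightarrow>
      \<exists>r. \<forall>\<tau>. f j (\<psi> (\<lambda>i. w i + poly (\<sigma> i) \<tau>)) = poly (\<sigma> j + monom 1 (2 * W) * r) \<tau>"
  proof -
    define jetp where "jetp p \<gamma> = has_jet {..<n} w (\<lambda>x. p (\<psi> x)) \<gamma>" for p \<gamma>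
    have jetp_ex: "\<exists>\<gamma>. jetp p \<gamma>" if "p \<in> polynomial_functions D V" for p
      unfolding jetp_def by (rule polynomial_on_has_jet[OF finite_lessThan poly[OF that]])
    have jetp_cmult: "jetp (\<lambda>F. c * p F) (\<lambda>i. c * \<gamma> i)" if "jetp p \<gamma>" for c p \<gamma>
      using has_jet_mult[OF has_jet_const[of _ _ c] that[unfolded jetp_def]] unfolding jetp_def by simp
    have jetp_add: "jetp (\<lambda>F. p F + q F) (\<lambda>i. \<gamma> i + \<gamma>' i)" if "jetp p \<gamma>" "jetp q \<gamma>'" for p q \<gamma> \<gamma>'
      using that unfolding jetp_def by (rule has_jet_add)
    have const: "jetp (\<lambda>_. c) (\<lambda>_. 0)" for c
      unfolding jetp_def by (rule has_jet_const)
    define U where "U = {\<gamma>. \<exists>p\<in>polynomial_functions D V. jetp p \<gamma>}"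
    have "\<exists>e. \<forall>j\<in>{..<n}. e j \<in> U \<and> (\<forall>i\<in>{..<n}. e j i = of_bool (i = j))"
    proof (rule exists_dual_basis)
      show "(\<lambda>_. 0) \<in> U" unfolding U_def using const[of 0] polynomial_functions.const[of 0] by blast
      show "(\<lambda>i. u i + v i) \<in> U" if uv: "u \<in> U" "v \<in> U" for u v
      proof -
        obtain p q where pq: "p \<in> polynomial_functions D V" "jetp p u" "q \<in> polynomial_functions D V" "jetp q v"
          using uv unfolding U_def by blast
        show ?thesis unfolding U_def using jetp_add[OF pq(2,4)] polynomial_functions.add[OF pq(1,3)] by blast
      qed
      show "(\<lambda>i. c * u i) \<in> U" if u: "u \<in> U" for c u
      proof -
        obtain p where p: "p \<in> polynomial_functions D V" "jetp p u"
          using u unfolding U_def by blast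
        show ?thesis unfolding U_def using jetp_cmult[OF p(2)] polynomial_functions_cmult[OF p(1)] by blast
      qed
      show "\<forall>i\<in>{..<n}. v i = 0" if v: "\<And>u. u \<in> U \<Longrightarrow> (\<Sum>i<n. u i * v i) = 0" for v
      proof -
        have "((\<lambda>s. p (\<psi> (\<lambda>i. w i + s * v i))) has_real_derivative 0) (at 0)"
          if p: "p \<in> polynomial_functions D V" for p
        proof -
          obtain \<gamma> where \<gamma>: "jetp p \<gamma>" using jetp_ex[OF p] by blast
          then have "(\<Sum>i<n. \<gamma> i * v i) = 0" using v p unfolding U_def by blast
          then show ?thesis using has_jet_deriv[OF \<gamma>[unfolded jetp_def], of v] by simp
        qed
        from immersion[OF this] show ?thesis by simp
      qed
    qed simp
    then obtain e where e: "\<And>j. j < n \<Longrightarrow> e j \<in> U" "\<And>i j. j < n \<Longrightarrow> i < n \<Longrightarrow> e j i = of_bool (i = j)"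
      by auto
    then have "\<forall>j. \<exists>p. j < n \<longrightarrow> p \<in> polynomial_functions D V \<and> jetp p (e j)"
      unfolding U_def by blast
    then obtain p where p: "\<And>j. j < n \<Longrightarrow> p j \<in> polynomial_functions D V" "\<And>j. j < n \<Longrightarrow> jetp (p j) (e j)"
      by metis
    \<comment> \<open>Subtracting the value at the base point makes the expansion along a curve
      start with \<sigma> j.\<close>
    define f where "f j F = p j F + - p j (\<psi> w)" for j F
    have f: "f j \<in> polynomial_functions D V" if "j < n" for j
      unfolding f_def by (intro polynomial_functions.add polynomial_functions.const p(1)[OF that])
    show ?thesis
    proof (rule that[OF f])
      fix j W and \<sigma> :: "nat \<Rightarrow> real poly" assume j: "j < n" and d: "\<forall>i<n. monom 1 W dvd \<sigma> i"
      have jf: "jetp (f j) (\<lambda>i. e j i + 0)"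
        unfolding f_def by (rule jetp_add[OF p(2)[OF j] const])
      have d': "\<forall>i\<in>{..<n}. monom 1 W dvd \<sigma> i" using d by simp
      have "(\<Sum>i\<in>{..<n}. smult (e j i + 0) (\<sigma> i)) = (\<Sum>i\<in>{..<n}. if i = j then \<sigma> i else 0)"
        using e(2)[OF j] by (intro sum.cong) auto
      then have S: "(\<Sum>i\<in>{..<n}. smult (e j i + 0) (\<sigma> i)) = \<sigma> j" using j by simp
      have 0: "f j (\<psi> w) = 0" by (simp add: f_def)
      show "\<exists>r. \<forall>\<tau>. f j (\<psi> (\<lambda>i. w i + poly (\<sigma> i) \<tau>)) = poly (\<sigma> j + monom 1 (2 * W) * r) \<tau>"
        using has_jetD[OF jf[unfolded jetp_def] d'] unfolding S 0 by simp
    qed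
  qed
  define Z where "Z k = T closure_of (\<psi> ` L k)" for k
  have LV: "\<psi> ` L k \<subseteq> V" for k using \<psi> by blast
  have indep: "algebraically_independent_on k f (\<psi> ` L k)" if "k \<le> n" for k
    unfolding L_def using that by (intro algebraically_independent_on_slice[of k n] jet) auto
  \<comment> \<open>This makes the chain strict: the slice \<open>L k\<close> has \<open>k\<close>
    free parameters, so counting monomials excludes \<open>k + 1\<close> independent functions on
    its image, whereas the image of \<open>L (Suc k)\<close> carries them.\<close>
  have not_indep: "\<not> algebraically_independent_on (Suc k) f (\<psi> ` L k)" if "k < n" for k
  proof
    define cut where "cut x i = (if i < k then x i else w i)" for x :: "nat \<Rightarrow> real" and i
    have "\<psi> ` L k = range (\<lambda>x. \<psi> (cut x))"
    proof (intro equalityI image_subsetI)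
      fix x assume "x \<in> L k"
      then have "cut x = x" by (auto simp: cut_def L_def fun_eq_iff)
      then show "\<psi> x \<in> range (\<lambda>x. \<psi> (cut x))" by (metis rangeI)
    next
      fix x show "\<psi> (cut x) \<in> \<psi> ` L k" by (rule imageI) (simp add: cut_def L_def)
    qed
    moreover assume "algebraically_independent_on (Suc k) f (\<psi> ` L k)"
    ultimately have ai: "algebraically_independent_on (Suc k) f (range (\<lambda>x. \<psi> (cut x)))" by simp
    have "(\<lambda>x. f j (\<psi> (cut x))) \<in> polynomial_on {..<k}" if "j < Suc k" for j
    proof -
      have "(\<lambda>x. cut x i) \<in> polynomial_on {..<k}" for i
        unfolding cut_def by (cases "i < k") (auto intro: polynomial_on.intros)
      from polynomial_on_subst[OF poly[OF f], of j "\<lambda>i x. cut x i", OF _ this] that \<open>k < n\<close>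
      show ?thesis by simp
    qed
    from algebraically_independent_on_range_le[OF _ this ai] show False by simp
  qed
  have chain: "Z k \<subset> Z (Suc k)" if "k < n" for k
  proof
    show "Z k \<subseteq> Z (Suc k)" unfolding Z_def by (intro closure_of_mono image_mono) (auto simp: L_def)
    show "Z k \<noteq> Z (Suc k)"
    proof
      assume eq: "Z k = Z (Suc k)"
      have "\<psi> ` L (Suc k) \<subseteq> Z (Suc k)"
        unfolding Z_def using LV by (intro closure_of_subset) (simp add: T_def topspace_zariski)
      then have "algebraically_independent_on (Suc k) f (Z (Suc k))"
        using algebraically_independent_on_mono[OF indep[of "Suc k"]] that by simp
      then have "algebraically_independent_on (Suc k) f (T closure_of (\<psi> ` L k))"
        using eq unfolding Z_def by simp
      then have "algebraically_independent_on (Suc k) f (\<psi> ` L k)"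
        using that f by (intro transfer[OF LV]) auto
      then show False using not_indep[OF that] by blast
    qed
  qed
  have Zprop: "closedin T (Z k) \<and> irreducible_in T (Z k) \<and> Z k \<subseteq> C" for k
  proof (intro conjI)
    show "closedin T (Z k)" by (simp add: Z_def)
    show "Z k \<subseteq> C" unfolding Z_def C_def by (intro closure_of_mono) auto
    show "irreducible_in T (Z k)" unfolding Z_def T_def
    proof (rule irreducible_in_closure_image[OF LV _ poly])
      show "L k \<noteq> {}" by (auto simp: L_def)
      show "(\<lambda>i. x i + \<tau> * (y i - x i)) \<in> L k" if "x \<in> L k" "y \<in> L k" for x y \<tau>
        using that by (simp add: L_def)
    qed
  qed
  have "krull_dimension (subtopology T C) = enat n"
    unfolding krull_dimension_closed_subspace[OF closedC]
  proof (rule antisym)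
    show "Sup {enat n | n. \<exists>Z. (\<forall>i\<le>n. closedin T (Z i) \<and> irreducible_in T (Z i) \<and> Z i \<subseteq> C) \<and>
        (\<forall>i<n. Z i \<subset> Z (Suc i))} \<le> enat n"
    proof (rule Sup_least, elim CollectE exE conjE)
      fix x N Z
      assume x: "x = enat N" and Z: "\<forall>i\<le>N. closedin T (Z i) \<and> irreducible_in T (Z i) \<and> Z i \<subseteq> C"
        "\<forall>i<N. Z i \<subset> Z (Suc i)"
      have "N \<le> n" by (rule upper[of N Z]) (use Z in simp_all)
      then show "x \<le> enat n" unfolding x by simp
    qed
    show "enat n \<le> Sup {enat n | n. \<exists>Z. (\<forall>i\<le>n. closedin T (Z i) \<and> irreducible_in T (Z i) \<and> Z i \<subseteq> C) \<and>
        (\<forall>i<n. Z i \<subset> Z (Suc i))}"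
    proof (rule Sup_upper, intro CollectI exI conjI)
      show "\<forall>i\<le>n. closedin T (Z i) \<and> irreducible_in T (Z i) \<and> Z i \<subseteq> C" using Zprop by blast
      show "\<forall>i<n. Z i \<subset> Z (Suc i)" using chain by blast
    qed (rule refl)
  qed
  then show ?thesis unfolding zariski_closure_dimension_def C_def T_def .
qed

section \<open>Families of homogeneous polynomial maps\<close>

definition monomials :: "nat \<Rightarrow> nat \<Rightarrow> nat \<Rightarrow> (nat \<times> nat) multiset set" where
  "monomials m n k = {M. size M = k \<and> set_mset M \<subseteq> {..<m} \<times> {..<n}}"

lemma finite_monomials: "finite (monomials m n k)"
proof -
  have "monomials m n k \<subseteq> mset ` {xs. set xs \<subseteq> {..<m} \<times> {..<n} \<and> length xs = k}"
  proof
    fix M assume M: "M \<in> monomials m n k"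
    obtain xs where "M = mset xs" by (metis ex_mset)
    then show "M \<in> mset ` {xs. set xs \<subseteq> {..<m} \<times> {..<n} \<and> length xs = k}"
      using M unfolding monomials_def by auto
  qed
  then show ?thesis by (rule finite_subset) (intro finite_imageI finite_lists_length_eq, simp)
qed

text \<open>Homogeneous in the entries of \<open>X\<close>, with coefficients polynomial in the
  parameters. Tracking both at once gives membership in \<open>hom_poly_maps\<close> and the
  polynomial dependence on the weights from one induction over the layers.\<close>

definition param_form ::
    "'i set \<Rightarrow> nat \<Rightarrow> nat \<Rightarrow> nat \<Rightarrow> (('i \<Rightarrow> real) \<Rightarrow> real mat \<Rightarrow> real) \<Rightarrow> bool" where
  "param_form I m n k f \<longleftrightarrow>
     (\<exists>c. (\<forall>M. c M \<in> polynomial_on I) \<and>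
        (\<forall>x. \<forall>X\<in>carrier_mat m n. f x X = (\<Sum>M\<in>monomials m n k. c M x * (\<Prod>p\<in>#M. X $$ p))))"

lemma param_form_cong:
  assumes "\<And>x X. X \<in> carrier_mat m n \<Longrightarrow> f x X = g x X"
  shows "param_form I m n k f \<longleftrightarrow> param_form I m n k g"
  unfolding param_form_def using assms by (intro ex_cong1) auto

lemma param_form_zero: "param_form I m n k (\<lambda>x X. 0)"
  unfolding param_form_def by (intro exI[of _ "\<lambda>_ _. 0"]) (auto intro: polynomial_on.const)

lemma param_form_add:
  assumes "param_form I m n k f" "param_form I m n k g"
  shows "param_form I m n k (\<lambda>x X. f x X + g x X)"
proof -
  obtain c where c: "\<And>M. c M \<in> polynomial_on I"
    "\<And>x X. X \<in> carrier_mat m n \<Longrightarrow> f x X = (\<Sum>M\<in>monomials m n k. c M x * (\<Prod>p\<in>#M. X $$ p))"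
    using assms(1) unfolding param_form_def by blast
  obtain c' where c': "\<And>M. c' M \<in> polynomial_on I"
    "\<And>x X. X \<in> carrier_mat m n \<Longrightarrow> g x X = (\<Sum>M\<in>monomials m n k. c' M x * (\<Prod>p\<in>#M. X $$ p))"
    using assms(2) unfolding param_form_def by blast
  show ?thesis unfolding param_form_def
  proof (intro exI[of _ "\<lambda>M x. c M x + c' M x"] conjI allI ballI)
    show "(\<lambda>x. c M x + c' M x) \<in> polynomial_on I" for M
      by (rule polynomial_on.add[OF c(1) c'(1)])
  qed (simp add: c(2) c'(2) sum.distrib distrib_right)
qed

lemma param_form_sum:
  assumes "\<And>a. a \<in> A \<Longrightarrow> param_form I m n k (f a)"
  shows "param_form I m n k (\<lambda>x X. \<Sum>a\<in>A. f a x X)"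
  using assms
  by (induction A rule: infinite_finite_induct) (auto intro: param_form_zero param_form_add)

lemma param_form_mult:
  assumes "param_form I m n k f" "param_form I m n k' g"
  shows "param_form I m n (k + k') (\<lambda>x X. f x X * g x X)"
proof -
  obtain c where c: "\<And>M. c M \<in> polynomial_on I"
    "\<And>x X. X \<in> carrier_mat m n \<Longrightarrow> f x X = (\<Sum>M\<in>monomials m n k. c M x * (\<Prod>p\<in>#M. X $$ p))"
    using assms(1) unfolding param_form_def by blast
  obtain c' where c': "\<And>M. c' M \<in> polynomial_on I"
    "\<And>x X. X \<in> carrier_mat m n \<Longrightarrow> g x X = (\<Sum>M\<in>monomials m n k'. c' M x * (\<Prod>p\<in>#M. X $$ p))"
    using assms(2) unfolding param_form_def by blast
  define S where "S = monomials m n k \<times> monomials m n k'"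
  define C where "C M x = (\<Sum>q\<in>{q \<in> S. fst q + snd q = M}. c (fst q) x * c' (snd q) x)" for M x
  have finS: "finite S" unfolding S_def by (intro finite_cartesian_product finite_monomials)
  have img: "(\<lambda>q. fst q + snd q) ` S \<subseteq> monomials m n (k + k')"
    unfolding S_def monomials_def by auto
  show ?thesis unfolding param_form_def
  proof (intro exI[of _ C] conjI allI ballI)
    show "C M \<in> polynomial_on I" for M
      unfolding C_def by (intro polynomial_on_sum polynomial_on.mult c(1) c'(1))
    fix x X assume X: "(X :: real mat) \<in> carrier_mat m n"
    have "f x X * g x X = (\<Sum>q\<in>S. c (fst q) x * c' (snd q) x * (\<Prod>p\<in>#fst q + snd q. X $$ p))"
      unfolding c(2)[OF X] c'(2)[OF X] sum_product S_def sum.cartesian_product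
      by (intro sum.cong) (auto simp: ac_simps)
    also have "\<dots> = (\<Sum>M\<in>monomials m n (k + k'). \<Sum>q\<in>{q \<in> S. fst q + snd q = M}.
        c (fst q) x * c' (snd q) x * (\<Prod>p\<in>#fst q + snd q. X $$ p))"
      by (rule sum.group[symmetric, OF finS finite_monomials img])
    also have "\<dots> = (\<Sum>M\<in>monomials m n (k + k'). C M x * (\<Prod>p\<in>#M. X $$ p))"
      unfolding C_def sum_distrib_right by (intro sum.cong) auto
    finally show "f x X * g x X = (\<Sum>M\<in>monomials m n (k + k'). C M x * (\<Prod>p\<in>#M. X $$ p))" .
  qed
qed

lemma param_form_param:
  assumes "g \<in> polynomial_on I"
  shows "param_form I m n 0 (\<lambda>x X. g x)"
proof -
  have "monomials m n 0 = {{#}}" unfolding monomials_def by auto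
  then show ?thesis unfolding param_form_def using assms by (intro exI[of _ "\<lambda>_. g"]) simp
qed

lemma param_form_entry:
  assumes "i < m" "j < n"
  shows "param_form I m n 1 (\<lambda>x X. X $$ (i, j))"
  unfolding param_form_def
proof (intro exI[of _ "\<lambda>M _. of_bool (M = {#(i, j)#})"] conjI allI ballI)
  fix X :: "real mat"
  have "{#(i, j)#} \<in> monomials m n 1" using assms by (simp add: monomials_def)
  then show "X $$ (i, j) = (\<Sum>M\<in>monomials m n 1. of_bool (M = {#(i, j)#}) * (\<Prod>p\<in>#M. X $$ p))"
    by (subst sum.remove[of _ "{#(i, j)#}"]) (simp_all add: finite_monomials)
qed (rule polynomial_on.const)

definition matrix_form :: "'i set \<Rightarrow> nat \<Rightarrow> nat \<Rightarrow> nat \<Rightarrow> nat \<Rightarrow> nat \<Rightarrow>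
    (('i \<Rightarrow> real) \<Rightarrow> real mat \<Rightarrow> real mat) \<Rightarrow> bool" where
  "matrix_form I m n k r s F \<longleftrightarrow>
     (\<forall>x. \<forall>X\<in>carrier_mat m n. F x X \<in> carrier_mat r s) \<and>
     (\<forall>i<r. \<forall>j<s. param_form I m n k (\<lambda>x X. F x X $$ (i, j)))"

lemma mult_mat_entry:
  assumes "A \<in> carrier_mat r u" "B \<in> carrier_mat u s" "i < r" "j < s"
  shows "(A * B) $$ (i, j) = (\<Sum>k<u. A $$ (i, k) * B $$ (k, j))"
  using assms by (simp add: scalar_prod_def atLeast0LessThan)

lemma matrix_form_mult:
  assumes "matrix_form I m n k r u F" "matrix_form I m n k' u s G"
  shows "matrix_form I m n (k + k') r s (\<lambda>x X. F x X * G x X)"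
  unfolding matrix_form_def
proof (intro conjI allI ballI impI)
  show "F x X * G x X \<in> carrier_mat r s" if "X \<in> carrier_mat m n" for x X
    using assms that unfolding matrix_form_def by (meson mult_carrier_mat)
  fix i j assume ij: "i < r" "j < s"
  have "param_form I m n (k + k') (\<lambda>x X. \<Sum>b<u. F x X $$ (i, b) * G x X $$ (b, j))"
    using assms ij unfolding matrix_form_def by (intro param_form_sum param_form_mult) auto
  moreover have "(F x X * G x X) $$ (i, j) = (\<Sum>b<u. F x X $$ (i, b) * G x X $$ (b, j))"
    if "X \<in> carrier_mat m n" for x X
    using assms ij that unfolding matrix_form_def by (intro mult_mat_entry) auto
  ultimately show "param_form I m n (k + k') (\<lambda>x X. (F x X * G x X) $$ (i, j))"
    by (subst param_form_cong) auto
qed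

lemma matrix_form_transpose:
  assumes "matrix_form I m n k r s F"
  shows "matrix_form I m n k s r (\<lambda>x X. transpose_mat (F x X))"
  unfolding matrix_form_def
proof (intro conjI allI ballI impI)
  show "transpose_mat (F x X) \<in> carrier_mat s r" if "X \<in> carrier_mat m n" for x X
    using assms that unfolding matrix_form_def by simp
  fix i j assume ij: "i < s" "j < r"
  have "transpose_mat (F x X) $$ (i, j) = F x X $$ (j, i)" if "X \<in> carrier_mat m n" for x X
  proof -
    have "F x X \<in> carrier_mat r s" using assms that unfolding matrix_form_def by blast
    then show ?thesis using ij by simp
  qed
  moreover have "param_form I m n k (\<lambda>x X. F x X $$ (j, i))"
    using assms ij unfolding matrix_form_def by blast
  ultimately show "param_form I m n k (\<lambda>x X. transpose_mat (F x X) $$ (i, j))"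
    by (subst param_form_cong) auto
qed

definition polynomial_matrix :: "'i set \<Rightarrow> nat \<Rightarrow> nat \<Rightarrow> (('i \<Rightarrow> real) \<Rightarrow> real mat) \<Rightarrow> bool" where
  "polynomial_matrix I r s A \<longleftrightarrow> (\<forall>x. A x \<in> carrier_mat r s) \<and>
     (\<forall>i<r. \<forall>j<s. (\<lambda>x. A x $$ (i, j)) \<in> polynomial_on I)"

lemma matrix_form_param:
  "polynomial_matrix I r s A \<Longrightarrow> matrix_form I m n 0 r s (\<lambda>x X. A x)"
  unfolding polynomial_matrix_def matrix_form_def by (auto intro: param_form_param)

lemma matrix_form_attention_network:
  assumes "\<And>i. i \<in> {1..l} \<Longrightarrow> polynomial_matrix I (a i) (d (i - 1)) (\<lambda>x. Q x i) \<and>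
      polynomial_matrix I (a i) (d (i - 1)) (\<lambda>x. K x i) \<and>
      polynomial_matrix I (d i) (d (i - 1)) (\<lambda>x. V x i)"
  shows "matrix_form I (d 0) t (3 ^ l) (d l) t (\<lambda>x X. attention_network (Q x) (K x) (V x) l X)"
  using assms
proof (induction l)
  case 0
  then show ?case by (auto simp: matrix_form_def intro: param_form_entry[simplified])
next
  case (Suc l)
  let ?F = "\<lambda>x X. attention_network (Q x) (K x) (V x) l X"
  have F: "matrix_form I (d 0) t (3 ^ l) (d l) t ?F" using Suc by auto
  have W: "polynomial_matrix I (a (Suc l)) (d l) (\<lambda>x. Q x (Suc l))"
    "polynomial_matrix I (a (Suc l)) (d l) (\<lambda>x. K x (Suc l))"
    "polynomial_matrix I (d (Suc l)) (d l) (\<lambda>x. V x (Suc l))"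
    using Suc.prems[of "Suc l"] by auto
  have "matrix_form I (d 0) t (0 + 3 ^ l + 3 ^ l + 0 + 0 + 3 ^ l) (d (Suc l)) t
      (\<lambda>x X. V x (Suc l) * ?F x X * transpose_mat (?F x X) * transpose_mat (K x (Suc l)) * Q x (Suc l) * ?F x X)"
    by (intro matrix_form_mult[OF _ F] matrix_form_mult[OF _ matrix_form_param[OF W(1)]]
        matrix_form_mult[OF _ matrix_form_transpose[OF matrix_form_param[OF W(2)]]]
        matrix_form_mult[OF _ matrix_form_transpose[OF F]] matrix_form_param W(3))
  moreover have "0 + 3 ^ l + 3 ^ l + 0 + 0 + 3 ^ l = (3 ^ Suc l :: nat)" by simp
  ultimately show ?case by (simp only: attention_layer_def attention_network.simps)
qed

text \<open>Over the empty set of parameters the coefficients are constants, so the closure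
  properties of \<open>param_form\<close> also serve the target space.\<close>

lemma hom_poly_maps_iff:
  "F \<in> hom_poly_maps m n r s k \<longleftrightarrow> F \<in> carrier_mat m n \<rightarrow>\<^sub>E carrier_mat r s \<and>
     (\<forall>i<r. \<forall>j<s. param_form ({} :: unit set) m n k (\<lambda>_ X. F X $$ (i, j)))"
proof -
  have "homogeneous_form m n k f \<longleftrightarrow> param_form ({} :: unit set) m n k (\<lambda>_. f)" for f
  proof
    assume "homogeneous_form m n k f"
    then obtain c where "\<forall>X\<in>carrier_mat m n. f X = (\<Sum>M\<in>monomials m n k. c M * (\<Prod>p\<in>#M. X $$ p))"
      unfolding homogeneous_form_def monomials_def by blast
    then show "param_form ({} :: unit set) m n k (\<lambda>_. f)" unfolding param_form_def
      by (intro exI[of _ "\<lambda>M _. c M"]) (simp add: polynomial_on.const)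
  next
    assume "param_form ({} :: unit set) m n k (\<lambda>_. f)"
    then obtain c where "\<forall>x. \<forall>X\<in>carrier_mat m n. f X = (\<Sum>M\<in>monomials m n k. c M x * (\<Prod>p\<in>#M. X $$ p))"
      unfolding param_form_def by blast
    then show "homogeneous_form m n k f" unfolding homogeneous_form_def monomials_def
      by (intro exI[of _ "\<lambda>M. c M undefined"]) blast
  qed
  then show ?thesis unfolding hom_poly_maps_def by simp
qed

lemma param_form_specialize:
  assumes "param_form I m n k f"
  shows "param_form J m n k (\<lambda>_. f x)"
proof -
  obtain c where "\<And>X. X \<in> carrier_mat m n \<Longrightarrow> f x X = (\<Sum>M\<in>monomials m n k. c M x * (\<Prod>p\<in>#M. X $$ p))"
    using assms unfolding param_form_def by blast
  then show ?thesis unfolding param_form_def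
    by (intro exI[of _ "\<lambda>M _. c M x"]) (simp add: polynomial_on.const)
qed

lemma matrix_form_hom_poly_maps:
  assumes "matrix_form I m n k r s F"
  shows "(\<lambda>X\<in>carrier_mat m n. F x X) \<in> hom_poly_maps m n r s k"
  unfolding hom_poly_maps_iff
proof (intro conjI allI impI)
  show "(\<lambda>X\<in>carrier_mat m n. F x X) \<in> carrier_mat m n \<rightarrow>\<^sub>E carrier_mat r s"
    using assms unfolding matrix_form_def restrict_PiE_iff by blast
  fix i j assume "i < r" "j < s"
  then have "param_form I m n k (\<lambda>x X. F x X $$ (i, j))"
    using assms unfolding matrix_form_def by blast
  from param_form_specialize[OF this, of "{} :: unit set" x]
  have "param_form ({} :: unit set) m n k (\<lambda>_ X. F x X $$ (i, j))" .
  then show "param_form ({} :: unit set) m n k (\<lambda>_ X. (\<lambda>X\<in>carrier_mat m n. F x X) X $$ (i, j))"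
    by (subst param_form_cong) auto
qed

lemma hom_poly_maps_add:
  assumes "F \<in> hom_poly_maps m n r s k" "G \<in> hom_poly_maps m n r s k"
  shows "(\<lambda>X\<in>carrier_mat m n. F X + G X) \<in> hom_poly_maps m n r s k"
proof -
  have "matrix_form ({} :: unit set) m n k r s (\<lambda>_ X. F X + G X)"
    unfolding matrix_form_def
  proof (intro conjI allI ballI impI)
    show "F X + G X \<in> carrier_mat r s" if "X \<in> carrier_mat m n" for X
      using assms that unfolding hom_poly_maps_iff by (meson PiE_mem add_carrier_mat)
    fix i j assume ij: "i < r" "j < s"
    then have "param_form ({} :: unit set) m n k (\<lambda>_ X. F X $$ (i, j) + G X $$ (i, j))"
      using assms unfolding hom_poly_maps_iff by (intro param_form_add) auto
    moreover have "(F X + G X) $$ (i, j) = F X $$ (i, j) + G X $$ (i, j)" if "X \<in> carrier_mat m n" for X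
    proof -
      have "G X \<in> carrier_mat r s" using assms that unfolding hom_poly_maps_iff by auto
      then show ?thesis using ij by simp
    qed
    ultimately show "param_form ({} :: unit set) m n k (\<lambda>_ X. (F X + G X) $$ (i, j))"
      by (subst param_form_cong) auto
  qed
  from matrix_form_hom_poly_maps[OF this] show ?thesis .
qed

lemma hom_poly_maps_smult:
  assumes "F \<in> hom_poly_maps m n r s k"
  shows "(\<lambda>X\<in>carrier_mat m n. c \<cdot>\<^sub>m F X) \<in> hom_poly_maps m n r s k"
proof -
  have "matrix_form ({} :: unit set) m n k r s (\<lambda>_ X. c \<cdot>\<^sub>m F X)"
    unfolding matrix_form_def
  proof (intro conjI allI ballI impI)
    show "c \<cdot>\<^sub>m F X \<in> carrier_mat r s" if "X \<in> carrier_mat m n" for X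
      using assms that unfolding hom_poly_maps_iff by (meson PiE_mem smult_carrier_mat)
    fix i j assume ij: "i < r" "j < s"
    then have "param_form ({} :: unit set) m n (0 + k) (\<lambda>_ X. c * F X $$ (i, j))"
      using assms unfolding hom_poly_maps_iff
      by (intro param_form_mult param_form_param polynomial_on.const) auto
    moreover have "(c \<cdot>\<^sub>m F X) $$ (i, j) = c * F X $$ (i, j)" if "X \<in> carrier_mat m n" for X
    proof -
      have "F X \<in> carrier_mat r s" using assms that unfolding hom_poly_maps_iff by auto
      then show ?thesis using ij by simp
    qed
    ultimately show "param_form ({} :: unit set) m n k (\<lambda>_ X. (c \<cdot>\<^sub>m F X) $$ (i, j))"
      by (subst param_form_cong) auto
  qed
  from matrix_form_hom_poly_maps[OF this] show ?thesis .
qed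

text \<open>A linear functional is only given abstractly. Expanding the map in the finite family
  \<open>E b\<close> of matrices with one monomial entry reduces \<open>L\<close> to the scalars
  \<open>L (E b)\<close>, multiplied by coefficients that are polynomial in the parameters.\<close>

lemma linear_functional_matrix_form:
  assumes F: "matrix_form I m n k r s F"
    and L: "linear_functional_on (carrier_mat m n) (hom_poly_maps m n r s k) L"
  shows "(\<lambda>x. L (\<lambda>X\<in>carrier_mat m n. F x X)) \<in> polynomial_on I"
proof -
  define D where "D = (carrier_mat m n :: real mat set)"
  define V where "V = hom_poly_maps m n r s k"
  define E where "E b = (\<lambda>X\<in>D. mat r s (\<lambda>p. if p = fst b then \<Prod>q\<in>#snd b. X $$ q else 0))"
    for b :: "(nat \<times> nat) \<times> (nat \<times> nat) multiset"
  define T where "T = ({..<r} \<times> {..<s}) \<times> monomials m n k"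
  have finT: "finite T" unfolding T_def by (simp add: finite_monomials)
  have EV: "E b \<in> V" if b: "b \<in> T" for b
  proof -
    have "matrix_form ({} :: unit set) m n k r s
        (\<lambda>_ X. mat r s (\<lambda>p. if p = fst b then \<Prod>q\<in>#snd b. X $$ q else 0))"
      unfolding matrix_form_def
    proof (intro conjI allI ballI impI)
      fix i j assume ij: "i < r" "j < s"
      have "param_form ({} :: unit set) m n k (\<lambda>_ X. if (i, j) = fst b then \<Prod>q\<in>#snd b. X $$ q else 0)"
      proof (cases "(i, j) = fst b")
        case True
        have "snd b \<in> monomials m n k" using b unfolding T_def by auto
        then have "param_form ({} :: unit set) m n k (\<lambda>_ X. \<Prod>q\<in>#snd b. X $$ q)"
          unfolding param_form_def
          by (intro exI[of _ "\<lambda>M _. of_bool (M = snd b)"] conjI allI ballI polynomial_on.const)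
            (subst sum.remove[of _ "snd b"], simp_all add: finite_monomials)
        then show ?thesis using True by simp
      next
        case False
        then show ?thesis by (simp add: param_form_zero)
      qed
      then show "param_form ({} :: unit set) m n k (\<lambda>_ X.
          mat r s (\<lambda>p. if p = fst b then \<Prod>q\<in>#snd b. X $$ q else 0) $$ (i, j))"
        using ij by simp
    qed simp
    from matrix_form_hom_poly_maps[OF this] show ?thesis unfolding E_def V_def D_def .
  qed
  define comb where "comb c A = (\<lambda>X\<in>D. mat r s (\<lambda>p. \<Sum>b\<in>A. c b * E b X $$ p))" for c and A
  have comb: "comb c A \<in> V \<and> L (comb c A) = (\<Sum>b\<in>A. c b * L (E b))" if "A \<subseteq> T" for c A
    using finite_subset[OF that finT] that
  proof (induction A rule: finite_induct)
    case empty
    have "matrix_form ({} :: unit set) m n k r s (\<lambda>_ X. mat r s (\<lambda>p. \<Sum>b\<in>{}. c b * E b X $$ p))"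
      unfolding matrix_form_def by (simp add: param_form_zero)
    from matrix_form_hom_poly_maps[OF this] have V0: "comb c {} \<in> V"
      unfolding comb_def V_def D_def .
    \<comment> \<open>The value of \<open>L\<close> at the zero map comes from homogeneity with the
      scalar 0.\<close>
    have "(\<lambda>X\<in>D. 0 \<cdot>\<^sub>m comb c {} X) = comb c {}"
      unfolding comb_def by (rule restrict_ext) (auto intro!: eq_matI)
    then have "L (comb c {}) = 0 * L (comb c {})"
      using L V0 unfolding linear_functional_on_def V_def D_def by metis
    then show ?case using V0 by simp
  next
    case (insert b A)
    then have IH: "comb c A \<in> V" "L (comb c A) = (\<Sum>b\<in>A. c b * L (E b))" and Eb: "E b \<in> V"
      using EV by auto
    define G where "G = (\<lambda>X\<in>D. c b \<cdot>\<^sub>m E b X)"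
    have GV: "G \<in> V" using hom_poly_maps_smult Eb unfolding G_def V_def D_def by blast
    have LG: "L G = c b * L (E b)"
      using L Eb unfolding G_def linear_functional_on_def V_def D_def by blast
    have eq: "comb c (insert b A) = (\<lambda>X\<in>D. G X + comb c A X)"
      unfolding comb_def
    proof (rule restrict_ext)
      fix X assume X: "X \<in> D"
      have EX: "E b X \<in> carrier_mat r s" using X unfolding E_def by simp
      show "mat r s (\<lambda>p. \<Sum>b\<in>insert b A. c b * E b X $$ p) =
          G X + (\<lambda>X\<in>D. mat r s (\<lambda>p. \<Sum>b\<in>A. c b * E b X $$ p)) X"
        using X EX insert.hyps unfolding G_def by (intro eq_matI) auto
    qed
    have "comb c (insert b A) \<in> V"
      unfolding eq using hom_poly_maps_add GV IH(1) unfolding V_def D_def by blast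
    moreover have "L (comb c (insert b A)) = L G + L (comb c A)"
      unfolding eq using L GV IH(1) unfolding linear_functional_on_def V_def D_def by blast
    ultimately show ?case using LG IH(2) insert.hyps by simp
  qed
  have "\<forall>p. \<exists>c. p \<in> {..<r} \<times> {..<s} \<longrightarrow> (\<forall>M. c M \<in> polynomial_on I) \<and>
        (\<forall>x. \<forall>X\<in>carrier_mat m n. F x X $$ p = (\<Sum>M\<in>monomials m n k. c M x * (\<Prod>q\<in>#M. X $$ q)))"
    using F unfolding matrix_form_def param_form_def by auto
  from choice[OF this] obtain c where
    c: "\<forall>p. p \<in> {..<r} \<times> {..<s} \<longrightarrow> (\<forall>M. c p M \<in> polynomial_on I) \<and>
        (\<forall>x. \<forall>X\<in>carrier_mat m n. F x X $$ p = (\<Sum>M\<in>monomials m n k. c p M x * (\<Prod>q\<in>#M. X $$ q)))"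
    by (elim exE)
  have F_eq: "(\<lambda>X\<in>D. F x X) = comb (\<lambda>b. c (fst b) (snd b) x) T" for x
    unfolding comb_def
  proof (rule restrict_ext)
    fix X assume X: "X \<in> D"
    then have carr: "F x X \<in> carrier_mat r s" using F unfolding matrix_form_def D_def by blast
    show "F x X = mat r s (\<lambda>p. \<Sum>b\<in>T. c (fst b) (snd b) x * E b X $$ p)"
    proof (rule eq_matI)
      fix i j assume "i < dim_row (mat r s (\<lambda>p. \<Sum>b\<in>T. c (fst b) (snd b) x * E b X $$ p))"
        "j < dim_col (mat r s (\<lambda>p. \<Sum>b\<in>T. c (fst b) (snd b) x * E b X $$ p))"
      then have ij: "i < r" "j < s" by auto
      have "(\<Sum>b\<in>T. c (fst b) (snd b) x * E b X $$ (i, j)) =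
          (\<Sum>p\<in>{..<r} \<times> {..<s}. \<Sum>M\<in>monomials m n k. c p M x * E (p, M) X $$ (i, j))"
        unfolding T_def sum.cartesian_product by (intro sum.cong) auto
      also have "\<dots> = (\<Sum>p\<in>{..<r} \<times> {..<s}. if p = (i, j) then
          (\<Sum>M\<in>monomials m n k. c p M x * (\<Prod>q\<in>#M. X $$ q)) else 0)"
        using X ij unfolding E_def by (intro sum.cong) auto
      also have "\<dots> = (\<Sum>M\<in>monomials m n k. c (i, j) M x * (\<Prod>q\<in>#M. X $$ q))"
        using ij by simp
      also have "\<dots> = F x X $$ (i, j)"
        using c[THEN spec, of "(i, j)"] ij X unfolding D_def by simp
      finally show "F x X $$ (i, j) = mat r s (\<lambda>p. \<Sum>b\<in>T. c (fst b) (snd b) x * E b X $$ p) $$ (i, j)"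
        using ij by simp
    qed (use carr in auto)
  qed
  have "L (\<lambda>X\<in>D. F x X) = (\<Sum>b\<in>T. c (fst b) (snd b) x * L (E b))" for x
    unfolding F_eq using comb[of T] by blast
  moreover have "(\<lambda>x. \<Sum>b\<in>T. c (fst b) (snd b) x * L (E b)) \<in> polynomial_on I"
  proof (intro polynomial_on_sum polynomial_on.mult polynomial_on.const)
    fix b assume "b \<in> T"
    then show "(\<lambda>x. c (fst b) (snd b) x) \<in> polynomial_on I"
      using c unfolding T_def by auto
  qed
  ultimately show ?thesis unfolding D_def by simp
qed

lemma polynomial_functions_matrix_form:
  assumes F: "matrix_form I m n k r s F"
    and "p \<in> polynomial_functions (carrier_mat m n) (hom_poly_maps m n r s k)"
  shows "(\<lambda>x. p (\<lambda>X\<in>carrier_mat m n. F x X)) \<in> polynomial_on I"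
  using assms(2)
proof induction
  case (linear L)
  then show ?case by (rule linear_functional_matrix_form[OF F])
next
  case (const c)
  show ?case by (rule polynomial_on.const)
next
  case (add p q)
  show ?case using add.IH by (rule polynomial_on.add)
next
  case (mult p q)
  show ?case using mult.IH by (rule polynomial_on.mult)
qed

text \<open>Flatness of a deformation will be tested on these evaluations, which turn it into a
  statement about the entries of the output.\<close>

lemma entry_linear_functional:
  assumes "X \<in> carrier_mat m n" "i < r" "j < s"
  shows "linear_functional_on (carrier_mat m n) (hom_poly_maps m n r s k) (\<lambda>F. F X $$ (i, j))"
  unfolding linear_functional_on_def
proof (intro conjI ballI allI)
  fix F G assume FG: "F \<in> hom_poly_maps m n r s k" "G \<in> hom_poly_maps m n r s k"
  then have "F X \<in> carrier_mat r s" "G X \<in> carrier_mat r s"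
    using assms(1) unfolding hom_poly_maps_def by auto
  then show "(\<lambda>X\<in>carrier_mat m n. F X + G X) X $$ (i, j) = F X $$ (i, j) + G X $$ (i, j)"
    using assms by simp
next
  fix c F assume "F \<in> hom_poly_maps m n r s k"
  then have "F X \<in> carrier_mat r s"
    using assms(1) unfolding hom_poly_maps_def by auto
  then show "(\<lambda>X\<in>carrier_mat m n. c \<cdot>\<^sub>m F X) X $$ (i, j) = c * F X $$ (i, j)"
    using assms by simp
qed

section \<open>Infinitesimal rigidity of the normal form\<close>

definition bilin :: "nat \<Rightarrow> (nat \<Rightarrow> nat \<Rightarrow> real) \<Rightarrow> (nat \<Rightarrow> real) \<Rightarrow> (nat \<Rightarrow> real) \<Rightarrow> real" where
  "bilin n A u v = (\<Sum>i<n. \<Sum>j<n. u i * A i j * v j)"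

lemma bilin_left: "bilin n A (\<lambda>i. a * u i + b * v i) w = a * bilin n A u w + b * bilin n A v w"
  by (simp add: bilin_def sum.distrib sum_distrib_left algebra_simps)

lemma bilin_right: "bilin n A w (\<lambda>i. a * u i + b * v i) = a * bilin n A w u + b * bilin n A w v"
  by (simp add: bilin_def sum.distrib sum_distrib_left algebra_simps)

lemma bilin_scale_left: "bilin n A (\<lambda>i. a * u i) w = a * bilin n A u w"
  using bilin_left[of n A a u 0 u w] by simp

lemma bilin_scale_right: "bilin n A w (\<lambda>i. a * u i) = a * bilin n A w u"
  using bilin_right[of n A w a u 0 u] by simp

lemma bilin_add_left: "bilin n A (\<lambda>i. u i + v i) w = bilin n A u w + bilin n A v w"
  using bilin_left[of n A 1 u 1 v w] by simp

lemma bilin_add_right: "bilin n A w (\<lambda>i. u i + v i) = bilin n A w u + bilin n A w v"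
  using bilin_right[of n A w 1 u 1 v] by simp

lemma bilin_diff_left: "bilin n A (\<lambda>i. u i - v i) w = bilin n A u w - bilin n A v w"
  using bilin_left[of n A 1 u "-1" v w] by simp

lemma bilin_diff_right: "bilin n A w (\<lambda>i. u i - v i) = bilin n A w u - bilin n A w v"
  using bilin_right[of n A w 1 u "-1" v] by simp

definition unit_vector :: "nat \<Rightarrow> nat \<Rightarrow> real" where
  "unit_vector i j = of_bool (j = i)"

lemma bilin_unit:
  assumes "i < n" "j < n"
  shows "bilin n A (unit_vector i) (unit_vector j) = A i j"
proof -
  have "bilin n A (unit_vector i) (unit_vector j) = (\<Sum>i'<n. \<Sum>j'<n. if j' = j then (if i' = i then A i' j' else 0) else 0)"
    unfolding bilin_def unit_vector_def by (intro sum.cong) auto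
  then show ?thesis using assms by simp
qed

definition trunc_id :: "nat \<Rightarrow> nat \<Rightarrow> nat \<Rightarrow> real" where
  "trunc_id \<alpha> r c = of_bool (r = c \<and> r < \<alpha>)"

lemma bilin_trunc_id:
  assumes "\<alpha> \<le> n"
  shows "bilin n (trunc_id \<alpha>) u v = (\<Sum>i<\<alpha>. u i * v i)"
proof -
  have "bilin n (trunc_id \<alpha>) u v = (\<Sum>i<n. \<Sum>j<n. if j = i then (if i < \<alpha> then u i * v i else 0) else 0)"
    unfolding bilin_def trunc_id_def by (intro sum.cong) auto
  also have "\<dots> = (\<Sum>i<n. if i < \<alpha> then u i * v i else 0)" by simp
  also have "\<dots> = (\<Sum>i<\<alpha>. u i * v i)"
    using assms by (intro sum.mono_neutral_cong_right) auto
  finally show ?thesis .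
qed

text \<open>Since \<alpha> \<ge> 2, both squares occur in the form. Coordinates 0 and 1 are the
  relevant ones because pairs of test vectors are controlled by their minor in these two
  rows.\<close>

lemma bilin_trunc_id_pos:
  assumes "\<alpha> \<le> n" "2 \<le> \<alpha>" "u 0 \<noteq> 0 \<or> u 1 \<noteq> 0"
  shows "bilin n (trunc_id \<alpha>) u u > 0"
proof -
  have "0 < u 0 ^ 2 + u 1 ^ 2" using assms(3) by (simp add: sum_power2_gt_zero_iff)
  also have "\<dots> = (\<Sum>i\<in>{0, 1}. u i * u i)" by (simp add: power2_eq_square)
  also have "\<dots> \<le> (\<Sum>i<\<alpha>. u i * u i)"
    using assms(2) by (intro sum_mono2) auto
  finally show ?thesis using bilin_trunc_id[OF assms(1)] by simp
qed

text \<open>Write b and g for the two forms. The identity says that the functional b(x, _) is a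
  multiple of g(x, _) for generic x, which forces b to be a multiple of g; \<open>B00\<close> then
  makes the multiple zero. Only vectors with nonzero coordinate 0 may be probed, hence the sums with
  \<open>e 0\<close> throughout.\<close>

lemma proportional_to_trunc_id:
  fixes B :: "nat \<Rightarrow> nat \<Rightarrow> real"
  assumes \<alpha>: "2 \<le> \<alpha>" "\<alpha> \<le> n" and B00: "B 0 0 = 0"
    and proportional: "\<And>x y. x 0 \<noteq> 0 \<Longrightarrow> x 0 * y 1 - x 1 * y 0 \<noteq> 0 \<Longrightarrow>
      bilin n B x x * bilin n (trunc_id \<alpha>) x y = bilin n B x y * bilin n (trunc_id \<alpha>) x x"
    and "i < n" "j < n"
  shows "B i j = 0"
proof -
  define e where "e = unit_vector"
  define b where "b = bilin n B"
  define g where "g = bilin n (trunc_id \<alpha>)"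
  have n: "0 < n" "1 < n" using \<alpha> by auto
  have gu: "g (e i) (e j) = of_bool (i = j \<and> i < \<alpha>)" if "i < n" "j < n" for i j
    unfolding g_def e_def using that by (simp add: bilin_unit trunc_id_def)
  have bu: "b (e i) (e j) = B i j" if "i < n" "j < n" for i j
    unfolding b_def e_def using that by (simp add: bilin_unit)
  have e: "e i j = of_bool (j = i)" for i j by (simp add: e_def unit_vector_def)
  note lin = bilin_add_left[of n B, folded b_def] bilin_add_right[of n B, folded b_def]
    bilin_diff_left[of n B, folded b_def] bilin_diff_right[of n B, folded b_def]
    bilin_add_left[of n "trunc_id \<alpha>", folded g_def] bilin_add_right[of n "trunc_id \<alpha>", folded g_def]
    bilin_diff_left[of n "trunc_id \<alpha>", folded g_def] bilin_diff_right[of n "trunc_id \<alpha>", folded g_def]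
  \<comment> \<open>The condition on the minor disappears by linearity in \<open>y\<close>: if the
    minor of \<open>x\<close> and \<open>y\<close> is zero, those with \<open>y + e 1\<close> and
    with \<open>e 1\<close> are not.\<close>
  have E: "b x x * g x y = b x y * g x x" if x: "x 0 \<noteq> 0" for x y
  proof (cases "x 0 * y 1 - x 1 * y 0 = 0")
    case False
    then show ?thesis using proportional x unfolding b_def g_def by blast
  next
    case True
    have "b x x * g x (\<lambda>i. y i + e 1 i) = b x (\<lambda>i. y i + e 1 i) * g x x"
      unfolding b_def g_def by (rule proportional) (use x True in \<open>auto simp: e algebra_simps\<close>)
    moreover have "b x x * g x (e 1) = b x (e 1) * g x x"
      unfolding b_def g_def by (rule proportional) (use x in \<open>auto simp: e\<close>)
    ultimately show ?thesis by (simp add: lin algebra_simps)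
  qed
  have e0: "e i 0 = of_bool (i = 0)" for i by (simp add: e)
  have pos: "g x x \<noteq> 0" if "x 0 \<noteq> 0" for x
    unfolding g_def using bilin_trunc_id_pos[OF \<alpha>(2,1), of x] that by simp
  have E0: "b x y = 0" if "x 0 \<noteq> 0" "g x y = 0" for x y
    using E[of x y, OF that(1)] pos[of x, OF that(1)] that(2) by simp
  have E1: "b x y = 0" if "x 0 \<noteq> 0" "b x x = 0" for x y
    using E[of x y, OF that(1)] pos[of x, OF that(1)] that(2) by simp
  have E2: "b x x = 0" if "x 0 \<noteq> 0" "b x y = 0" "g x y \<noteq> 0" for x y
    using E[of x y, OF that(1)] that(2,3) by simp
  have row0: "b (e 0) y = 0" for y
    by (rule E1) (use n B00 in \<open>simp_all add: e0 bu\<close>)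
  have "b (\<lambda>i. e 0 i + e 1 i) (\<lambda>i. e 0 i - e 1 i) = 0"
    by (rule E0) (use n \<alpha> in \<open>simp_all add: e0 lin gu\<close>)
  moreover have "b (\<lambda>i. e 0 i - e 1 i) (\<lambda>i. e 0 i + e 1 i) = 0"
    by (rule E0) (use n \<alpha> in \<open>simp_all add: e0 lin gu\<close>)
  ultimately have b1: "b (e 1) (e 0) = 0" "b (e 1) (e 1) = 0" unfolding lin row0 by auto
  have "b (\<lambda>i. e 0 i + e 1 i) y = 0" for y
    by (rule E1) (use b1 in \<open>simp_all add: e0 lin row0\<close>)
  then have row1: "b (e 1) y = 0" for y unfolding lin row0 by simp
  \<comment> \<open>For k \<ge> \<alpha> the form g does not see \<open>e k\<close>. Adding
    \<open>e 0\<close> and \<open>e 1\<close> makes the vector admissible and gives it the value 1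
    against \<open>e 1\<close>, where b is already known to vanish.\<close>
  have row: "b (e k) y = 0" if k: "2 \<le> k" "k < n" for k y
  proof -
    have "b (\<lambda>i. e 0 i + e k i) (e 1) = 0"
      by (rule E0) (use n k in \<open>simp_all add: e0 lin gu\<close>)
    then have k1: "b (e k) (e 1) = 0" unfolding lin row0 by simp
    have "b (\<lambda>i. e 0 i + (e 1 i + e k i)) (\<lambda>i. e 0 i + (e 1 i + e k i)) = 0"
      by (rule E2[of _ "e 1"]) (use n k \<alpha> k1 row0 row1 in \<open>simp_all add: e0 lin gu\<close>)
    then have "b (\<lambda>i. e 0 i + (e 1 i + e k i)) y = 0"
      using E1[of "\<lambda>i. e 0 i + (e 1 i + e k i)" y] k by (simp add: e0)
    then show ?thesis unfolding lin row0 row1 by simp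
  qed
  have "b (e i) (e j) = 0"
    using row0 row1 row[of i] \<open>i < n\<close> by (cases "i = 0"; cases "i = 1") auto
  then show ?thesis using bu \<open>i < n\<close> \<open>j < n\<close> by simp
qed

text \<open>The layer with value matrix \<open>V\<close> and attention matrix \<open>A\<close>, applied to a matrix with the two
  columns \<open>u\<close> and \<open>\<epsilon> v\<close>, yields the columns \<open>u'\<close> and \<open>\<epsilon> v'\<close> below with \<open>\<eta> = \<epsilon>\<^sup>2\<close>.\<close>

definition pair_layer :: "real \<Rightarrow> nat \<Rightarrow> (nat \<Rightarrow> nat \<Rightarrow> real) \<Rightarrow> (nat \<Rightarrow> nat \<Rightarrow> real) \<Rightarrow>
    (nat \<Rightarrow> real) \<times> (nat \<Rightarrow> real) \<Rightarrow> (nat \<Rightarrow> real) \<times> (nat \<Rightarrow> real)" where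
  "pair_layer \<eta> n A V z = (let u = fst z; v = snd z in
     (\<lambda>r. \<Sum>c<n. V r c * (u c * bilin n A u u + \<eta> * (v c * bilin n A v u)),
      \<lambda>r. \<Sum>c<n. V r c * (u c * bilin n A u v + \<eta> * (v c * bilin n A v v))))"

lemma fst_pair_layer: "fst (pair_layer \<eta> n A V z) r =
    (\<Sum>c<n. V r c * (fst z c * bilin n A (fst z) (fst z) + \<eta> * (snd z c * bilin n A (snd z) (fst z))))"
  by (simp add: pair_layer_def Let_def)

lemma snd_pair_layer: "snd (pair_layer \<eta> n A V z) r =
    (\<Sum>c<n. V r c * (fst z c * bilin n A (fst z) (snd z) + \<eta> * (snd z c * bilin n A (snd z) (snd z))))"
  by (simp add: pair_layer_def Let_def)

primrec pair_network :: "real \<Rightarrow> (nat \<Rightarrow> nat) \<Rightarrow> (nat \<Rightarrow> nat \<Rightarrow> nat \<Rightarrow> real) \<Rightarrow>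
    (nat \<Rightarrow> nat \<Rightarrow> nat \<Rightarrow> real) \<Rightarrow> nat \<Rightarrow> nat \<Rightarrow>
    (nat \<Rightarrow> real) \<times> (nat \<Rightarrow> real) \<Rightarrow> (nat \<Rightarrow> real) \<times> (nat \<Rightarrow> real)" where
  "pair_network \<eta> d A V k 0 z = z"
| "pair_network \<eta> d A V k (Suc m) z =
     pair_layer \<eta> (d (k + m)) (A (Suc (k + m))) (V (Suc (k + m))) (pair_network \<eta> d A V k m z)"

text \<open>The recursion adds layers at the output, whereas the rigidity argument removes them at
  the input.\<close>

lemma pair_network_front:
  "pair_network \<eta> d A V k (Suc m) z =
     pair_network \<eta> d A V (Suc k) m (pair_layer \<eta> (d k) (A (Suc k)) (V (Suc k)) z)"
proof (induction m)
  case (Suc m)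
  have "pair_network \<eta> d A V k (Suc (Suc m)) z =
    pair_layer \<eta> (d (k + Suc m)) (A (Suc (k + Suc m))) (V (Suc (k + Suc m))) (pair_network \<eta> d A V k (Suc m) z)"
    by (rule pair_network.simps)
  then show ?case unfolding Suc.IH by simp
qed simp

text \<open>In every layer the first output column is even and the second one odd in the second
  input column. So \<epsilon> splits off the second column and otherwise enters through its square,
  and the limit is the value at \<eta> = 0.\<close>

lemma pair_network_rescale:
  "pair_network 1 d A V k m (u, \<lambda>i. \<epsilon> * v i) =
     (fst (pair_network (\<epsilon>\<^sup>2) d A V k m (u, v)), \<lambda>i. \<epsilon> * snd (pair_network (\<epsilon>\<^sup>2) d A V k m (u, v)) i)"
proof (induction m)
  case (Suc m)
  show ?case unfolding pair_network.simps Suc.IH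
    by (auto simp: fun_eq_iff prod_eq_iff fst_pair_layer snd_pair_layer bilin_scale_left bilin_scale_right
        sum_distrib_left power2_eq_square algebra_simps)
qed simp

text \<open>With an identity value matrix the layer multiplies the pair of columns by its 2 x 2 Gram
  matrix, which is equivariant under rotations of the pair. A rotation makes the target columns u
  and v orthogonal for the form g. Scaling u by p yields the image p^3 g(u, u) u, so p is the
  inverse cube root of g(u, u), likewise for v; finally the rotation is undone.\<close>

lemma pair_layer_surj:
  fixes x' y' :: "nat \<Rightarrow> real"
  assumes minor: "x' 0 * y' 1 - x' 1 * y' 0 \<noteq> 0" and \<alpha>: "2 \<le> \<alpha>" "\<alpha> \<le> n" and \<delta>: "2 \<le> \<delta>" "\<delta> \<le> n"
    and V: "\<And>r c. V r c = of_bool (r = c)"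
  shows "\<exists>x y. x 0 * y 1 - x 1 * y 0 \<noteq> 0 \<and>
    (\<forall>r<\<delta>. fst (pair_layer 1 n (trunc_id \<alpha>) V (x, y)) r = x' r \<and>
            snd (pair_layer 1 n (trunc_id \<alpha>) V (x, y)) r = y' r)"
proof -
  define g where "g = bilin n (trunc_id \<alpha>)"
  have sym: "g u v = g v u" for u v
    unfolding g_def bilin_trunc_id[OF \<alpha>(2)] by (simp add: mult.commute)
  note gl = bilin_left[of n "trunc_id \<alpha>", folded g_def] and gr = bilin_right[of n "trunc_id \<alpha>", folded g_def]
  \<comment> \<open>Only the rows below \<delta> are prescribed; the target is padded with
    zeros.\<close>
  define X where "X r = (if r < \<delta> then x' r else 0)" for r
  define Y where "Y r = (if r < \<delta> then y' r else 0)" for r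
  have XY: "X 0 * Y 1 - X 1 * Y 0 \<noteq> 0" using minor \<delta> by (simp add: X_def Y_def)
  \<comment> \<open>This is the value of the form on the two columns rotated by \<theta>. A quarter
    turn changes its sign, so it has a zero in between.\<close>
  define F where "F \<theta> = cos \<theta> * sin \<theta> * (g Y Y - g X X) + (cos \<theta> ^ 2 - sin \<theta> ^ 2) * g X Y" for \<theta> :: real
  have cont: "continuous_on {0..pi / 2} F" unfolding F_def by (intro continuous_intros)
  have F0: "F 0 = g X Y" "F (pi / 2) = - g X Y" unfolding F_def by auto
  have "\<exists>\<theta>. F \<theta> = 0"
  proof (cases "g X Y \<le> 0")
    case True
    then show ?thesis using IVT'[of F 0 0 "pi / 2"] F0 cont by auto
  next
    case False
    then show ?thesis using IVT2'[of F "pi / 2" 0 0] F0 cont by auto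
  qed
  then obtain \<theta> where \<theta>: "F \<theta> = 0" by blast
  define c where "c = cos \<theta>"
  define s where "s = sin \<theta>"
  have cs: "c * c + s * s = 1" unfolding c_def s_def using sin_cos_squared_add2[of \<theta>] by (simp add: power2_eq_square)
  define u where "u = (\<lambda>r. c * X r + s * Y r)"
  define v where "v = (\<lambda>r. (- s) * X r + c * Y r)"
  have guv: "g u v = 0"
  proof -
    have "g u v = F \<theta>" unfolding u_def v_def gl gr F_def c_def[symmetric] s_def[symmetric]
      using sym[of Y X] by (simp add: power2_eq_square algebra_simps)
    then show ?thesis using \<theta> by simp
  qed
  have minor_uv: "u 0 * v 1 - u 1 * v 0 = X 0 * Y 1 - X 1 * Y 0"
  proof -
    have "u 0 * v 1 - u 1 * v 0 = (c * c + s * s) * (X 0 * Y 1 - X 1 * Y 0)"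
      unfolding u_def v_def by (simp add: algebra_simps)
    then show ?thesis using cs by simp
  qed
  have gu: "g u u > 0" unfolding g_def
    by (rule bilin_trunc_id_pos[OF \<alpha>(2,1)]) (use minor_uv XY in auto)
  have gv: "g v v > 0" unfolding g_def
    by (rule bilin_trunc_id_pos[OF \<alpha>(2,1)]) (use minor_uv XY in auto)
  define p where "p = 1 / root 3 (g u u)"
  define q where "q = 1 / root 3 (g v v)"
  have p: "p \<noteq> 0" "p * p * p * g u u = 1"
  proof -
    have "root 3 (g u u) ^ 3 = g u u" using gu by (intro real_root_pow_pos2) auto
    then show "p \<noteq> 0" "p * p * p * g u u = 1" using gu unfolding p_def
      by (auto simp: power3_eq_cube field_simps)
  qed
  have q: "q \<noteq> 0" "q * q * q * g v v = 1"
  proof -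
    have "root 3 (g v v) ^ 3 = g v v" using gv by (intro real_root_pow_pos2) auto
    then show "q \<noteq> 0" "q * q * q * g v v = 1" using gv unfolding q_def
      by (auto simp: power3_eq_cube field_simps)
  qed
  define x where "x = (\<lambda>r. c * p * u r + (- s * q) * v r)"
  define y where "y = (\<lambda>r. s * p * u r + c * q * v r)"
  define a where "a = p * p * g u u"
  define b where "b = q * q * g v v"
  have pa: "p * a = 1" "q * b = 1" unfolding a_def b_def using p(2) q(2) by (simp_all add: ac_simps)
  have gvu: "g v u = 0" using guv sym by simp
  have gxx: "g x x = c * c * a + s * s * b"
    unfolding x_def gl gr guv gvu a_def b_def by (simp add: algebra_simps)
  have gyx: "g y x = c * s * (a - b)"
    unfolding x_def y_def gl gr guv gvu a_def b_def by (simp add: algebra_simps)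
  have gxy: "g x y = c * s * (a - b)" using gyx sym by simp
  have gyy: "g y y = s * s * a + c * c * b"
    unfolding y_def gl gr guv gvu a_def b_def by (simp add: algebra_simps)
  have eq1: "x r * g x x + y r * g y x = X r" for r
  proof -
    have "x r * g x x + y r * g y x =
        (c * c + s * s) * (c * (p * a) * u r - s * (q * b) * v r)"
      unfolding gxx gyx unfolding x_def y_def by (simp add: algebra_simps)
    also have "\<dots> = c * u r - s * v r" using cs pa by simp
    also have "\<dots> = (c * c + s * s) * X r" unfolding u_def v_def by (simp add: algebra_simps)
    finally show ?thesis using cs by simp
  qed
  have eq2: "x r * g x y + y r * g y y = Y r" for r
  proof -
    have "x r * g x y + y r * g y y =
        (c * c + s * s) * (s * (p * a) * u r + c * (q * b) * v r)"
      unfolding gxy gyy unfolding x_def y_def by (simp add: algebra_simps)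
    also have "\<dots> = s * u r + c * v r" using cs pa by simp
    also have "\<dots> = (c * c + s * s) * Y r" unfolding u_def v_def by (simp add: algebra_simps)
    finally show ?thesis using cs by simp
  qed
  have "x 0 * y 1 - x 1 * y 0 = (c * c + s * s) * (p * q) * (u 0 * v 1 - u 1 * v 0)"
    unfolding x_def y_def by (simp add: algebra_simps)
  then have "x 0 * y 1 - x 1 * y 0 \<noteq> 0" using cs p(1) q(1) minor_uv XY by simp
  moreover have "fst (pair_layer 1 n (trunc_id \<alpha>) V (x, y)) r = x' r \<and>
      snd (pair_layer 1 n (trunc_id \<alpha>) V (x, y)) r = y' r" if r: "r < \<delta>" for r
  proof -
    have pick: "(\<Sum>c<n. V r c * h c) = h r" for h
    proof -
      have "(\<Sum>c<n. V r c * h c) = (\<Sum>c<n. if c = r then h c else 0)"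
        by (intro sum.cong) (auto simp: V)
      then show ?thesis using r \<delta> by simp
    qed
    show ?thesis
      unfolding fst_pair_layer snd_pair_layer fst_conv snd_conv pick g_def[symmetric] mult_1
        eq1 eq2 using r by (simp add: X_def Y_def)
  qed
  ultimately show ?thesis by blast
qed

section \<open>First-order calculus with a limit parameter\<close>

text \<open>The s-derivative will be known to vanish for \<eta> > 0 and is wanted at \<eta> = 0, so
  it has to be continuous in \<eta>. Continuity of the value at s = 0 keeps the class closed under
  the product rule.\<close>

definition cont_deriv :: "(real \<Rightarrow> real \<Rightarrow> real) \<Rightarrow> bool" where
  "cont_deriv f \<longleftrightarrow> (\<exists>D. (\<forall>\<eta>. ((\<lambda>s. f s \<eta>) has_real_derivative D \<eta>) (at 0)) \<and>
     isCont D 0 \<and> isCont (f 0) 0)"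

lemma cont_deriv_param:
  assumes "(f has_real_derivative D) (at 0)"
  shows "cont_deriv (\<lambda>s \<eta>. f s)"
  unfolding cont_deriv_def using assms by (intro exI[of _ "\<lambda>_. D"]) auto

lemma cont_deriv_const: "cont_deriv (\<lambda>s \<eta>. c)"
  by (rule cont_deriv_param[of _ 0]) simp

lemma cont_deriv_snd: "cont_deriv (\<lambda>s \<eta>. \<eta>)"
  unfolding cont_deriv_def by (intro exI[of _ "\<lambda>_. 0"]) auto

lemma cont_deriv_add:
  assumes "cont_deriv f" "cont_deriv g"
  shows "cont_deriv (\<lambda>s \<eta>. f s \<eta> + g s \<eta>)"
proof -
  obtain D where D: "\<And>\<eta>. ((\<lambda>s. f s \<eta>) has_real_derivative D \<eta>) (at 0)" "isCont D 0" "isCont (f 0) 0"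
    using assms(1) unfolding cont_deriv_def by blast
  obtain E where E: "\<And>\<eta>. ((\<lambda>s. g s \<eta>) has_real_derivative E \<eta>) (at 0)" "isCont E 0" "isCont (g 0) 0"
    using assms(2) unfolding cont_deriv_def by blast
  show ?thesis unfolding cont_deriv_def
    by (intro exI[of _ "\<lambda>\<eta>. D \<eta> + E \<eta>"] conjI allI DERIV_add D E continuous_add)
qed

lemma cont_deriv_mult:
  assumes "cont_deriv f" "cont_deriv g"
  shows "cont_deriv (\<lambda>s \<eta>. f s \<eta> * g s \<eta>)"
proof -
  obtain D where D: "\<And>\<eta>. ((\<lambda>s. f s \<eta>) has_real_derivative D \<eta>) (at 0)" "isCont D 0" "isCont (f 0) 0"
    using assms(1) unfolding cont_deriv_def by blast
  obtain E where E: "\<And>\<eta>. ((\<lambda>s. g s \<eta>) has_real_derivative E \<eta>) (at 0)" "isCont E 0" "isCont (g 0) 0"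
    using assms(2) unfolding cont_deriv_def by blast
  show ?thesis unfolding cont_deriv_def
    by (intro exI[of _ "\<lambda>\<eta>. D \<eta> * g 0 \<eta> + E \<eta> * f 0 \<eta>"] conjI allI DERIV_mult D E
        continuous_add continuous_mult)
qed

lemma cont_deriv_sum:
  assumes "\<And>a. a \<in> S \<Longrightarrow> cont_deriv (f a)"
  shows "cont_deriv (\<lambda>s \<eta>. \<Sum>a\<in>S. f a s \<eta>)"
  using assms
  by (induction S rule: infinite_finite_induct) (auto intro: cont_deriv_const cont_deriv_add)

lemma cont_deriv_zero_limit:
  assumes "cont_deriv f" "\<And>\<eta>. \<eta> > 0 \<Longrightarrow> ((\<lambda>s. f s \<eta>) has_real_derivative 0) (at 0)"
  shows "((\<lambda>s. f s 0) has_real_derivative 0) (at 0)"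
proof -
  obtain D where D: "\<And>\<eta>. ((\<lambda>s. f s \<eta>) has_real_derivative D \<eta>) (at 0)" "isCont D 0"
    using assms(1) unfolding cont_deriv_def by blast
  have "D \<eta> = 0" if "\<eta> > 0" for \<eta> using DERIV_unique[OF D(1) assms(2)[OF that]] .
  then have "eventually (\<lambda>\<eta>. D \<eta> = 0) (at_right 0)"
    using eventually_at_right_less[of "0 :: real"] by (auto elim: eventually_mono)
  then have "(D \<longlongrightarrow> 0) (at_right 0)" by (rule tendsto_eventually)
  moreover have "(D \<longlongrightarrow> D 0) (at_right 0)"
    using D(2) unfolding isCont_def by (rule filterlim_mono) (auto intro: at_le)
  ultimately have "D 0 = 0" by (intro tendsto_unique[of "at_right 0"]) auto
  then show ?thesis using D(1)[of 0] by simp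
qed

text \<open>First-order contact at s = 0 is preserved by sums and products, so a moving input of a
  network may be exchanged for a constant one in contact with it.\<close>

definition same_jet :: "(real \<Rightarrow> real) \<Rightarrow> (real \<Rightarrow> real) \<Rightarrow> bool" where
  "same_jet f g \<longleftrightarrow> f 0 = g 0 \<and> (\<exists>D. (f has_real_derivative D) (at 0) \<and> (g has_real_derivative D) (at 0))"

lemma same_jet_refl: "(f has_real_derivative D) (at 0) \<Longrightarrow> same_jet f f"
  unfolding same_jet_def by blast

lemma same_jet_deriv:
  assumes "same_jet f g" "(f has_real_derivative D) (at 0)"
  shows "(g has_real_derivative D) (at 0)"
  using assms DERIV_unique unfolding same_jet_def by blast

lemma same_jet_add:
  assumes "same_jet f f'" "same_jet g g'"
  shows "same_jet (\<lambda>s. f s + g s) (\<lambda>s. f' s + g' s)"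
proof -
  obtain D E where "(f has_real_derivative D) (at 0)" "(f' has_real_derivative D) (at 0)"
    "(g has_real_derivative E) (at 0)" "(g' has_real_derivative E) (at 0)"
    using assms unfolding same_jet_def by blast
  then show ?thesis using assms unfolding same_jet_def
    by (intro conjI exI[of _ "D + E"] DERIV_add) auto
qed

lemma same_jet_mult:
  assumes "same_jet f f'" "same_jet g g'"
  shows "same_jet (\<lambda>s. f s * g s) (\<lambda>s. f' s * g' s)"
proof -
  obtain D E where D: "(f has_real_derivative D) (at 0)" "(f' has_real_derivative D) (at 0)"
    "(g has_real_derivative E) (at 0)" "(g' has_real_derivative E) (at 0)"
    using assms unfolding same_jet_def by blast
  have 0: "f 0 = f' 0" "g 0 = g' 0" using assms unfolding same_jet_def by auto
  show ?thesis unfolding same_jet_def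
    using DERIV_mult[OF D(1,3)] DERIV_mult[OF D(2,4)] 0 by (intro conjI exI[of _ "D * g' 0 + E * f' 0"]) auto
qed

lemma same_jet_sum:
  assumes "\<And>a. a \<in> S \<Longrightarrow> same_jet (f a) (g a)"
  shows "same_jet (\<lambda>s. \<Sum>a\<in>S. f a s) (\<lambda>s. \<Sum>a\<in>S. g a s)"
proof -
  have 0: "same_jet (\<lambda>_. 0) (\<lambda>_. 0)" by (rule same_jet_refl[of _ 0]) simp
  show ?thesis using assms
    by (induction S rule: infinite_finite_induct) (auto intro: 0 same_jet_add)
qed

section \<open>Rigidity along a curve of weights\<close>

text \<open>The tangent vector is carried by a curve, so that the composite network can be
  differentiated by the usual rules. \<open>A'00\<close> records the normalisation by rescaling,
  \<open>V_const\<close> the one by hidden changes of basis.\<close>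

locale normal_form_curve =
  fixes l \<delta> :: nat and d \<alpha> :: "nat \<Rightarrow> nat"
    and A V :: "real \<Rightarrow> nat \<Rightarrow> nat \<Rightarrow> nat \<Rightarrow> real" and A' V' :: "nat \<Rightarrow> nat \<Rightarrow> nat \<Rightarrow> real"
  assumes l: "1 \<le> l" and \<delta>: "2 \<le> \<delta>" "\<delta> \<le> d 0" "\<delta> \<le> d l"
    and d: "\<And>i. 0 < i \<Longrightarrow> i < l \<Longrightarrow> d i = \<delta>"
    and \<alpha>: "\<And>i. i < l \<Longrightarrow> 2 \<le> \<alpha> (Suc i) \<and> \<alpha> (Suc i) \<le> d i"
    and dA: "\<And>i r c. ((\<lambda>s. A s i r c) has_real_derivative A' i r c) (at 0)"
    and dV: "\<And>i r c. ((\<lambda>s. V s i r c) has_real_derivative V' i r c) (at 0)"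
    and A0: "\<And>i. i < l \<Longrightarrow> A 0 (Suc i) = trunc_id (\<alpha> (Suc i))"
    and V0: "\<And>i r c. V 0 i r c = of_bool (r = c)"
    and A'00: "\<And>i. i < l \<Longrightarrow> A' (Suc i) 0 0 = 0"
    and V_const: "\<And>s i r c. 0 < i \<Longrightarrow> i < l \<Longrightarrow> c < \<delta> \<Longrightarrow> V s i r c = of_bool (r = c)"
    and flat0: "\<And>x y j. x 0 * y 1 - x 1 * y 0 \<noteq> 0 \<Longrightarrow> j < d l \<Longrightarrow>
      ((\<lambda>s. fst (pair_network 1 d (A s) (V s) 0 l (x, y)) j) has_real_derivative 0) (at 0) \<and>
      ((\<lambda>s. snd (pair_network 1 d (A s) (V s) 0 l (x, y)) j) has_real_derivative 0) (at 0)"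
begin

lemma d_ge: "i < l \<Longrightarrow> \<delta> \<le> d i"
  using \<delta> d by (cases "i = 0") auto

definition net :: "real \<Rightarrow> real \<Rightarrow> nat \<Rightarrow> nat \<Rightarrow> (nat \<Rightarrow> real) \<times> (nat \<Rightarrow> real) \<Rightarrow>
    (nat \<Rightarrow> real) \<times> (nat \<Rightarrow> real)" where
  "net \<eta> s k m z = pair_network \<eta> d (A s) (V s) k m z"

text \<open>The invariant of the peeling: flatness for the network that begins after layer
  \<open>k\<close>. A nonzero minor survives scaling the second column and is what
  \<open>pair_layer_surj\<close> can reach from an earlier layer.\<close>

definition stationary :: "nat \<Rightarrow> bool" where
  "stationary k \<longleftrightarrow> (\<forall>x y j. x 0 * y 1 - x 1 * y 0 \<noteq> 0 \<longrightarrow> j < d l \<longrightarrow>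
      ((\<lambda>s. fst (net 1 s k (l - k) (x, y)) j) has_real_derivative 0) (at 0) \<and>
      ((\<lambda>s. snd (net 1 s k (l - k) (x, y)) j) has_real_derivative 0) (at 0))"

lemma net_Suc: "net \<eta> s k (Suc m) z =
    pair_layer \<eta> (d (k + m)) (A s (Suc (k + m))) (V s (Suc (k + m))) (net \<eta> s k m z)"
  by (simp add: net_def)

lemma net_front: "net \<eta> s k (Suc m) z =
    net \<eta> s (Suc k) m (pair_layer \<eta> (d k) (A s (Suc k)) (V s (Suc k)) z)"
  unfolding net_def by (rule pair_network_front)

lemma net_0 [simp]: "net \<eta> s k 0 z = z"
  by (simp add: net_def)

lemma cont_deriv_net:
  "cont_deriv (\<lambda>s \<eta>. fst (net \<eta> s k m z) j) \<and> cont_deriv (\<lambda>s \<eta>. snd (net \<eta> s k m z) j)"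
proof (induction m arbitrary: j)
  case 0
  show ?case by (simp add: cont_deriv_const)
next
  case (Suc m)
  have f: "cont_deriv (\<lambda>s \<eta>. fst (net \<eta> s k m z) j)"
    and g: "cont_deriv (\<lambda>s \<eta>. snd (net \<eta> s k m z) j)" for j using Suc.IH by blast+
  show ?case unfolding net_Suc fst_pair_layer snd_pair_layer bilin_def
    by (intro conjI cont_deriv_sum cont_deriv_mult cont_deriv_add cont_deriv_snd f g
        cont_deriv_param[OF dA] cont_deriv_param[OF dV])
qed

text \<open>Feeding the pair \<open>x\<close>, \<epsilon> \<open>y\<close> with \<epsilon>^2 =
  \<eta> into the network at 1 gives the network at \<eta>, up to the factor \<epsilon> on the
  second column. Dividing by it and letting \<eta> tend to 0 gives the claim.\<close>

lemma stationary_rank_one: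
  assumes "stationary k" and xy: "x 0 * y 1 - x 1 * y 0 \<noteq> 0" and j: "j < d l"
  shows "((\<lambda>s. fst (net 0 s k (l - k) (x, y)) j) has_real_derivative 0) (at 0)"
    and "((\<lambda>s. snd (net 0 s k (l - k) (x, y)) j) has_real_derivative 0) (at 0)"
proof -
  have resc: "((\<lambda>s. fst (net \<eta> s k (l - k) (x, y)) j) has_real_derivative 0) (at 0) \<and>
      ((\<lambda>s. snd (net \<eta> s k (l - k) (x, y)) j) has_real_derivative 0) (at 0)" if "\<eta> > 0" for \<eta>
  proof -
    define \<epsilon> where "\<epsilon> = sqrt \<eta>"
    have \<epsilon>: "\<epsilon> > 0" "\<epsilon>\<^sup>2 = \<eta>" using that by (auto simp: \<epsilon>_def)
    have "x 0 * (\<epsilon> * y 1) - x 1 * (\<epsilon> * y 0) = \<epsilon> * (x 0 * y 1 - x 1 * y 0)"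
      by (simp add: algebra_simps)
    then have "x 0 * (\<epsilon> * y 1) - x 1 * (\<epsilon> * y 0) \<noteq> 0" using xy \<epsilon>(1) by simp
    then have "((\<lambda>s. fst (net 1 s k (l - k) (x, \<lambda>i. \<epsilon> * y i)) j) has_real_derivative 0) (at 0) \<and>
      ((\<lambda>s. snd (net 1 s k (l - k) (x, \<lambda>i. \<epsilon> * y i)) j) has_real_derivative 0) (at 0)"
      using assms(1)[unfolded stationary_def, THEN spec[of _ x], THEN spec[of _ "\<lambda>i. \<epsilon> * y i"]] j by blast
    then have "((\<lambda>s. fst (net \<eta> s k (l - k) (x, y)) j) has_real_derivative 0) (at 0)"
      and *: "((\<lambda>s. \<epsilon> * snd (net \<eta> s k (l - k) (x, y)) j) has_real_derivative 0) (at 0)"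
      unfolding net_def pair_network_rescale \<epsilon>(2) by simp_all
    moreover have "((\<lambda>s. snd (net \<eta> s k (l - k) (x, y)) j) has_real_derivative 0) (at 0)"
      using DERIV_cmult[OF *, of "1 / \<epsilon>"] \<epsilon>(1) by simp
    ultimately show ?thesis by blast
  qed
  show "((\<lambda>s. fst (net 0 s k (l - k) (x, y)) j) has_real_derivative 0) (at 0)"
    using cont_deriv_zero_limit[of "\<lambda>s \<eta>. fst (net \<eta> s k (l - k) (x, y)) j"] resc cont_deriv_net by blast
  show "((\<lambda>s. snd (net 0 s k (l - k) (x, y)) j) has_real_derivative 0) (at 0)"
    using cont_deriv_zero_limit[of "\<lambda>s \<eta>. snd (net \<eta> s k (l - k) (x, y)) j"] resc cont_deriv_net by blast
qed

text \<open>At \<eta> = 0 the first layer sends both columns to multiples of V x, with factors q =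
  x^T A x and b = x^T A y. A later layer is linear in the second column and multiplies a collinear
  pair by a common matrix, so q v = b u persists. The relation is cross-multiplied to avoid
  division.\<close>

lemma rank_one_ratio:
  assumes "0 < m"
  shows "bilin (d k) (A s (Suc k)) x x * snd (net 0 s k m (x, y)) j =
    bilin (d k) (A s (Suc k)) x y * fst (net 0 s k m (x, y)) j"
  using assms
proof (induction m arbitrary: j)
  case (Suc m)
  define q where "q = bilin (d k) (A s (Suc k)) x x"
  define b where "b = bilin (d k) (A s (Suc k)) x y"
  show ?case
  proof (cases "m = 0")
    case True
    then show ?thesis
      by (simp add: net_Suc fst_pair_layer snd_pair_layer sum_distrib_left mult_ac)
  next
    case False
    define u where "u = fst (net 0 s k m (x, y))"
    define v where "v = snd (net 0 s k m (x, y))"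
    define W where "W = V s (Suc (k + m))"
    define B where "B = bilin (d (k + m)) (A s (Suc (k + m)))"
    have uv: "q * v i = b * u i" for i
      using Suc.IH[of i] False unfolding q_def b_def u_def v_def by simp
    then have "(\<lambda>i. q * v i) = (\<lambda>i. b * u i)" by auto
    then have B: "q * B u v = b * B u u"
      unfolding B_def by (metis bilin_scale_right)
    have "q * snd (net 0 s k (Suc m) (x, y)) j = (\<Sum>c<d (k + m). W j c * (u c * (q * B u v)))"
      by (simp add: net_Suc snd_pair_layer u_def v_def W_def B_def sum_distrib_left mult_ac)
    also have "\<dots> = b * fst (net 0 s k (Suc m) (x, y)) j"
      unfolding B by (simp add: net_Suc fst_pair_layer u_def v_def W_def B_def sum_distrib_left mult_ac)
    finally show ?thesis unfolding q_def b_def .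
  qed
qed simp

lemma V0_sum: "r < n \<Longrightarrow> (\<Sum>c<n. V 0 i r c * h c) = h r"
proof -
  assume r: "r < n"
  have "(\<Sum>c<n. V 0 i r c * h c) = (\<Sum>c<n. if c = r then h c else 0)"
    by (intro sum.cong) (auto simp: V0)
  then show ?thesis using r by simp
qed

text \<open>With identity value matrices each layer multiplies the first column by the value of a
  form that is positive on it. Rows 0 and 1 exist at every width, so this supplies nonzero outputs
  to cancel.\<close>

lemma base_net_scale:
  assumes "x 0 \<noteq> 0 \<or> x 1 \<noteq> 0" "k + m \<le> l"
  shows "\<exists>\<kappa>>0. \<forall>j<2. fst (net 0 0 k m (x, y)) j = \<kappa> * x j"
  using assms(2)
proof (induction m)
  case 0
  show ?case by (intro exI[of _ 1]) simp
next
  case (Suc m)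
  then obtain \<kappa> where \<kappa>: "\<kappa> > 0" "\<forall>j<2. fst (net 0 0 k m (x, y)) j = \<kappa> * x j" by auto
  define u where "u = fst (net 0 0 k m (x, y))"
  have km: "k + m < l" using Suc.prems by simp
  have "u 0 \<noteq> 0 \<or> u 1 \<noteq> 0" using \<kappa> assms(1) unfolding u_def by auto
  then have pos: "bilin (d (k + m)) (trunc_id (\<alpha> (Suc (k + m)))) u u > 0"
    using \<alpha>[OF km] by (intro bilin_trunc_id_pos) auto
  have "fst (net 0 0 k (Suc m) (x, y)) j = bilin (d (k + m)) (trunc_id (\<alpha> (Suc (k + m)))) u u * \<kappa> * x j"
    if "j < 2" for j
  proof -
    have "j < d (k + m)" using that \<alpha>[OF km] by auto
    then show ?thesis using \<kappa>(2) that
      by (simp add: net_Suc fst_pair_layer A0[OF km] u_def[symmetric] V0_sum)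
  qed
  then show ?case using pos \<kappa>(1)
    by (intro exI[of _ "bilin (d (k + m)) (trunc_id (\<alpha> (Suc (k + m)))) u u * \<kappa>"]) auto
qed

lemma deriv_bilin:
  "((\<lambda>s. bilin n (A s i) x y) has_real_derivative bilin n (A' i) x y) (at 0)"
  unfolding bilin_def
  by (rule DERIV_cong) (rule DERIV_sum DERIV_cmult DERIV_cmult_right dA | simp)+

text \<open>Differentiate q v = b u from \<open>rank_one_ratio\<close> at s = 0. Since u and v do
  not move, q' v = b' u remains; combined with q v = b u and u \<noteq> 0 it says that the form of
  \<open>A'\<close> is proportional to that of the base point.\<close>

lemma stationary_attention:
  assumes "stationary k" "k < l" "r < d k" "c < d k"
  shows "A' (Suc k) r c = 0"
proof (rule proportional_to_trunc_id[of "\<alpha> (Suc k)" "d k"])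
  fix x y :: "nat \<Rightarrow> real"
  assume x: "x 0 \<noteq> 0" and xy: "x 0 * y 1 - x 1 * y 0 \<noteq> 0"
  define q where "q s = bilin (d k) (A s (Suc k)) x x" for s
  define b where "b s = bilin (d k) (A s (Suc k)) x y" for s
  define u where "u s = fst (net 0 s k (l - k) (x, y)) 0" for s
  define v where "v s = snd (net 0 s k (l - k) (x, y)) 0" for s
  have "0 < d l" using \<delta> by simp
  note du = stationary_rank_one(1)[OF assms(1) xy this, folded u_def]
    and dv = stationary_rank_one(2)[OF assms(1) xy this, folded v_def]
  have qv: "q s * v s = b s * u s" for s
    unfolding q_def v_def b_def u_def using assms(2) by (intro rank_one_ratio) simp
  have "((\<lambda>s. q s * v s) has_real_derivative bilin (d k) (A' (Suc k)) x x * v 0 + 0 * q 0) (at 0)"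
    unfolding q_def by (intro DERIV_mult deriv_bilin dv)
  moreover have "((\<lambda>s. b s * u s) has_real_derivative bilin (d k) (A' (Suc k)) x y * u 0 + 0 * b 0) (at 0)"
    unfolding b_def by (intro DERIV_mult deriv_bilin du)
  ultimately have "bilin (d k) (A' (Suc k)) x x * v 0 + 0 * q 0 = bilin (d k) (A' (Suc k)) x y * u 0 + 0 * b 0"
    unfolding qv by (rule DERIV_unique)
  then have eq: "bilin (d k) (A' (Suc k)) x x * v 0 = bilin (d k) (A' (Suc k)) x y * u 0" by simp
  obtain \<kappa> where "\<kappa> > 0" "u 0 = \<kappa> * x 0"
    using base_net_scale[of x k "l - k" y] x assms(2) unfolding u_def by auto
  then have u0: "u 0 \<noteq> 0" using x by simp
  have "bilin (d k) (A' (Suc k)) x x * b 0 * u 0 = bilin (d k) (A' (Suc k)) x x * v 0 * q 0"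
    using qv[of 0] by (simp add: mult_ac)
  also have "\<dots> = bilin (d k) (A' (Suc k)) x y * q 0 * u 0" unfolding eq by (simp add: mult_ac)
  finally have "bilin (d k) (A' (Suc k)) x x * b 0 = bilin (d k) (A' (Suc k)) x y * q 0" using u0 by simp
  then show "bilin (d k) (A' (Suc k)) x x * bilin (d k) (trunc_id (\<alpha> (Suc k))) x y =
      bilin (d k) (A' (Suc k)) x y * bilin (d k) (trunc_id (\<alpha> (Suc k))) x x"
    unfolding b_def q_def A0[OF assms(2)] .
qed (use \<alpha>[OF assms(2)] A'00[OF assms(2)] assms(3,4) in auto)


text \<open>For a single layer the first column at \<eta> = 0 is V x times a scalar, which stands
  still because the attention matrix does. As the scalar is nonzero, V' x = 0.\<close>

lemma stationary_last_value:
  assumes "stationary (l - 1)" "r < d l" "c < d (l - 1)"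
  shows "V' l r c = 0"
proof -
  define k where "k = l - 1"
  have k: "Suc k = l" "k < l" "l - k = Suc 0" using l by (auto simp: k_def)
  have st: "stationary k" using assms(1) by (simp add: k_def)
  have A'0: "A' (Suc k) r c = 0" if "r < d k" "c < d k" for r c
    using stationary_attention[OF st k(2) that] .
  have n: "2 \<le> d k" using d_ge[OF k(2)] \<delta> by simp
  have rel: "(\<Sum>c<d k. V' l r c * x c) = 0" if x: "x 0 = 1" for x :: "nat \<Rightarrow> real"
  proof -
    define q where "q s = bilin (d k) (A s (Suc k)) x x" for s
    have dq: "(q has_real_derivative 0) (at 0)"
    proof -
      have "bilin (d k) (A' (Suc k)) x x = 0" unfolding bilin_def using A'0 by simp
      then show ?thesis using deriv_bilin[of "d k" "Suc k" x x] unfolding q_def by simp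
    qed
    have q0: "q 0 > 0" unfolding q_def A0[OF k(2)]
      using \<alpha>[OF k(2)] x by (intro bilin_trunc_id_pos) auto
    have "((\<lambda>s. \<Sum>c<d k. V s l r c * (x c * q s)) has_real_derivative
        (\<Sum>c<d k. V' l r c * (x c * q 0) + (x c * 0) * V 0 l r c)) (at 0)"
      by (intro DERIV_sum DERIV_mult dV DERIV_cmult dq)
    moreover have "((\<lambda>s. \<Sum>c<d k. V s l r c * (x c * q s)) has_real_derivative 0) (at 0)"
      using stationary_rank_one(1)[OF st, of x "unit_vector 1" r] x assms(2) k(1)
      by (simp add: k(3) net_Suc fst_pair_layer unit_vector_def q_def)
    ultimately have "(\<Sum>c<d k. V' l r c * (x c * q 0) + (x c * 0) * V 0 l r c) = 0"
      by (rule DERIV_unique)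
    then have "(\<Sum>c<d k. V' l r c * x c) * q 0 = 0"
      by (simp add: sum_distrib_right mult.assoc)
    then show ?thesis using q0 by simp
  qed
  have pick: "(\<Sum>c<d k. V' l r c * unit_vector i c) = V' l r i" if "i < d k" for i
  proof -
    have "(\<Sum>c<d k. V' l r c * unit_vector i c) = (\<Sum>c<d k. if c = i then V' l r c else 0)"
      by (intro sum.cong) (auto simp: unit_vector_def)
    then show ?thesis using that by simp
  qed
  have 0: "V' l r 0 = 0" using rel[of "unit_vector 0"] pick[of 0] n by (simp add: unit_vector_def)
  show ?thesis
  proof (cases "c = 0")
    case False
    \<comment> \<open>The relation is available only for vectors with coordinate 0 equal to 1, so
      column \<open>c\<close> is reached as a difference of two such vectors.\<close>
    have "(\<Sum>c'<d k. V' l r c' * (unit_vector 0 c' + unit_vector c c')) = 0"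
      by (rule rel) (use False in \<open>simp add: unit_vector_def\<close>)
    then show ?thesis using 0 pick[of 0] pick[of c] n assms(3)
      by (simp add: distrib_left sum.distrib k_def)
  qed (simp add: 0)
qed

text \<open>The hidden value matrices after the first are fixed identities, so at \<eta> = 0 the
  later hidden layers only contribute scalars. These may move with \<open>s\<close>.\<close>

lemma first_layers_collinear:
  assumes "0 < m" "m < l"
  shows "\<exists>\<sigma> D. (\<sigma> has_real_derivative D) (at 0) \<and>
    (\<forall>s. \<forall>r<\<delta>. fst (net 0 s 0 m (x, y)) r = \<sigma> s * (\<Sum>c<d 0. V s 1 r c * x c))"
  using assms
proof (induction m)
  case (Suc m)
  have q: "\<exists>D. ((\<lambda>s. bilin (d m) (A s (Suc m)) (fst (net 0 s 0 m (x, y))) (fst (net 0 s 0 m (x, y)))) has_real_derivative D) (at 0)"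
  proof -
    have "cont_deriv (\<lambda>s \<eta>. bilin (d m) (A s (Suc m)) (fst (net \<eta> s 0 m (x, y))) (fst (net \<eta> s 0 m (x, y))))"
      unfolding bilin_def
      by (intro cont_deriv_sum cont_deriv_mult cont_deriv_net[THEN conjunct1] cont_deriv_param[OF dA])
    then show ?thesis unfolding cont_deriv_def by blast
  qed
  then obtain E where E: "((\<lambda>s. bilin (d m) (A s (Suc m)) (fst (net 0 s 0 m (x, y))) (fst (net 0 s 0 m (x, y)))) has_real_derivative E) (at 0)"
    by blast
  show ?case
  proof (cases "m = 0")
    case True
    have "fst (net 0 s 0 (Suc m) (x, y)) r =
        bilin (d m) (A s (Suc m)) (fst (net 0 s 0 m (x, y))) (fst (net 0 s 0 m (x, y))) *
        (\<Sum>c<d 0. V s 1 r c * x c)" for s r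
      using True by (simp add: net_Suc fst_pair_layer sum_distrib_left mult_ac)
    then show ?thesis using E by blast
  next
    case False
    then obtain \<sigma> D where \<sigma>: "(\<sigma> has_real_derivative D) (at 0)"
      "\<forall>s. \<forall>r<\<delta>. fst (net 0 s 0 m (x, y)) r = \<sigma> s * (\<Sum>c<d 0. V s 1 r c * x c)"
      using Suc by auto
    have dm: "d m = \<delta>" using False Suc.prems by (intro d) auto
    define q where "q s = bilin (d m) (A s (Suc m)) (fst (net 0 s 0 m (x, y))) (fst (net 0 s 0 m (x, y)))" for s
    have "fst (net 0 s 0 (Suc m) (x, y)) r = (\<sigma> s * q s) * (\<Sum>c<d 0. V s 1 r c * x c)"
      if r: "r < \<delta>" for s r
    proof -
      have "fst (net 0 s 0 (Suc m) (x, y)) r = (\<Sum>c<\<delta>. V s (Suc m) r c * (fst (net 0 s 0 m (x, y)) c * q s))"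
        unfolding q_def by (simp add: net_Suc fst_pair_layer dm)
      also have "\<dots> = (\<Sum>c<\<delta>. if c = r then fst (net 0 s 0 m (x, y)) c * q s else 0)"
        using V_const[of "Suc m"] Suc.prems by (intro sum.cong) auto
      also have "\<dots> = fst (net 0 s 0 m (x, y)) r * q s" using r by simp
      finally show ?thesis using \<sigma>(2) r by simp
    qed
    moreover have "((\<lambda>s. \<sigma> s * q s) has_real_derivative D * q 0 + E * \<sigma> 0) (at 0)"
      using E unfolding q_def by (intro DERIV_mult \<sigma>(1))
    ultimately show ?thesis by blast
  qed
qed simp

text \<open>The first and the last value matrix move simultaneously: at \<eta> = 0 the first output
  column is a moving scalar times V_l V_1 x. In a row r with x r = 0 the derivative of the scalar
  drops out, leaving V_l' x + V_1' x = 0 in that row. Changing x by \<open>e c\<close> with c \<ge>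
  \<delta> does not affect the first summand, so the entry of V_1' vanishes.\<close>

lemma stationary_first_value:
  assumes "stationary 0" "2 \<le> l" "r < \<delta>" "c < d 0"
  shows "V' 1 r c = 0"
proof (cases "c < \<delta>")
  case True
  have "(\<lambda>s. V s 1 r c) = (\<lambda>s. of_bool (r = c))" using V_const[of 1 c] assms(2) True by auto
  then have "((\<lambda>s. V s 1 r c) has_real_derivative 0) (at 0)" by simp
  then show ?thesis using DERIV_unique[OF dV] by blast
next
  case False
  define m where "m = l - 1"
  have m: "0 < m" "m < l" "Suc m = l" "d m = \<delta>"
    using assms(2) d[of m] by (auto simp: m_def)
  have r: "r < d l" using assms(3) \<delta> by simp
  have dc: "(\<Sum>c<n. (if c = i then f c else 0 :: real)) = (if i < n then f i else 0)" for f :: "nat \<Rightarrow> real" and i n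
    by simp
  have key: "(\<Sum>c<\<delta>. V' l r c * x c) + (\<Sum>c<d 0. V' 1 r c * x c) = 0"
    if xr: "x r = 0" and x: "x 0 * y 1 - x 1 * y 0 \<noteq> 0" for x y :: "nat \<Rightarrow> real"
  proof -
    obtain \<sigma> D where \<sigma>: "(\<sigma> has_real_derivative D) (at 0)"
      "\<And>s r. r < \<delta> \<Longrightarrow> fst (net 0 s 0 m (x, y)) r = \<sigma> s * (\<Sum>c<d 0. V s 1 r c * x c)"
      using first_layers_collinear[OF m(1,2), of x y] by blast
    define q where "q s = bilin (d m) (A s (Suc m)) (fst (net 0 s 0 m (x, y))) (fst (net 0 s 0 m (x, y)))" for s
    obtain E where E: "(q has_real_derivative E) (at 0)"
    proof -
      have "cont_deriv (\<lambda>s \<eta>. bilin (d m) (A s (Suc m)) (fst (net \<eta> s 0 m (x, y))) (fst (net \<eta> s 0 m (x, y))))"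
        unfolding bilin_def
        by (intro cont_deriv_sum cont_deriv_mult cont_deriv_net[THEN conjunct1] cont_deriv_param[OF dA])
      then show ?thesis using that unfolding cont_deriv_def q_def by blast
    qed
    define z where "z s i = (\<Sum>c<d 0. V s 1 i c * x c)" for s i
    define z' where "z' i = (\<Sum>c<d 0. V' 1 i c * x c)" for i
    have dz: "((\<lambda>s. z s i) has_real_derivative z' i) (at 0)" for i
      unfolding z_def z'_def by (intro DERIV_sum DERIV_cmult_right dV)
    have z0: "z 0 i = x i" if "i < d 0" for i unfolding z_def using V0_sum[OF that] .
    define w where "w i s = (\<Sum>c<\<delta>. V s l i c * z s c)" for i s
    have out: "fst (net 0 s 0 l (x, y)) i = \<sigma> s * q s * w i s" for s i
    proof -
      have "fst (net 0 s 0 l (x, y)) i = (\<Sum>c<\<delta>. V s l i c * (fst (net 0 s 0 m (x, y)) c * q s))"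
        using net_Suc[of 0 s 0 m] m unfolding q_def by (simp add: fst_pair_layer)
      also have "\<dots> = (\<Sum>c<\<delta>. V s l i c * (\<sigma> s * z s c * q s))"
        unfolding z_def by (intro sum.cong) (simp_all add: \<sigma>(2))
      finally show ?thesis by (simp add: w_def sum_distrib_left mult_ac)
    qed
    have dw: "(w r has_real_derivative (\<Sum>c<\<delta>. V' l r c * z 0 c + z' c * V 0 l r c)) (at 0)"
      unfolding w_def by (intro DERIV_sum DERIV_mult dV dz)
    have w'_eq: "(\<Sum>c<\<delta>. V' l r c * z 0 c + z' c * V 0 l r c) = (\<Sum>c<\<delta>. V' l r c * x c) + z' r"
    proof -
      have "(\<Sum>c<\<delta>. V' l r c * z 0 c) = (\<Sum>c<\<delta>. V' l r c * x c)"
        using z0 \<delta> by (intro sum.cong) auto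
      moreover have "(\<Sum>c<\<delta>. z' c * V 0 l r c) = z' r"
        using V0_sum[OF assms(3), of l z'] by (simp add: mult.commute)
      ultimately show ?thesis by (simp add: sum.distrib)
    qed
    have w0: "w i 0 = x i" if "i < \<delta>" for i
      unfolding w_def using V0_sum[OF that, of l "z 0"] z0[of i] that \<delta> by simp
    have "x 0 \<noteq> 0 \<or> x 1 \<noteq> 0" using x by auto
    then obtain \<kappa> where \<kappa>: "\<kappa> > 0" "\<forall>j<2. fst (net 0 0 0 l (x, y)) j = \<kappa> * x j"
      using base_net_scale[of x 0 l y] by auto
    have \<sigma>q: "\<sigma> 0 * q 0 \<noteq> 0"
    proof -
      have "\<exists>j<2. x j \<noteq> 0" using \<open>x 0 \<noteq> 0 \<or> x 1 \<noteq> 0\<close> 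
        by (intro exI[of _ "if x 0 = 0 then 1 else 0"]) auto
      then obtain j where j: "j < 2" "x j \<noteq> 0" by blast
      then have "\<sigma> 0 * q 0 * x j = \<kappa> * x j" using \<kappa>(2) out[of 0 j] w0[of j] \<delta> by auto
      then show ?thesis using j \<kappa>(1) by auto
    qed
    have "((\<lambda>s. \<sigma> s * q s * w r s) has_real_derivative
        (D * q 0 + E * \<sigma> 0) * w r 0 + ((\<Sum>c<\<delta>. V' l r c * x c) + z' r) * (\<sigma> 0 * q 0)) (at 0)"
      using dw unfolding w'_eq by (intro DERIV_mult \<sigma>(1) E)
    moreover have "((\<lambda>s. \<sigma> s * q s * w r s) has_real_derivative 0) (at 0)"
      using stationary_rank_one(1)[OF assms(1) x r] unfolding out[symmetric] by simp
    ultimately have "(D * q 0 + E * \<sigma> 0) * w r 0 + ((\<Sum>c<\<delta>. V' l r c * x c) + z' r) * (\<sigma> 0 * q 0) = 0"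
      by (rule DERIV_unique)
    then show ?thesis using \<sigma>q w0[OF assms(3)] xr unfolding z'_def by simp
  qed
  have pick: "(\<Sum>c<n. f c * unit_vector i c) = (if i < n then f i else 0)" for f n i
  proof -
    have "(\<Sum>c<n. f c * unit_vector i c) = (\<Sum>c<n. if c = i then f c else 0)"
      by (intro sum.cong) (auto simp: unit_vector_def)
    then show ?thesis by simp
  qed
  \<comment> \<open>One of the rows 0 and 1 other than \<open>r\<close>: then
    \<open>unit_vector j\<close> vanishes at \<open>r\<close>, and its minor with the other one of
    the two vectors is nonzero.\<close>
  define j :: nat where "j = (if r = 0 then 1 else 0)"
  have j: "j < 2" "j \<noteq> r" "j < \<delta>" "j < d 0" "j \<noteq> c" using \<delta> False by (auto simp: j_def)
  define y where "y = unit_vector (1 - j)"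
  have c: "c \<noteq> r" "c \<noteq> 0" "c \<noteq> 1" using False assms(3) \<delta> by auto
  have "(\<Sum>c<\<delta>. V' l r c * unit_vector j c) + (\<Sum>c<d 0. V' 1 r c * unit_vector j c) = 0"
    by (rule key[of _ y]) (use j in \<open>auto simp: unit_vector_def y_def j_def split: if_splits\<close>)
  moreover have "(\<Sum>c'<\<delta>. V' l r c' * (unit_vector j c' + unit_vector c c')) +
      (\<Sum>c'<d 0. V' 1 r c' * (unit_vector j c' + unit_vector c c')) = 0"
    by (rule key[of _ y]) (use j c in \<open>auto simp: unit_vector_def y_def j_def split: if_splits\<close>)
  ultimately show ?thesis using False assms(4) by (simp add: distrib_left sum.distrib pick)
qed

lemma same_jet_net:
  assumes "\<And>j. j < d k \<Longrightarrow> same_jet (\<lambda>s. fst (z s) j) (\<lambda>s. fst z' j)"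
    and "\<And>j. j < d k \<Longrightarrow> same_jet (\<lambda>s. snd (z s) j) (\<lambda>s. snd z' j)" and "j < d (k + m)"
  shows "same_jet (\<lambda>s. fst (net \<eta> s k m (z s)) j) (\<lambda>s. fst (net \<eta> s k m z') j) \<and>
    same_jet (\<lambda>s. snd (net \<eta> s k m (z s)) j) (\<lambda>s. snd (net \<eta> s k m z') j)"
  using assms(3)
proof (induction m arbitrary: j)
  case 0
  then show ?case using assms(1,2) by simp
next
  case (Suc m)
  have f: "same_jet (\<lambda>s. fst (net \<eta> s k m (z s)) j) (\<lambda>s. fst (net \<eta> s k m z') j)"
    and g: "same_jet (\<lambda>s. snd (net \<eta> s k m (z s)) j) (\<lambda>s. snd (net \<eta> s k m z') j)"
    if "j \<in> {..<d (k + m)}" for j using Suc.IH that by auto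
  have const: "same_jet (\<lambda>s. \<eta>) (\<lambda>s. \<eta>)" by (rule same_jet_refl[of _ 0]) simp
  show ?case unfolding net_Suc fst_pair_layer snd_pair_layer bilin_def
    by (intro conjI same_jet_sum same_jet_mult same_jet_add const same_jet_refl[OF dA]
        same_jet_refl[OF dV] f g)
qed

text \<open>Any pair with nonzero minor is the image of such a pair under layer \<open>k + 1\<close>
  at the base point. As the velocities of this layer vanish, its moving output is in first-order
  contact with the fixed pair, which may be fed to the remaining network instead.\<close>

lemma stationary_step:
  assumes st: "stationary k" and k: "Suc k < l"
    and V'0: "\<And>r c. r < \<delta> \<Longrightarrow> c < d k \<Longrightarrow> V' (Suc k) r c = 0"
  shows "stationary (Suc k)"
  unfolding stationary_def
proof (intro allI impI)
  fix x' y' :: "nat \<Rightarrow> real" and j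
  assume xy': "x' 0 * y' 1 - x' 1 * y' 0 \<noteq> 0" and j: "j < d l"
  have kl: "k < l" and dk: "d (Suc k) = \<delta>" using k d[of "Suc k"] by auto
  have A'0: "A' (Suc k) r c = 0" if "r < d k" "c < d k" for r c
    using stationary_attention[OF st kl that] .
  obtain x y where xy: "x 0 * y 1 - x 1 * y 0 \<noteq> 0" and
    img: "\<And>r. r < \<delta> \<Longrightarrow> fst (pair_layer 1 (d k) (trunc_id (\<alpha> (Suc k))) (V 0 (Suc k)) (x, y)) r = x' r \<and>
            snd (pair_layer 1 (d k) (trunc_id (\<alpha> (Suc k))) (V 0 (Suc k)) (x, y)) r = y' r"
    using pair_layer_surj[OF xy', of "\<alpha> (Suc k)" "d k" \<delta> "V 0 (Suc k)"] \<alpha>[OF kl] d_ge[OF kl] \<delta> V0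
    by blast
  define z where "z s = pair_layer 1 (d k) (A s (Suc k)) (V s (Suc k)) (x, y)" for s
  have dbil: "((\<lambda>s. bilin (d k) (A s (Suc k)) u v) has_real_derivative 0) (at 0)" for u v
  proof -
    have "bilin (d k) (A' (Suc k)) u v = 0" unfolding bilin_def using A'0 by simp
    then show ?thesis using deriv_bilin[of "d k" "Suc k" u v] by simp
  qed
  have dvan: "((\<lambda>s. \<Sum>c<d k. V s (Suc k) r c * (u c * bilin (d k) (A s (Suc k)) a b +
      1 * (v c * bilin (d k) (A s (Suc k)) a' b'))) has_real_derivative 0) (at 0)"
    if r: "r < \<delta>" for r u v a b a' b'
  proof -
    have "((\<lambda>s. \<Sum>c<d k. V s (Suc k) r c * (u c * bilin (d k) (A s (Suc k)) a b +
        1 * (v c * bilin (d k) (A s (Suc k)) a' b'))) has_real_derivative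
        (\<Sum>c<d k. V' (Suc k) r c * (u c * bilin (d k) (A 0 (Suc k)) a b +
        1 * (v c * bilin (d k) (A 0 (Suc k)) a' b')) + (u c * 0 + 1 * (v c * 0)) * V 0 (Suc k) r c)) (at 0)"
      by (intro DERIV_sum DERIV_mult dV DERIV_add DERIV_cmult dbil)
    then show ?thesis using V'0[OF r] by simp
  qed
  have zf: "same_jet (\<lambda>s. fst (z s) r) (\<lambda>s. fst (x', y') r)" if "r < d (Suc k)" for r
  proof -
    have r: "r < \<delta>" using that dk by simp
    have "((\<lambda>s. fst (z s) r) has_real_derivative 0) (at 0)"
      unfolding z_def fst_pair_layer by (rule dvan[OF r])
    moreover have "fst (z 0) r = x' r" using img[OF r] unfolding z_def A0[OF kl] by blast
    ultimately show ?thesis unfolding same_jet_def by auto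
  qed
  have zs: "same_jet (\<lambda>s. snd (z s) r) (\<lambda>s. snd (x', y') r)" if "r < d (Suc k)" for r
  proof -
    have r: "r < \<delta>" using that dk by simp
    have "((\<lambda>s. snd (z s) r) has_real_derivative 0) (at 0)"
      unfolding z_def snd_pair_layer by (rule dvan[OF r])
    moreover have "snd (z 0) r = y' r" using img[OF r] unfolding z_def A0[OF kl] by blast
    ultimately show ?thesis unfolding same_jet_def by auto
  qed
  define m where "m = l - Suc k"
  have m: "l - k = Suc m" "Suc k + m = l" using k by (auto simp: m_def)
  have front: "net 1 s k (l - k) (x, y) = net 1 s (Suc k) m (z s)" for s
    unfolding m(1) net_front z_def ..
  have "((\<lambda>s. fst (net 1 s (Suc k) m (z s)) j) has_real_derivative 0) (at 0)"
    "((\<lambda>s. snd (net 1 s (Suc k) m (z s)) j) has_real_derivative 0) (at 0)"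
    using st[unfolded stationary_def, THEN spec[of _ x], THEN spec[of _ y], THEN spec[of _ j]] xy j
    unfolding front by simp_all
  moreover have "same_jet (\<lambda>s. fst (net 1 s (Suc k) m (z s)) j) (\<lambda>s. fst (net 1 s (Suc k) m (x', y')) j)"
    "same_jet (\<lambda>s. snd (net 1 s (Suc k) m (z s)) j) (\<lambda>s. snd (net 1 s (Suc k) m (x', y')) j)"
    using same_jet_net[of "Suc k" z "(x', y')" j m 1, OF zf zs] j unfolding m(2) by blast+
  ultimately show "((\<lambda>s. fst (net 1 s (Suc k) (l - Suc k) (x', y')) j) has_real_derivative 0) (at 0) \<and>
      ((\<lambda>s. snd (net 1 s (Suc k) (l - Suc k) (x', y')) j) has_real_derivative 0) (at 0)"
    unfolding m_def[symmetric] by (intro conjI) (rule same_jet_deriv, assumption+)+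
qed

lemma stationary: "k < l \<Longrightarrow> stationary k"
proof (induction k)
  case 0
  show ?case unfolding stationary_def net_def using flat0 by simp
next
  case (Suc k)
  then have st: "stationary k" by simp
  have "V' (Suc k) r c = 0" if rc: "r < \<delta>" "c < d k" for r c
  proof (cases "k = 0")
    case True
    then show ?thesis using stationary_first_value[of r c] st rc Suc.prems by simp
  next
    case False
    then have "c < \<delta>" using d[of k] Suc.prems rc by simp
    then have "(\<lambda>s. V s (Suc k) r c) = (\<lambda>s. of_bool (r = c))" using V_const[of "Suc k"] Suc.prems by auto
    then have "((\<lambda>s. V s (Suc k) r c) has_real_derivative 0) (at 0)" by simp
    then show ?thesis using DERIV_unique[OF dV] by blast
  qed
  with st Suc.prems show ?case by (intro stationary_step)
qed

theorem infinitesimally_trivial: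
  shows "i < l \<Longrightarrow> r < d i \<Longrightarrow> c < d i \<Longrightarrow> A' (Suc i) r c = 0"
    and "r < d l \<Longrightarrow> c < d (l - 1) \<Longrightarrow> V' l r c = 0"
    and "2 \<le> l \<Longrightarrow> r < \<delta> \<Longrightarrow> c < d 0 \<Longrightarrow> V' 1 r c = 0"
  using stationary_attention[OF stationary] stationary_last_value[OF stationary]
    stationary_first_value[OF stationary] l by auto

end

section \<open>The normal form\<close>

definition two_columns :: "nat \<Rightarrow> nat \<Rightarrow> (nat \<Rightarrow> real) \<times> (nat \<Rightarrow> real) \<Rightarrow> real mat" where
  "two_columns n t z = mat n t (\<lambda>(r, c). if c = 0 then fst z r else if c = 1 then snd z r else 0)"

lemma two_columns_carrier [simp]: "two_columns n t z \<in> carrier_mat n t"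
  by (simp add: two_columns_def)

lemma assoc_mult_mat_dim:
  "dim_col A = dim_row B \<Longrightarrow> dim_col B = dim_row C \<Longrightarrow> A * B * C = A * (B * (C :: 'a :: semiring_0 mat))"
  by (rule assoc_mult_mat[of A "dim_row A" "dim_col A" B "dim_col B" C "dim_col C"]) auto

text \<open>Zero columns stay zero and contribute nothing to the other columns, so only the two
  nonzero ones interact.\<close>

lemma attention_layer_two_columns:
  assumes W: "Q \<in> carrier_mat a n" "K \<in> carrier_mat a n" "V \<in> carrier_mat m n" and t: "2 \<le> t"
    and A: "\<And>r c. r < n \<Longrightarrow> c < n \<Longrightarrow> A r c = (\<Sum>k<a. K $$ (k, r) * Q $$ (k, c))"
    and U: "\<And>r c. r < m \<Longrightarrow> c < n \<Longrightarrow> U r c = V $$ (r, c)"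
  shows "attention_layer Q K V (two_columns n t z) = two_columns m t (pair_layer 1 n A U z)"
proof -
  define X where "X = two_columns n t z"
  define N where "N = transpose_mat X * (transpose_mat K * Q * X)"
  define col where "col c = (if c = 0 then fst z else if c = 1 then snd z else (\<lambda>_. 0))" for c :: nat
  have X: "X \<in> carrier_mat n t" by (simp add: X_def)
  have X_entry: "X $$ (r, c) = col c r" if "r < n" "c < t" for r c
    using that by (simp add: X_def two_columns_def col_def)
  have KQ: "(transpose_mat K * Q) $$ (r, c) = A r c" if "r < n" "c < n" for r c
  proof -
    have "(transpose_mat K * Q) $$ (r, c) = (\<Sum>k<a. transpose_mat K $$ (r, k) * Q $$ (k, c))"
      by (rule mult_mat_entry[of _ n a _ n]) (use W that in simp_all)
    also have "\<dots> = A r c" unfolding A[OF that] using W that by (intro sum.cong) simp_all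
    finally show ?thesis .
  qed
  have KQX: "transpose_mat K * Q * X \<in> carrier_mat n t"
    using W(1,2) X by (meson mult_carrier_mat transpose_carrier_mat[THEN iffD2])
  have N_carr: "N \<in> carrier_mat t t" unfolding N_def using X KQX
    by (meson mult_carrier_mat transpose_carrier_mat[THEN iffD2])
  have N: "N $$ (i, j) = bilin n A (col i) (col j)" if "i < t" "j < t" for i j
  proof -
    have "N $$ (i, j) = (\<Sum>r<n. X $$ (r, i) * (transpose_mat K * Q * X) $$ (r, j))"
      unfolding N_def using X KQX that by (subst mult_mat_entry[of _ t n _ t]) simp_all
    also have "\<dots> = (\<Sum>r<n. col i r * (\<Sum>c<n. A r c * col j c))"
    proof (rule sum.cong)
      fix r assume r: "r \<in> {..<n}"
      have "(transpose_mat K * Q * X) $$ (r, j) = (\<Sum>c<n. (transpose_mat K * Q) $$ (r, c) * X $$ (c, j))"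
        using W(1,2) X r that by (intro mult_mat_entry[of _ n n _ t] mult_carrier_mat[of _ n a _ n]) simp_all
      then show "X $$ (r, i) * (transpose_mat K * Q * X) $$ (r, j) = col i r * (\<Sum>c<n. A r c * col j c)"
        using r that by (simp add: X_entry KQ)
    qed simp
    finally show ?thesis by (simp add: bilin_def sum_distrib_left mult.assoc)
  qed
  have VX: "V * X \<in> carrier_mat m t" using W(3) X by (rule mult_carrier_mat)
  \<comment> \<open>Bracketed in this way, the inner factor is the t x t matrix of values of the
    bilinear form on pairs of columns.\<close>
  have assoc: "attention_layer Q K V X = (V * X) * N"
    unfolding attention_layer_def N_def using W X by (simp add: assoc_mult_mat_dim)
  show ?thesis unfolding X_def[symmetric]
  proof (rule eq_matI)
    fix r j assume "r < dim_row (two_columns m t (pair_layer 1 n A U z))"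
      "j < dim_col (two_columns m t (pair_layer 1 n A U z))"
    then have rj: "r < m" "j < t" by (auto simp: two_columns_def)
    have "attention_layer Q K V X $$ (r, j) = (\<Sum>b<t. (V * X) $$ (r, b) * N $$ (b, j))"
      unfolding assoc using VX N_carr rj by (intro mult_mat_entry[of _ m t _ t])
    also have "\<dots> = (\<Sum>b<t. (\<Sum>c<n. U r c * col b c) * bilin n A (col b) (col j))"
    proof (rule sum.cong)
      fix b assume b: "b \<in> {..<t}"
      have "(V * X) $$ (r, b) = (\<Sum>c<n. V $$ (r, c) * X $$ (c, b))"
        using W(3) X rj b by (intro mult_mat_entry[of _ m n _ t]) simp_all
      then show "(V * X) $$ (r, b) * N $$ (b, j) = (\<Sum>c<n. U r c * col b c) * bilin n A (col b) (col j)"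
        using b rj by (simp add: X_entry N U)
    qed simp
    also have "\<dots> = (\<Sum>b\<in>{0, 1}. (\<Sum>c<n. U r c * col b c) * bilin n A (col b) (col j))"
      using t by (intro sum.mono_neutral_right) (auto simp: col_def)
    also have "\<dots> = (\<Sum>c<n. U r c * (fst z c * bilin n A (fst z) (col j) + 1 * (snd z c * bilin n A (snd z) (col j))))"
      by (simp add: col_def sum_distrib_right sum.distrib distrib_left mult.assoc)
    also have "\<dots> = two_columns m t (pair_layer 1 n A U z) $$ (r, j)"
    proof -
      have "bilin n A u (\<lambda>_. 0) = 0" for u by (simp add: bilin_def)
      then show ?thesis using rj
        by (auto simp: two_columns_def fst_pair_layer snd_pair_layer col_def)
    qed
    finally show "attention_layer Q K V X $$ (r, j) = two_columns m t (pair_layer 1 n A U z) $$ (r, j)" .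
  qed (use VX N_carr in \<open>auto simp: assoc two_columns_def\<close>)
qed

lemma attention_network_two_columns:
  assumes W: "\<And>i. i < l \<Longrightarrow> Q (Suc i) \<in> carrier_mat (a (Suc i)) (d i) \<and>
      K (Suc i) \<in> carrier_mat (a (Suc i)) (d i) \<and> V (Suc i) \<in> carrier_mat (d (Suc i)) (d i)"
    and t: "2 \<le> t"
    and A: "\<And>i r c. i < l \<Longrightarrow> r < d i \<Longrightarrow> c < d i \<Longrightarrow>
      A (Suc i) r c = (\<Sum>k<a (Suc i). K (Suc i) $$ (k, r) * Q (Suc i) $$ (k, c))"
    and U: "\<And>i r c. i < l \<Longrightarrow> r < d (Suc i) \<Longrightarrow> c < d i \<Longrightarrow> U (Suc i) r c = V (Suc i) $$ (r, c)"
  shows "attention_network Q K V l (two_columns (d 0) t z) =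
    two_columns (d l) t (pair_network 1 d A U 0 l z)"
  using W A U
proof (induction l)
  case (Suc l)
  then have IH: "attention_network Q K V l (two_columns (d 0) t z) =
      two_columns (d l) t (pair_network 1 d A U 0 l z)" by simp
  show ?case unfolding attention_network.simps IH pair_network.simps add_0
    by (rule attention_layer_two_columns[where a = "a (Suc l)"]) (use Suc.prems t in auto)
qed simp

lemma attention_network_cong:
  assumes "\<And>i. i \<in> {1..l} \<Longrightarrow> Q i = Q' i \<and> K i = K' i \<and> V i = V' i"
  shows "attention_network Q K V l X = attention_network Q' K' V' l X"
  using assms by (induction l) auto

lemma polynomial_on_cong:
  assumes "f \<in> polynomial_on I" "\<And>i. i \<in> I \<Longrightarrow> x i = y i"
  shows "f x = f y"
  using assms(1) by induction (auto simp: assms(2))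

section \<open>Coordinates of the normal form and immersion\<close>

locale architecture =
  fixes l t \<delta> :: nat and d a \<alpha> :: "nat \<Rightarrow> nat"
  assumes l: "1 \<le> l" and t: "2 \<le> t" and a: "\<And>i. i \<in> {1..l} \<Longrightarrow> 2 \<le> a i"
    and \<delta>: "2 \<le> \<delta>" "\<delta> \<le> d 0" "\<delta> \<le> d l"
    and d: "\<And>i. 0 < i \<Longrightarrow> i < l \<Longrightarrow> d i = \<delta>"
    and \<alpha>: "\<And>i. i \<in> {1..l} \<Longrightarrow> \<alpha> i = min (a i) (d (i - 1))"
begin

lemma d_ge: "i < l \<Longrightarrow> \<delta> \<le> d i"
  using \<delta> d by (cases "i = 0") auto

lemma \<alpha>_bounds: "i < l \<Longrightarrow> 2 \<le> \<alpha> (Suc i) \<and> \<alpha> (Suc i) \<le> d i \<and> \<alpha> (Suc i) \<le> a (Suc i)"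
  using \<alpha>[of "Suc i"] a[of "Suc i"] d_ge[of i] \<delta> by auto

text \<open>Coordinates of the normal form. The attention matrix of layer \<open>i\<close> is the product of a matrix
  with unit upper block and lower block \<open>(1, i, _, _)\<close> with the matrix \<open>(0, i, _, _)\<close>, whose first
  entry is \<open>1\<close>. The first value matrix is \<open>[1 | (2, 0, _, _)]\<close> unless it is the last one, the last
  one is \<open>(3, 0, _, _)\<close>, and all others are identities.\<close>

definition coordinates :: "(nat \<times> nat \<times> nat \<times> nat) set" where
  "coordinates =
     (\<Union>i\<in>{1..l}. (\<lambda>(k, c). (0, i, k, c)) ` ({..<\<alpha> i} \<times> {..<d (i - 1)} - {(0, 0)})) \<union>
     (\<Union>i\<in>{1..l}. (\<lambda>(r, k). (1, i, r, k)) ` ({\<alpha> i..<d (i - 1)} \<times> {..<\<alpha> i})) \<union>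
     (if 2 \<le> l then (\<lambda>(r, c). (2, 0, r, c)) ` ({..<\<delta>} \<times> {\<delta>..<d 0}) else {}) \<union>
     (\<lambda>(r, c). (3, 0, r, c)) ` ({..<d l} \<times> {..<d (l - 1)})"

lemma in_coordinates:
  shows "i \<in> {1..l} \<Longrightarrow> k < \<alpha> i \<Longrightarrow> c < d (i - 1) \<Longrightarrow> \<not> (k = 0 \<and> c = 0) \<Longrightarrow> (0, i, k, c) \<in> coordinates"
    and "i \<in> {1..l} \<Longrightarrow> \<alpha> i \<le> r \<Longrightarrow> r < d (i - 1) \<Longrightarrow> k < \<alpha> i \<Longrightarrow> (1, i, r, k) \<in> coordinates"
    and "2 \<le> l \<Longrightarrow> r < \<delta> \<Longrightarrow> \<delta> \<le> c \<Longrightarrow> c < d 0 \<Longrightarrow> (2, 0, r, c) \<in> coordinates"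
    and "r < d l \<Longrightarrow> c < d (l - 1) \<Longrightarrow> (3, 0, r, c) \<in> coordinates"
proof -
  have "(0, i, k, c) \<in> (\<lambda>(k, c). (0, i, k, c)) ` ({..<\<alpha> i} \<times> {..<d (i - 1)} - {(0, 0)})"
    if "k < \<alpha> i" "c < d (i - 1)" "\<not> (k = 0 \<and> c = 0)"
    by (rule image_eqI[of _ _ "(k, c)"]) (use that in auto)
  then show "i \<in> {1..l} \<Longrightarrow> k < \<alpha> i \<Longrightarrow> c < d (i - 1) \<Longrightarrow> \<not> (k = 0 \<and> c = 0) \<Longrightarrow> (0, i, k, c) \<in> coordinates"
    unfolding coordinates_def by blast
  have "(1, i, r, k) \<in> (\<lambda>(r, k). (1, i, r, k)) ` ({\<alpha> i..<d (i - 1)} \<times> {..<\<alpha> i})"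
    if "\<alpha> i \<le> r" "r < d (i - 1)" "k < \<alpha> i"
    by (rule image_eqI[of _ _ "(r, k)"]) (use that in auto)
  then show "i \<in> {1..l} \<Longrightarrow> \<alpha> i \<le> r \<Longrightarrow> r < d (i - 1) \<Longrightarrow> k < \<alpha> i \<Longrightarrow> (1, i, r, k) \<in> coordinates"
    unfolding coordinates_def by blast
  show "2 \<le> l \<Longrightarrow> r < \<delta> \<Longrightarrow> \<delta> \<le> c \<Longrightarrow> c < d 0 \<Longrightarrow> (2, 0, r, c) \<in> coordinates"
    unfolding coordinates_def by simp
  show "r < d l \<Longrightarrow> c < d (l - 1) \<Longrightarrow> (3, 0, r, c) \<in> coordinates"
    unfolding coordinates_def by simp
qed

definition upper_factor :: "(nat \<times> nat \<times> nat \<times> nat \<Rightarrow> real) \<Rightarrow> nat \<Rightarrow> nat \<Rightarrow> nat \<Rightarrow> real" where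
  "upper_factor x i k c = (if k = 0 \<and> c = 0 then 1 else x (0, i, k, c))"

definition lower_factor :: "(nat \<times> nat \<times> nat \<times> nat \<Rightarrow> real) \<Rightarrow> nat \<Rightarrow> nat \<Rightarrow> nat \<Rightarrow> real" where
  "lower_factor x i r k = (if r < \<alpha> i then of_bool (r = k) else x (1, i, r, k))"

definition attention_entry :: "(nat \<times> nat \<times> nat \<times> nat \<Rightarrow> real) \<Rightarrow> nat \<Rightarrow> nat \<Rightarrow> nat \<Rightarrow> real" where
  "attention_entry x i r c = (\<Sum>k<\<alpha> i. lower_factor x i r k * upper_factor x i k c)"

definition value_entry :: "(nat \<times> nat \<times> nat \<times> nat \<Rightarrow> real) \<Rightarrow> nat \<Rightarrow> nat \<Rightarrow> nat \<Rightarrow> real" where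
  "value_entry x i r c = (if i = l then x (3, 0, r, c)
     else if c < \<delta> then of_bool (r = c) else x (2, 0, r, c))"

text \<open>If the layer width is smaller than \<open>a i\<close>, then \<alpha> i < a i, and the
  extra rows are zero in both factors, so they add nothing to the attention matrix.\<close>

definition Q_nf :: "(nat \<times> nat \<times> nat \<times> nat \<Rightarrow> real) \<Rightarrow> nat \<Rightarrow> real mat" where
  "Q_nf x i = mat (a i) (d (i - 1)) (\<lambda>(k, c). if k < \<alpha> i then upper_factor x i k c else 0)"

definition K_nf :: "(nat \<times> nat \<times> nat \<times> nat \<Rightarrow> real) \<Rightarrow> nat \<Rightarrow> real mat" where
  "K_nf x i = mat (a i) (d (i - 1)) (\<lambda>(k, r). if k < \<alpha> i then lower_factor x i r k else 0)"

definition V_nf :: "(nat \<times> nat \<times> nat \<times> nat \<Rightarrow> real) \<Rightarrow> nat \<Rightarrow> real mat" where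
  "V_nf x i = mat (d i) (d (i - 1)) (\<lambda>(r, c). value_entry x i r c)"

definition normal_form :: "(nat \<times> nat \<times> nat \<times> nat \<Rightarrow> real) \<Rightarrow> real mat \<Rightarrow> real mat" where
  "normal_form x = (\<lambda>X\<in>carrier_mat (d 0) t. attention_network (Q_nf x) (K_nf x) (V_nf x) l X)"

lemma attention_entry_eq:
  assumes "i < l" "r < d i" "c < d i"
  shows "attention_entry x (Suc i) r c = (\<Sum>k<a (Suc i). K_nf x (Suc i) $$ (k, r) * Q_nf x (Suc i) $$ (k, c))"
proof -
  have "(\<Sum>k<a (Suc i). K_nf x (Suc i) $$ (k, r) * Q_nf x (Suc i) $$ (k, c)) =
      (\<Sum>k<a (Suc i). if k < \<alpha> (Suc i) then lower_factor x (Suc i) r k * upper_factor x (Suc i) k c else 0)"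
    using assms by (intro sum.cong) (auto simp: K_nf_def Q_nf_def)
  also have "\<dots> = attention_entry x (Suc i) r c"
    unfolding attention_entry_def using \<alpha>_bounds[OF assms(1)]
    by (intro sum.mono_neutral_cong_right) auto
  finally show ?thesis by simp
qed

lemma normal_form_in_neuromanifold: "normal_form x \<in> neuromanifold l t d a"
  unfolding neuromanifold_def normal_form_def Q_nf_def K_nf_def V_nf_def by fastforce

lemma normal_form_polynomial:
  assumes "i \<in> {1..l}"
  shows "polynomial_matrix coordinates (a i) (d (i - 1)) (\<lambda>x. Q_nf x i)"
    and "polynomial_matrix coordinates (a i) (d (i - 1)) (\<lambda>x. K_nf x i)"
    and "polynomial_matrix coordinates (d i) (d (i - 1)) (\<lambda>x. V_nf x i)"
proof -
  have coord: "(\<lambda>x. if b then c else x p) \<in> polynomial_on coordinates" if "b \<or> p \<in> coordinates" for b c p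
    using that by (cases b) (auto intro: polynomial_on.intros)
  have const: "(\<lambda>x. if b then f x else 0) \<in> polynomial_on coordinates"
    if "b \<Longrightarrow> f \<in> polynomial_on coordinates" for b f
    using that by (cases b) (auto intro: polynomial_on.intros)
  show "polynomial_matrix coordinates (a i) (d (i - 1)) (\<lambda>x. Q_nf x i)"
    unfolding polynomial_matrix_def
  proof (intro conjI allI impI)
    fix k c assume kc: "k < a i" "c < d (i - 1)"
    have "(\<lambda>x. if k < \<alpha> i then upper_factor x i k c else 0) \<in> polynomial_on coordinates"
    proof (rule const)
      assume "k < \<alpha> i"
      then show "(\<lambda>x. upper_factor x i k c) \<in> polynomial_on coordinates"
        unfolding upper_factor_def using kc assms in_coordinates(1)[of i k c] by (intro coord) blast
    qed
    then show "(\<lambda>x. Q_nf x i $$ (k, c)) \<in> polynomial_on coordinates" using kc by (simp add: Q_nf_def)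
  qed (simp add: Q_nf_def)
  show "polynomial_matrix coordinates (a i) (d (i - 1)) (\<lambda>x. K_nf x i)"
    unfolding polynomial_matrix_def
  proof (intro conjI allI impI)
    fix k r assume kr: "k < a i" "r < d (i - 1)"
    have "(\<lambda>x. if k < \<alpha> i then lower_factor x i r k else 0) \<in> polynomial_on coordinates"
    proof (rule const)
      assume "k < \<alpha> i"
      then show "(\<lambda>x. lower_factor x i r k) \<in> polynomial_on coordinates"
        unfolding lower_factor_def using kr assms in_coordinates(2)[of i r k] by (intro coord) (metis not_less)
    qed
    then show "(\<lambda>x. K_nf x i $$ (k, r)) \<in> polynomial_on coordinates" using kr by (simp add: K_nf_def)
  qed (simp add: K_nf_def)
  show "polynomial_matrix coordinates (d i) (d (i - 1)) (\<lambda>x. V_nf x i)"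
    unfolding polynomial_matrix_def
  proof (intro conjI allI impI)
    fix r c assume rc: "r < d i" "c < d (i - 1)"
    have "(\<lambda>x. value_entry x i r c) \<in> polynomial_on coordinates"
    proof (cases "i = l")
      case True
      then have "(3, 0, r, c) \<in> coordinates" using rc in_coordinates(4) by simp
      then show ?thesis using True unfolding value_entry_def by (simp add: polynomial_on.coord)
    next
      case False
      then have i: "i < l" "d i = \<delta>" using assms d[of i] by auto
      have "(2, 0, r, c) \<in> coordinates" if "\<not> c < \<delta>"
      proof -
        have "i = 1"
        proof (rule ccontr)
          assume "i \<noteq> 1"
          then have "d (i - 1) = \<delta>" using i(1) assms by (intro d) auto
          then show False using that rc by simp
        qed
        then show ?thesis using i rc that by (intro in_coordinates(3)) auto
      qed
      then show ?thesis using False unfolding value_entry_def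
        by (cases "c < \<delta>") (simp_all add: polynomial_on.const polynomial_on.coord)
    qed
    then show "(\<lambda>x. V_nf x i $$ (r, c)) \<in> polynomial_on coordinates" using rc by (simp add: V_nf_def)
  qed (simp add: V_nf_def)
qed

lemma normal_form_cong:
  assumes "\<And>p. p \<in> coordinates \<Longrightarrow> x p = y p"
  shows "normal_form x = normal_form y"
proof -
  have eq: "A x = A y" if "polynomial_matrix coordinates r c A" for A r c
  proof -
    have carr: "A x \<in> carrier_mat r c" "A y \<in> carrier_mat r c"
      using that unfolding polynomial_matrix_def by blast+
    show ?thesis
    proof (rule eq_matI)
    fix i j assume "i < dim_row (A y)" "j < dim_col (A y)"
    then have "(\<lambda>x. A x $$ (i, j)) \<in> polynomial_on coordinates"
      using that carr unfolding polynomial_matrix_def by auto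
    from polynomial_on_cong[OF this assms] show "A x $$ (i, j) = A y $$ (i, j)" .
    qed (use carr in auto)
  qed
  have "Q_nf x i = Q_nf y i \<and> K_nf x i = K_nf y i \<and> V_nf x i = V_nf y i" if "i \<in> {1..l}" for i
    using normal_form_polynomial[OF that, THEN eq] by blast
  then show ?thesis unfolding normal_form_def
    by (intro restrict_ext attention_network_cong)
qed

lemma normal_form_matrix_form:
  "matrix_form coordinates (d 0) t (3 ^ l) (d l) t (\<lambda>x X. attention_network (Q_nf x) (K_nf x) (V_nf x) l X)"
  by (rule matrix_form_attention_network[where a = a]) (use normal_form_polynomial in blast)

text \<open>One formula covers all kinds: the upper factors and the last value matrix become
  truncated identities and the lower blocks vanish, as does kind 2, where r < \<delta> \<le>
  c.\<close>

definition base_point :: "nat \<times> nat \<times> nat \<times> nat \<Rightarrow> real" where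
  "base_point = (\<lambda>(kind, i, r, c). of_bool (kind \<noteq> 1 \<and> r = c))"

text \<open>Flatness is evaluated at inputs with two columns, which is what
  \<open>normal_form_curve\<close> asks for. The coordinates are then recovered from its velocities.
  At the base point both factors are truncated identities, so the upper rows of \<open>A'\<close>
  are the velocity of the upper factor, and the lower rows, in the first \<alpha> columns, that of
  the lower factor.\<close>

lemma normal_form_immersion:
  assumes flat: "\<And>p. p \<in> polynomial_functions (carrier_mat (d 0) t) (hom_poly_maps (d 0) t (d l) t (3 ^ l)) \<Longrightarrow>
      ((\<lambda>s. p (normal_form (\<lambda>i. base_point i + s * v i))) has_real_derivative 0) (at 0)"
    and "q \<in> coordinates"
  shows "v q = 0"
proof -
  define x where "x s = (\<lambda>i. base_point i + s * v i)" for s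
  have dx: "((\<lambda>s. x s i) has_real_derivative v i) (at 0)" for i
    unfolding x_def by (auto intro!: derivative_eq_intros)
  have x0: "x 0 i = base_point i" for i by (simp add: x_def)
  define U' where "U' i k c = (if k = 0 \<and> c = 0 then 0 else v (0, i, k, c))" for i k c :: nat
  define L' where "L' i r k = (if r < \<alpha> i then 0 else v (1, i, r, k))" for i r k :: nat
  define A' where "A' i r c = (\<Sum>k<\<alpha> i. L' i r k * upper_factor (x 0) i k c + U' i k c * lower_factor (x 0) i r k)"
    for i r c
  define V' where "V' i r c = (if i = l then v (3, 0, r, c) else if c < \<delta> then 0 else v (2, 0, r, c))"
    for i r c :: nat
  have dU: "((\<lambda>s. upper_factor (x s) i k c) has_real_derivative U' i k c) (at 0)" for i k c
    unfolding upper_factor_def U'_def using dx by simp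
  have dL: "((\<lambda>s. lower_factor (x s) i r k) has_real_derivative L' i r k) (at 0)" for i r k
    unfolding lower_factor_def L'_def using dx by simp
  have U0: "upper_factor (x 0) i k c = of_bool (k = c)" for i k c
    by (auto simp: upper_factor_def x0 base_point_def)
  have L0: "lower_factor (x 0) i r k = of_bool (r = k \<and> r < \<alpha> i)" for i r k
    by (auto simp: lower_factor_def x0 base_point_def)
  have pick: "(\<Sum>k<n. f k * of_bool (k = c)) = (if c < n then f c else 0)"
    "(\<Sum>k<n. f k * of_bool (c = k \<and> P)) = (if c < n \<and> P then f c else 0)"
    for f :: "nat \<Rightarrow> real" and n c P
  proof -
    have "(\<Sum>k<n. f k * of_bool (k = c)) = (\<Sum>k<n. if k = c then f k else 0)"
      "(\<Sum>k<n. f k * of_bool (c = k \<and> P)) = (\<Sum>k<n. if k = c then if P then f k else 0 else 0)"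
      by (intro sum.cong; auto)+
    then show "(\<Sum>k<n. f k * of_bool (k = c)) = (if c < n then f c else 0)"
      "(\<Sum>k<n. f k * of_bool (c = k \<and> P)) = (if c < n \<and> P then f c else 0)" by simp_all
  qed
  have A'_upper: "A' i r c = U' i r c" if "r < \<alpha> i" for i r c
    unfolding A'_def sum.distrib U0 L0 pick using that by (simp add: L'_def)
  have A'_lower: "A' i r c = v (1, i, r, c)" if "\<not> r < \<alpha> i" "c < \<alpha> i" for i r c
    unfolding A'_def sum.distrib U0 L0 pick using that by (simp add: L'_def)
  interpret normal_form_curve l \<delta> d \<alpha> "\<lambda>s. attention_entry (x s)" "\<lambda>s. value_entry (x s)" A' V'
  proof unfold_locales
    show "((\<lambda>s. attention_entry (x s) i r c) has_real_derivative A' i r c) (at 0)" for i r c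
      unfolding attention_entry_def A'_def by (intro DERIV_sum DERIV_mult dL dU)
    show "((\<lambda>s. value_entry (x s) i r c) has_real_derivative V' i r c) (at 0)" for i r c
      unfolding value_entry_def V'_def using dx by simp
    show "attention_entry (x 0) (Suc i) = trunc_id (\<alpha> (Suc i))" for i
      unfolding attention_entry_def trunc_id_def U0 L0 pick by (auto simp: fun_eq_iff)
    show "value_entry (x 0) i r c = of_bool (r = c)" for i r c
      by (auto simp: value_entry_def x0 base_point_def)
    show "A' (Suc i) 0 0 = 0" if "i < l" for i
      using A'_upper[of 0 "Suc i" 0] \<alpha>_bounds[OF that] by (simp add: U'_def)
    show "value_entry (x s) i r c = of_bool (r = c)" if "0 < i" "i < l" "c < \<delta>" for s i r c
      using that by (simp add: value_entry_def)
    fix y z :: "nat \<Rightarrow> real" and j assume "j < d l"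
    have net: "normal_form (x s) (two_columns (d 0) t (y, z)) =
        two_columns (d l) t (pair_network 1 d (attention_entry (x s)) (value_entry (x s)) 0 l (y, z))" for s
      unfolding normal_form_def restrict_apply'[OF two_columns_carrier]
      by (rule attention_network_two_columns[where a = a])
        (use t in \<open>auto simp: Q_nf_def K_nf_def V_nf_def attention_entry_eq[symmetric] attention_entry_eq\<close>)
    have "((\<lambda>s. normal_form (x s) (two_columns (d 0) t (y, z)) $$ (j, c)) has_real_derivative 0) (at 0)"
      if "c < t" for c
      unfolding x_def
      by (rule flat, rule polynomial_functions.linear, rule entry_linear_functional)
        (use that \<open>j < d l\<close> in auto)
    from this[of 0] this[of 1] t \<open>j < d l\<close>
    show "((\<lambda>s. fst (pair_network 1 d (attention_entry (x s)) (value_entry (x s)) 0 l (y, z)) j)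
          has_real_derivative 0) (at 0) \<and>
        ((\<lambda>s. snd (pair_network 1 d (attention_entry (x s)) (value_entry (x s)) 0 l (y, z)) j)
          has_real_derivative 0) (at 0)"
      unfolding net by (simp add: two_columns_def)
  qed (use l \<delta> d \<alpha>_bounds in auto)
  from \<open>q \<in> coordinates\<close> consider
    (upper) i k c where "q = (0, i, k, c)" "i \<in> {1..l}" "k < \<alpha> i" "c < d (i - 1)" "k = 0 \<Longrightarrow> c \<noteq> 0"
  | (lower) i r k where "q = (1, i, r, k)" "i \<in> {1..l}" "\<alpha> i \<le> r" "r < d (i - 1)" "k < \<alpha> i"
  | (first) r c where "q = (2, 0, r, c)" "2 \<le> l" "r < \<delta>" "\<delta> \<le> c" "c < d 0"
  | (last) r c where "q = (3, 0, r, c)" "r < d l" "c < d (l - 1)"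
    unfolding coordinates_def by (force split: if_splits)
  then show ?thesis
  proof cases
    case upper
    then have i: "i - 1 < l" "Suc (i - 1) = i" by auto
    have "A' i k c = 0"
      using infinitesimally_trivial(1)[OF i(1), of k c] \<alpha>_bounds[OF i(1)] upper unfolding i(2) by auto
    then show ?thesis using A'_upper[OF upper(3), of c] upper(1) upper(5)
      by (cases "k = 0 \<and> c = 0") (auto simp: U'_def)
  next
    case lower
    then have i: "i - 1 < l" "Suc (i - 1) = i" by auto
    have "A' i r k = 0"
      using infinitesimally_trivial(1)[OF i(1), of r k] \<alpha>_bounds[OF i(1)] lower unfolding i(2) by auto
    then show ?thesis using A'_lower[of r i k] lower by simp
  next
    case first
    then show ?thesis using infinitesimally_trivial(3)[of r c] by (simp add: V'_def)
  next
    case last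
    then show ?thesis using infinitesimally_trivial(2)[of r c] by (simp add: V'_def)
  qed
qed

lemma finite_coordinates: "finite coordinates"
  by (auto simp: coordinates_def)

lemma dimension_normal_form:
  "zariski_closure_dimension (carrier_mat (d 0) t) (hom_poly_maps (d 0) t (d l) t (3 ^ l)) (range normal_form) =
     enat (card coordinates)"
proof -
  define D where "D = (carrier_mat (d 0) t :: real mat set)"
  define H where "H = hom_poly_maps (d 0) t (d l) t (3 ^ l)"
  define n where "n = card coordinates"
  obtain h where h: "bij_betw h coordinates {..<n}"
    using ex_bij_betw_finite_nat[OF finite_coordinates] unfolding n_def atLeast0LessThan by blast
  define h' where "h' = inv_into coordinates h"
  have h': "h' j \<in> coordinates" "h (h' j) = j" if "j < n" for j
    using that h unfolding h'_def
    by (auto simp: bij_betw_def intro!: inv_into_into f_inv_into_f)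
  have hn: "h i < n" "h' (h i) = i" if "i \<in> coordinates" for i
    using that h unfolding h'_def bij_betw_def by (auto simp: inv_into_f_f)
  define ext where "ext y i = (if i \<in> coordinates then y (h i) else base_point i)" for y :: "nat \<Rightarrow> real" and i
  define \<psi> where "\<psi> y = normal_form (ext y)" for y
  have range: "range \<psi> = range normal_form"
  proof (intro equalityI image_subsetI)
    show "\<psi> y \<in> range normal_form" for y by (simp add: \<psi>_def)
    show "normal_form x \<in> range \<psi>" for x
    proof -
      have "normal_form x = \<psi> (\<lambda>j. x (h' j))"
        unfolding \<psi>_def by (rule normal_form_cong) (simp add: ext_def hn)
      then show ?thesis by simp
    qed
  qed
  have poly: "(\<lambda>x. p (normal_form x)) \<in> polynomial_on coordinates" if "p \<in> polynomial_functions D H" for p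
    using polynomial_functions_matrix_form[OF normal_form_matrix_form] that
    unfolding D_def H_def normal_form_def by blast
  have "zariski_closure_dimension D H (range \<psi>) = enat n"
  proof (rule zariski_closure_dimension_image[where w = "\<lambda>j. base_point (h' j)"])
    show "range \<psi> \<subseteq> H"
      unfolding range H_def normal_form_def using matrix_form_hom_poly_maps[OF normal_form_matrix_form] by blast
    show "(\<lambda>y. p (\<psi> y)) \<in> polynomial_on {..<n}" if p: "p \<in> polynomial_functions D H" for p
      unfolding \<psi>_def
    proof (rule polynomial_on_subst[OF poly[OF p], where g = "\<lambda>i y. ext y i"])
      fix i assume "i \<in> coordinates"
      then show "(\<lambda>y. ext y i) \<in> polynomial_on {..<n}"
        unfolding ext_def using polynomial_on.coord[of "h i" "{..<n}"] hn(1)[of i] by simp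
    qed
    fix v :: "nat \<Rightarrow> real"
    assume flat: "\<And>p. p \<in> polynomial_functions D H \<Longrightarrow>
        ((\<lambda>s. p (\<psi> (\<lambda>j. base_point (h' j) + s * v j))) has_real_derivative 0) (at 0)"
    have eq: "\<psi> (\<lambda>j. base_point (h' j) + s * v j) = normal_form (\<lambda>i. base_point i + s * v (h i))" for s
      unfolding \<psi>_def by (rule normal_form_cong) (simp add: ext_def hn)
    have "v (h i) = 0" if "i \<in> coordinates" for i
      by (rule normal_form_immersion[OF _ that]) (use flat in \<open>simp add: eq D_def H_def\<close>)
    then show "\<forall>j<n. v j = 0" using h' by metis
  qed
  then show ?thesis unfolding range D_def H_def n_def .
qed

end

section \<open>Density of the normal form\<close>

definition leading_block :: "nat \<Rightarrow> real mat \<Rightarrow> real mat" where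
  "leading_block n M = mat n n (\<lambda>p. M $$ p)"

lemma transpose_mat_entry:
  "A \<in> carrier_mat n m \<Longrightarrow> i < m \<Longrightarrow> j < n \<Longrightarrow> transpose_mat A $$ (i, j) = A $$ (j, i)"
  by auto

text \<open>Cramer's rule through the adjugate, for a family of right-hand sides at once.\<close>

lemma leading_block_solve:
  assumes "det (leading_block n M) \<noteq> 0"
  shows "\<exists>x. \<forall>k<n. \<forall>c. (\<Sum>j<n. M $$ (k, j) * x j c) = b k c"
proof -
  define G where "G = leading_block n M"
  have G: "G \<in> carrier_mat n n" by (simp add: G_def leading_block_def)
  define H where "H = adj_mat G"
  have H: "H \<in> carrier_mat n n" "G * H = det G \<cdot>\<^sub>m 1\<^sub>m n"
    unfolding H_def using adj_mat[OF G] by blast+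
  define x where "x j c = (\<Sum>i<n. H $$ (j, i) * b i c) / det G" for j c
  have "(\<Sum>j<n. M $$ (k, j) * x j c) = b k c" if k: "k < n" for k c
  proof -
    have GH: "(\<Sum>j<n. G $$ (k, j) * H $$ (j, i)) = (if i = k then det G else 0)" if "i < n" for i
    proof -
      have "(\<Sum>j<n. G $$ (k, j) * H $$ (j, i)) = (G * H) $$ (k, i)"
        by (rule mult_mat_entry[symmetric, of _ n n _ n]) (use G H k that in auto)
      then show ?thesis using H(2) k that by simp
    qed
    have "(\<Sum>j<n. M $$ (k, j) * x j c) = (\<Sum>j<n. \<Sum>i<n. G $$ (k, j) * H $$ (j, i) * b i c) / det G"
      unfolding sum_divide_distrib
    proof (rule sum.cong)
      fix j assume "j \<in> {..<n}"
      then have "M $$ (k, j) = G $$ (k, j)" using k by (simp add: G_def leading_block_def)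
      then show "M $$ (k, j) * x j c = (\<Sum>i<n. G $$ (k, j) * H $$ (j, i) * b i c / det G)"
        by (simp add: x_def sum_distrib_left sum_divide_distrib mult.assoc)
    qed simp
    also have "\<dots> = (\<Sum>i<n. (\<Sum>j<n. G $$ (k, j) * H $$ (j, i)) * b i c) / det G"
      by (subst sum.swap) (simp add: sum_distrib_right)
    also have "\<dots> = (\<Sum>i<n. if i = k then det G * b i c else 0) / det G"
      using GH by (intro arg_cong2[of _ _ _ _ "(/)"] sum.cong) auto
    also have "\<dots> = b k c" using k assms by (simp add: G_def)
    finally show ?thesis .
  qed
  then show ?thesis by blast
qed

lemma polynomial_matrix_mult:
  assumes "polynomial_matrix I r u A" "polynomial_matrix I u s B"
  shows "polynomial_matrix I r s (\<lambda>x. A x * B x)"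
  unfolding polynomial_matrix_def
proof (intro conjI allI impI)
  show "A x * B x \<in> carrier_mat r s" for x
    using assms unfolding polynomial_matrix_def by (meson mult_carrier_mat)
  fix i j assume ij: "i < r" "j < s"
  have "(A x * B x) $$ (i, j) = (\<Sum>k<u. A x $$ (i, k) * B x $$ (k, j))" for x
    using assms ij unfolding polynomial_matrix_def by (intro mult_mat_entry) auto
  moreover have "(\<lambda>x. \<Sum>k<u. A x $$ (i, k) * B x $$ (k, j)) \<in> polynomial_on I"
    using assms ij unfolding polynomial_matrix_def
    by (intro polynomial_on_sum polynomial_on.mult) auto
  ultimately show "(\<lambda>x. (A x * B x) $$ (i, j)) \<in> polynomial_on I" by simp
qed

lemma polynomial_matrix_transpose:
  assumes "polynomial_matrix I r s A"
  shows "polynomial_matrix I s r (\<lambda>x. transpose_mat (A x))"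
proof -
  have carr: "A x \<in> carrier_mat r s" for x using assms unfolding polynomial_matrix_def by blast
  have "transpose_mat (A x) $$ (i, j) = A x $$ (j, i)" if "i < s" "j < r" for i j x
    using carr[of x] that by simp
  then show ?thesis using assms carr unfolding polynomial_matrix_def by simp
qed

lemma polynomial_on_det:
  assumes "polynomial_matrix I n n A"
  shows "(\<lambda>x. det (A x)) \<in> polynomial_on I"
proof -
  have "det (A x) = (\<Sum>p\<in>{p. p permutes {0..<n}}. signof p * (\<Prod>i = 0..<n. A x $$ (i, p i)))" for x
    using assms unfolding polynomial_matrix_def by (intro det_def') blast
  moreover have "(\<lambda>x. \<Sum>p\<in>{p. p permutes {0..<n}}. signof p * (\<Prod>i = 0..<n. A x $$ (i, p i))) \<in> polynomial_on I"
  proof (intro polynomial_on_sum polynomial_on_cmult polynomial_on_prod)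
    fix p i assume "p \<in> {p. p permutes {0..<n}}" "i \<in> {0..<n}"
    then have "i < n" "p i < n" using permutes_in_image[of p "{0..<n}" i] by auto
    then show "(\<lambda>x. A x $$ (i, p i)) \<in> polynomial_on I"
      using assms unfolding polynomial_matrix_def by blast
  qed
  ultimately show ?thesis by simp
qed

lemma polynomial_matrix_leading_block:
  assumes "polynomial_matrix I r s A" "n \<le> r" "n \<le> s"
  shows "polynomial_matrix I n n (\<lambda>x. leading_block n (A x))"
  using assms unfolding polynomial_matrix_def leading_block_def by simp

text \<open>The symmetries of the parametrisation: changes of basis of the hidden spaces, combined with
  rescalings of the attention matrices against the value matrices.\<close>

lemma attention_layer_gauge:
  assumes W: "Q \<in> carrier_mat a n" "K \<in> carrier_mat a n" "V \<in> carrier_mat m n"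
    and W': "Q' \<in> carrier_mat a n" "K' \<in> carrier_mat a n" "V' \<in> carrier_mat m n"
    and T: "T \<in> carrier_mat n n" and S: "S \<in> carrier_mat m m" and Y: "Y \<in> carrier_mat n t"
    and att: "transpose_mat (K * T) * (Q * T) = c \<cdot>\<^sub>m (transpose_mat K' * Q')"
    and val: "S * V' = c \<cdot>\<^sub>m (V * T)"
  shows "attention_layer Q K V (T * Y) = S * attention_layer Q' K' V' (Y :: real mat)"
proof -
  define Z where "Z = Y * transpose_mat Y"
  have Z: "Z \<in> carrier_mat n n" using Y by (simp add: Z_def)
  have smult_left: "(k \<cdot>\<^sub>m A) * B = k \<cdot>\<^sub>m (A * B)" if "dim_col A = dim_row B" for k and A B :: "real mat"
    by (rule mult_smult_assoc_mat[of A "dim_row A" "dim_col A" B "dim_col B"]) (use that in auto)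
  have smult_right: "A * (k \<cdot>\<^sub>m B) = k \<cdot>\<^sub>m (A * B)" if "dim_col A = dim_row B" for k and A B :: "real mat"
    by (rule mult_smult_distrib[of A "dim_row A" "dim_col A" B "dim_col B"]) (use that in auto)
  have "attention_layer Q K V (T * Y) = (V * T) * (Z * ((transpose_mat (K * T) * (Q * T)) * Y))"
  proof -
    have tr: "transpose_mat (T * Y) = transpose_mat Y * transpose_mat T"
      "transpose_mat (K * T) = transpose_mat T * transpose_mat K"
      using transpose_mult[OF T Y] transpose_mult[OF W(2) T] by auto
    show ?thesis unfolding attention_layer_def tr Z_def using W T Y
      by (simp add: assoc_mult_mat_dim)
  qed
  also have "\<dots> = (c \<cdot>\<^sub>m (V * T)) * (Z * ((transpose_mat K' * Q') * Y))"
    unfolding att using W W' T Y Z by (simp add: smult_left smult_right)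
  also have "\<dots> = S * attention_layer Q' K' V' Y"
    unfolding val[symmetric] attention_layer_def Z_def using W W' T Y S
    by (simp add: assoc_mult_mat_dim)
  finally show ?thesis .
qed

section \<open>Gauge fixing of generic weights\<close>

context architecture
begin

definition well_shaped :: "(nat \<Rightarrow> real mat) \<Rightarrow> (nat \<Rightarrow> real mat) \<Rightarrow> (nat \<Rightarrow> real mat) \<Rightarrow> bool" where
  "well_shaped Q K V \<longleftrightarrow> (\<forall>i<l. Q (Suc i) \<in> carrier_mat (a (Suc i)) (d i) \<and>
     K (Suc i) \<in> carrier_mat (a (Suc i)) (d i) \<and> V (Suc i) \<in> carrier_mat (d (Suc i)) (d i))"

text \<open>The scalar that is moved from the attention matrix to the value matrix, so that the
  former gets corner entry 1.\<close>

definition pivot :: "real mat \<Rightarrow> real mat \<Rightarrow> real mat \<Rightarrow> real" where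
  "pivot Q K T = (transpose_mat (K * T) * (Q * T)) $$ (0, 0)"

text \<open>The change of basis is forced: for the normalised value matrix to begin with an identity
  block, the next basis has to be the first \<delta> columns of the rescaled V T. Without any
  inverse it is polynomial in the weights.\<close>

primrec gauge :: "(nat \<Rightarrow> real mat) \<Rightarrow> (nat \<Rightarrow> real mat) \<Rightarrow> (nat \<Rightarrow> real mat) \<Rightarrow> nat \<Rightarrow> real mat" where
  "gauge Q K V 0 = 1\<^sub>m (d 0)"
| "gauge Q K V (Suc i) = mat (d (Suc i)) \<delta>
     (\<lambda>p. pivot (Q (Suc i)) (K (Suc i)) (gauge Q K V i) * (V (Suc i) * gauge Q K V i) $$ p)"

text \<open>One polynomial whose nonvanishing allows the divisions that produce the coordinates: by
  the pivots, by the blocks that give the rank factorisations, and by the block of the first value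
  matrix. The original states are T times the normalised ones, so T itself is never
  inverted.\<close>

definition genericity :: "(nat \<Rightarrow> real mat) \<Rightarrow> (nat \<Rightarrow> real mat) \<Rightarrow> (nat \<Rightarrow> real mat) \<Rightarrow> real" where
  "genericity Q K V = (\<Prod>i<l. pivot (Q (Suc i)) (K (Suc i)) (gauge Q K V i) *
       (if a (Suc i) < d i then det (leading_block (a (Suc i)) (K (Suc i) * gauge Q K V i)) else 1)) *
     (if 2 \<le> l then det (leading_block \<delta> (V 1)) else 1)"

lemma gauge_carrier: "i < l \<Longrightarrow> gauge Q K V i \<in> carrier_mat (d i) (d i)"
  using d by (cases i) auto

lemma generic_normal_form:
  assumes W: "well_shaped Q K V" and gen: "genericity Q K V \<noteq> 0"
  shows "\<exists>x. normal_form x = (\<lambda>X\<in>carrier_mat (d 0) t. attention_network Q K V l X)"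
proof -
  define T where "T = gauge Q K V"
  define c where "c i = pivot (Q (Suc i)) (K (Suc i)) (T i)" for i
  define M where "M i = transpose_mat (K (Suc i) * T i) * (Q (Suc i) * T i)" for i
  define B where "B i r s = M i $$ (r, s) / c i" for i r s
  have T: "T i \<in> carrier_mat (d i) (d i)" if "i < l" for i
    unfolding T_def by (rule gauge_carrier[OF that])
  have W': "Q (Suc i) \<in> carrier_mat (a (Suc i)) (d i)" "K (Suc i) \<in> carrier_mat (a (Suc i)) (d i)"
    "V (Suc i) \<in> carrier_mat (d (Suc i)) (d i)" if "i < l" for i
    using W that unfolding well_shaped_def by blast+
  have KT: "K (Suc i) * T i \<in> carrier_mat (a (Suc i)) (d i)"
    and QT: "Q (Suc i) * T i \<in> carrier_mat (a (Suc i)) (d i)"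
    and VT: "V (Suc i) * T i \<in> carrier_mat (d (Suc i)) (d i)" if "i < l" for i
    using W'[OF that] T[OF that] by (auto intro: mult_carrier_mat)
  have M_carr: "M i \<in> carrier_mat (d i) (d i)" if "i < l" for i
    unfolding M_def by (rule mult_carrier_mat[of _ "d i" "a (Suc i)"]) (use KT[OF that] QT[OF that] in auto)
  have M: "M i $$ (r, s) = (\<Sum>k<a (Suc i). (K (Suc i) * T i) $$ (k, r) * (Q (Suc i) * T i) $$ (k, s))"
    if "i < l" "r < d i" "s < d i" for i r s
  proof -
    have "M i $$ (r, s) = (\<Sum>k<a (Suc i). transpose_mat (K (Suc i) * T i) $$ (r, k) * (Q (Suc i) * T i) $$ (k, s))"
      unfolding M_def using KT[OF that(1)] QT[OF that(1)] that
      by (intro mult_mat_entry[of _ "d i" _ _ "d i"]) auto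
    also have "\<dots> = (\<Sum>k<a (Suc i). (K (Suc i) * T i) $$ (k, r) * (Q (Suc i) * T i) $$ (k, s))"
      using that by (intro sum.cong refl) (simp only: transpose_mat_entry[OF KT[OF that(1)]] lessThan_iff)
    finally show ?thesis .
  qed
  have gen': "pivot (Q (Suc i)) (K (Suc i)) (gauge Q K V i) \<noteq> 0"
    "(if a (Suc i) < d i then det (leading_block (a (Suc i)) (K (Suc i) * gauge Q K V i)) else 1) \<noteq> 0"
    if "i < l" for i
    using gen that unfolding genericity_def by auto
  have c: "c i \<noteq> 0" "c i = M i $$ (0, 0)" if "i < l" for i
    using gen'(1)[OF that] unfolding c_def T_def M_def pivot_def by auto
  have B00: "B i 0 0 = 1" if "i < l" for i unfolding B_def using c[OF that] by simp
  \<comment> \<open>If a < d, the other columns of K T are combinations of the first a ones, and the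
    rows of the attention matrix inherit these combinations. If \<alpha> is the full width, there
    are no lower rows.\<close>
  have "\<exists>\<Lambda>. \<forall>r s. i < l \<longrightarrow> r < d i \<longrightarrow> s < d i \<longrightarrow>
      B i r s = (\<Sum>k<\<alpha> (Suc i). (if r < \<alpha> (Suc i) then of_bool (r = k) else \<Lambda> r k) * B i k s)" for i
  proof (cases "i < l")
    case i: True
    have trivial: "(\<Sum>k<n. of_bool (r = k) * f k) = f r" if "r < n" for r n and f :: "nat \<Rightarrow> real"
    proof -
      have "(\<Sum>k<n. of_bool (r = k) * f k) = (\<Sum>k<n. if k = r then f k else 0)"
        by (intro sum.cong) auto
      then show ?thesis using that by simp
    qed
    show ?thesis
    proof (cases "a (Suc i) < d i")
      case True
      then have \<alpha>a: "\<alpha> (Suc i) = a (Suc i)" using \<alpha>[of "Suc i"] i by simp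
      have "det (leading_block (a (Suc i)) (K (Suc i) * T i)) \<noteq> 0"
        using gen'[OF i] True unfolding T_def by simp
      from leading_block_solve[OF this, of "\<lambda>k r. (K (Suc i) * T i) $$ (k, r)"]
      obtain \<mu> where \<mu>: "\<And>k r. k < a (Suc i) \<Longrightarrow>
          (\<Sum>j<a (Suc i). (K (Suc i) * T i) $$ (k, j) * \<mu> j r) = (K (Suc i) * T i) $$ (k, r)" by blast
      have "M i $$ (r, s) = (\<Sum>j<a (Suc i). \<mu> j r * M i $$ (j, s))" if rs: "r < d i" "s < d i" for r s
      proof -
        have "M i $$ (r, s) = (\<Sum>k<a (Suc i). \<Sum>j<a (Suc i).
            (K (Suc i) * T i) $$ (k, j) * \<mu> j r * (Q (Suc i) * T i) $$ (k, s))"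
          unfolding M[OF i rs] by (intro sum.cong refl) (simp add: \<mu>[symmetric] sum_distrib_right)
        also have "\<dots> = (\<Sum>j<a (Suc i). \<mu> j r * (\<Sum>k<a (Suc i).
            (K (Suc i) * T i) $$ (k, j) * (Q (Suc i) * T i) $$ (k, s)))"
          by (subst sum.swap) (simp add: sum_distrib_left mult_ac)
        also have "\<dots> = (\<Sum>j<a (Suc i). \<mu> j r * M i $$ (j, s))"
          using True rs by (intro sum.cong refl) (simp add: M[OF i])
        finally show ?thesis .
      qed
      then have B_lin: "B i r s = (\<Sum>k<\<alpha> (Suc i). \<mu> k r * B i k s)" if "r < d i" "s < d i" for r s
        using that by (simp add: B_def \<alpha>a sum_divide_distrib)
      have "B i r s = (\<Sum>k<\<alpha> (Suc i). (if r < \<alpha> (Suc i) then of_bool (r = k) else \<mu> k r) * B i k s)"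
        if rs: "r < d i" "s < d i" for r s
        using trivial[of r "\<alpha> (Suc i)" "\<lambda>k. B i k s"] B_lin[OF rs] by (cases "r < \<alpha> (Suc i)") simp_all
      then show ?thesis by (intro exI[of _ "\<lambda>r k. \<mu> k r"]) blast
    next
      case False
      then have "\<alpha> (Suc i) = d i" using \<alpha>[of "Suc i"] i by simp
      then show ?thesis using trivial[of _ "d i" "\<lambda>k. B i k _"] by auto
    qed
  qed simp
  then obtain \<Lambda> where \<Lambda>: "\<And>i r s. i < l \<Longrightarrow> r < d i \<Longrightarrow> s < d i \<Longrightarrow>
      B i r s = (\<Sum>k<\<alpha> (Suc i). (if r < \<alpha> (Suc i) then of_bool (r = k) else \<Lambda> i r k) * B i k s)"
    by metis
  \<comment> \<open>Expressing the columns of the first value matrix through its leading block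
    yields exactly what remains of it after the change of basis.\<close>
  have "\<exists>E. 2 \<le> l \<longrightarrow> (\<forall>r<\<delta>. \<forall>s. (\<Sum>j<\<delta>. V 1 $$ (r, j) * E j s) = V 1 $$ (r, s))"
  proof (cases "2 \<le> l")
    case True
    then have "det (leading_block \<delta> (V 1)) \<noteq> 0" using gen unfolding genericity_def by auto
    from leading_block_solve[OF this, of "\<lambda>r s. V 1 $$ (r, s)"] show ?thesis by blast
  qed simp
  then obtain E where E: "\<And>r s. 2 \<le> l \<Longrightarrow> r < \<delta> \<Longrightarrow> (\<Sum>j<\<delta>. V 1 $$ (r, j) * E j s) = V 1 $$ (r, s)"
    by blast
  define x where "x = (\<lambda>(kind, i, r, s). if kind = (0 :: nat) then B (i - 1) r s
    else if kind = 1 then \<Lambda> (i - 1) r s else if kind = 2 then E r s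
    else c (l - 1) * (V l * T (l - 1)) $$ (r, s))"
  have x: "x (0, Suc i, r, s) = B i r s" "x (1, Suc i, r, s) = \<Lambda> i r s" "x (2, 0, r, s) = E r s"
    "x (3, 0, r, s) = c (l - 1) * (V l * T (l - 1)) $$ (r, s)" for i r s
    by (simp_all add: x_def)
  have nf: "Q_nf x (Suc i) \<in> carrier_mat (a (Suc i)) (d i)" "K_nf x (Suc i) \<in> carrier_mat (a (Suc i)) (d i)"
    "V_nf x (Suc i) \<in> carrier_mat (d (Suc i)) (d i)" for i
    by (auto simp: Q_nf_def K_nf_def V_nf_def)
  have att: "M i = c i \<cdot>\<^sub>m (transpose_mat (K_nf x (Suc i)) * Q_nf x (Suc i))" if i: "i < l" for i
  proof (rule eq_matI)
    fix r s assume "r < dim_row (c i \<cdot>\<^sub>m (transpose_mat (K_nf x (Suc i)) * Q_nf x (Suc i)))"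
      "s < dim_col (c i \<cdot>\<^sub>m (transpose_mat (K_nf x (Suc i)) * Q_nf x (Suc i)))"
    then have rs: "r < d i" "s < d i" using nf[of i] by auto
    have "(transpose_mat (K_nf x (Suc i)) * Q_nf x (Suc i)) $$ (r, s) = attention_entry x (Suc i) r s"
    proof -
      have "(transpose_mat (K_nf x (Suc i)) * Q_nf x (Suc i)) $$ (r, s) =
          (\<Sum>k<a (Suc i). transpose_mat (K_nf x (Suc i)) $$ (r, k) * Q_nf x (Suc i) $$ (k, s))"
        using nf[of i] rs by (intro mult_mat_entry[of _ "d i" _ _ "d i"]) auto
      also have "\<dots> = attention_entry x (Suc i) r s"
        unfolding attention_entry_eq[OF i rs] using nf[of i] rs by (intro sum.cong) auto
      finally show ?thesis .
    qed
    also have "\<dots> = B i r s"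
    proof -
      have "upper_factor x (Suc i) k s = B i k s" for k
        unfolding upper_factor_def x using B00[OF i] by auto
      then show ?thesis unfolding attention_entry_def lower_factor_def x using \<Lambda>[OF i rs] by simp
    qed
    finally show "M i $$ (r, s) = (c i \<cdot>\<^sub>m (transpose_mat (K_nf x (Suc i)) * Q_nf x (Suc i))) $$ (r, s)"
      using nf[of i] rs c[OF i] by (simp add: B_def)
  qed (use M_carr[OF i] nf[of i] in auto)
  \<comment> \<open>The output space is not subject to a change of basis, so the last one is the
    identity.\<close>
  define S where "S i = (if i = l then 1\<^sub>m (d l) else T i)" for i
  have S: "S i \<in> carrier_mat (d i) (d i)" if "i \<le> l" for i
    using T that by (auto simp: S_def)
  have val: "S (Suc i) * V_nf x (Suc i) = c i \<cdot>\<^sub>m (V (Suc i) * T i)" if i: "i < l" for i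
  proof (cases "Suc i = l")
    case True
    have "V_nf x (Suc i) = c i \<cdot>\<^sub>m (V (Suc i) * T i)"
    proof (rule eq_matI)
      fix r s assume "r < dim_row (c i \<cdot>\<^sub>m (V (Suc i) * T i))" "s < dim_col (c i \<cdot>\<^sub>m (V (Suc i) * T i))"
      then have rs: "r < d (Suc i)" "s < d i" using VT[OF i] by auto
      have "V_nf x (Suc i) $$ (r, s) = c i * (V (Suc i) * T i) $$ (r, s)"
      proof -
        have "V_nf x (Suc i) $$ (r, s) = x (3, 0, r, s)"
          using rs unfolding V_nf_def value_entry_def True by (simp add: True[symmetric])
        moreover have "l - 1 = i" using True by simp
        ultimately show ?thesis unfolding x(4) by (simp only: True)
      qed
      also have "\<dots> = (c i \<cdot>\<^sub>m (V (Suc i) * T i)) $$ (r, s)"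
        by (rule index_smult_mat(1)[symmetric]) (use rs VT[OF i] in auto)
      finally show "V_nf x (Suc i) $$ (r, s) = (c i \<cdot>\<^sub>m (V (Suc i) * T i)) $$ (r, s)" .
    qed (use VT[OF i] nf[of i] in auto)
    then show ?thesis using left_mult_one_mat[OF nf(3)[of i]] True by (simp add: S_def)
  next
    case False
    then have i': "Suc i < l" "d (Suc i) = \<delta>" using i d[of "Suc i"] by auto
    have SV: "T (Suc i) * V_nf x (Suc i) \<in> carrier_mat \<delta> (d i)"
      using T[OF i'(1)] nf(3)[of i] i'(2) by (metis mult_carrier_mat)
    have TS: "T (Suc i) $$ (r, j) = c i * (V (Suc i) * T i) $$ (r, j)" if "r < \<delta>" "j < \<delta>" for r j
      using that i'(2) by (simp add: T_def c_def)
    have VTi: "dim_row (V (Suc i) * T i) = \<delta>" "dim_col (V (Suc i) * T i) = d i"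
      using VT[OF i] i'(2) by auto
    have "(T (Suc i) * V_nf x (Suc i)) $$ (r, s) = c i * (V (Suc i) * T i) $$ (r, s)"
      if rs: "r < \<delta>" "s < d i" for r s
    proof -
      have "(T (Suc i) * V_nf x (Suc i)) $$ (r, s) = (\<Sum>j<\<delta>. T (Suc i) $$ (r, j) * V_nf x (Suc i) $$ (j, s))"
        using T[OF i'(1)] nf(3)[of i] i'(2) rs by (intro mult_mat_entry[of _ \<delta> _ _ "d i"]) auto
      also have "\<dots> = c i * (\<Sum>j<\<delta>. (V (Suc i) * T i) $$ (r, j) * (if s < \<delta> then of_bool (j = s) else E j s))"
        using False rs TS i'(2)
        by (simp add: V_nf_def value_entry_def x sum_distrib_left mult.assoc cong: if_cong)
      also have "(\<Sum>j<\<delta>. (V (Suc i) * T i) $$ (r, j) * (if s < \<delta> then of_bool (j = s) else E j s)) =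
          (V (Suc i) * T i) $$ (r, s)"
      proof (cases "s < \<delta>")
        case True
        have "(\<Sum>j<\<delta>. (V (Suc i) * T i) $$ (r, j) * (if s < \<delta> then of_bool (j = s) else E j s)) =
            (\<Sum>j<\<delta>. if j = s then (V (Suc i) * T i) $$ (r, j) else 0)"
          using True by (intro sum.cong) auto
        then show ?thesis using True by simp
      next
        case s: False
        have i0: "i = 0"
        proof (rule ccontr)
          assume "i \<noteq> 0"
          then have "d i = \<delta>" using i by (intro d) auto
          then show False using s rs by simp
        qed
        have "V 1 \<in> carrier_mat (d 1) (d 0)" using W'(3)[OF i] i0 by simp
        then have "V (Suc i) * T i = V 1" using i0 by (simp add: T_def)
        then show ?thesis using s E[of r s] rs i'(1) i0 by simp
      qed
      finally show ?thesis .
    qed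
    then have "T (Suc i) * V_nf x (Suc i) = c i \<cdot>\<^sub>m (V (Suc i) * T i)"
      using SV VTi by (intro eq_matI) (auto simp del: index_mult_mat)
    then show ?thesis using False by (simp add: S_def)
  qed
  have net: "attention_network Q K V i X = S i * attention_network (Q_nf x) (K_nf x) (V_nf x) i X \<and>
      attention_network (Q_nf x) (K_nf x) (V_nf x) i X \<in> carrier_mat (d i) t"
    if X: "X \<in> carrier_mat (d 0) t" and "i \<le> l" for X i
    using that(2)
  proof (induction i)
    case 0
    then show ?case using X l by (simp add: S_def T_def)
  next
    case (Suc i)
    define Y where "Y = attention_network (Q_nf x) (K_nf x) (V_nf x) i X"
    have i: "i < l" using Suc.prems by simp
    have Y: "Y \<in> carrier_mat (d i) t" and IH: "attention_network Q K V i X = T i * Y"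
      using Suc i unfolding Y_def S_def by auto
    have "attention_network Q K V (Suc i) X = S (Suc i) * attention_layer (Q_nf x (Suc i)) (K_nf x (Suc i)) (V_nf x (Suc i)) Y"
      unfolding attention_network.simps IH
      by (rule attention_layer_gauge[OF W'[OF i] nf T[OF i] S[OF Suc.prems] Y att[OF i, unfolded M_def] val[OF i]])
    moreover have "attention_layer (Q_nf x (Suc i)) (K_nf x (Suc i)) (V_nf x (Suc i)) Y \<in> carrier_mat (d (Suc i)) t"
      unfolding attention_layer_def using nf[of i] Y by auto
    ultimately show ?case unfolding Y_def by simp
  qed
  have "attention_network (Q_nf x) (K_nf x) (V_nf x) l X = attention_network Q K V l X"
    if "X \<in> carrier_mat (d 0) t" for X
    using net[OF that, of l] by (auto simp: S_def)
  then show ?thesis unfolding normal_form_def by (intro exI[of _ x] restrict_ext)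
qed

lemma polynomial_gauge:
  assumes W: "\<And>i. i < l \<Longrightarrow> polynomial_matrix I (a (Suc i)) (d i) (\<lambda>x. Q x (Suc i)) \<and>
      polynomial_matrix I (a (Suc i)) (d i) (\<lambda>x. K x (Suc i)) \<and>
      polynomial_matrix I (d (Suc i)) (d i) (\<lambda>x. V x (Suc i))"
  shows "i < l \<Longrightarrow> polynomial_matrix I (d i) (d i) (\<lambda>x. gauge (Q x) (K x) (V x) i)"
    and "i < l \<Longrightarrow> (\<lambda>x. pivot (Q x (Suc i)) (K x (Suc i)) (gauge (Q x) (K x) (V x) i)) \<in> polynomial_on I"
proof -
  have piv: "(\<lambda>x. pivot (Q x (Suc i)) (K x (Suc i)) (T x)) \<in> polynomial_on I"
    if i: "i < l" and T: "polynomial_matrix I (d i) (d i) T" for i T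
  proof -
    have "polynomial_matrix I (d i) (d i)
        (\<lambda>x. transpose_mat (K x (Suc i) * T x) * (Q x (Suc i) * T x))"
      by (rule polynomial_matrix_mult[OF polynomial_matrix_transpose,
            OF polynomial_matrix_mult[OF W[OF i, THEN conjunct2, THEN conjunct1] T]
            polynomial_matrix_mult[OF W[OF i, THEN conjunct1] T]])
    moreover have "0 < d i" using d_ge[OF i] \<delta> by simp
    ultimately show ?thesis unfolding pivot_def polynomial_matrix_def by blast
  qed
  have main: "i < l \<Longrightarrow> polynomial_matrix I (d i) (d i) (\<lambda>x. gauge (Q x) (K x) (V x) i)" for i
  proof (induction i)
    case 0
    show ?case by (simp add: polynomial_matrix_def polynomial_on.const)
  next
    case (Suc i)
    then have i: "i < l" and T: "polynomial_matrix I (d i) (d i) (\<lambda>x. gauge (Q x) (K x) (V x) i)"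
      and di: "d (Suc i) = \<delta>" using d[of "Suc i"] by auto
    have VT: "polynomial_matrix I (d (Suc i)) (d i) (\<lambda>x. V x (Suc i) * gauge (Q x) (K x) (V x) i)"
      by (rule polynomial_matrix_mult[OF W[OF i, THEN conjunct2, THEN conjunct2] T])
    show ?case unfolding polynomial_matrix_def
    proof (intro conjI allI impI)
      fix r s assume rs: "r < d (Suc i)" "s < d (Suc i)"
      have "s < d i" using rs(2) d_ge[OF i] di by simp
      then have "(\<lambda>x. pivot (Q x (Suc i)) (K x (Suc i)) (gauge (Q x) (K x) (V x) i) *
          (V x (Suc i) * gauge (Q x) (K x) (V x) i) $$ (r, s)) \<in> polynomial_on I"
        using VT rs(1) unfolding polynomial_matrix_def
        by (intro polynomial_on.mult piv[OF i T]) blast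
      then show "(\<lambda>x. gauge (Q x) (K x) (V x) (Suc i) $$ (r, s)) \<in> polynomial_on I"
        using rs di by (simp del: index_mult_mat)
    qed (simp add: di)
  qed
  then show "i < l \<Longrightarrow> polynomial_matrix I (d i) (d i) (\<lambda>x. gauge (Q x) (K x) (V x) i)" .
  show "i < l \<Longrightarrow> (\<lambda>x. pivot (Q x (Suc i)) (K x (Suc i)) (gauge (Q x) (K x) (V x) i)) \<in> polynomial_on I"
    using piv main by blast
qed

lemma polynomial_genericity:
  assumes W: "\<And>i. i < l \<Longrightarrow> polynomial_matrix I (a (Suc i)) (d i) (\<lambda>x. Q x (Suc i)) \<and>
      polynomial_matrix I (a (Suc i)) (d i) (\<lambda>x. K x (Suc i)) \<and>
      polynomial_matrix I (d (Suc i)) (d i) (\<lambda>x. V x (Suc i))"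
  shows "(\<lambda>x. genericity (Q x) (K x) (V x)) \<in> polynomial_on I"
proof -
  have pg: "polynomial_matrix I (d i) (d i) (\<lambda>x. gauge (Q x) (K x) (V x) i)"
    "(\<lambda>x. pivot (Q x (Suc i)) (K x (Suc i)) (gauge (Q x) (K x) (V x) i)) \<in> polynomial_on I"
    if i: "i < l" for i
    by (rule polynomial_gauge[of I Q K V], rule W, assumption, rule i)+
  have "(\<lambda>x. if a (Suc i) < d i then det (leading_block (a (Suc i)) (K x (Suc i) * gauge (Q x) (K x) (V x) i)) else 1)
      \<in> polynomial_on I" if i: "i < l" for i
  proof (cases "a (Suc i) < d i")
    case True
    have "polynomial_matrix I (a (Suc i)) (d i) (\<lambda>x. K x (Suc i) * gauge (Q x) (K x) (V x) i)"
      by (rule polynomial_matrix_mult[OF W[OF i, THEN conjunct2, THEN conjunct1] pg(1)[OF i]])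
    then have "(\<lambda>x. det (leading_block (a (Suc i)) (K x (Suc i) * gauge (Q x) (K x) (V x) i))) \<in> polynomial_on I"
      by (rule polynomial_on_det[OF polynomial_matrix_leading_block]) (use True in auto)
    then show ?thesis using True by simp
  qed (simp add: polynomial_on.const)
  moreover have "(\<lambda>x. if 2 \<le> l then det (leading_block \<delta> (V x 1)) else 1) \<in> polynomial_on I"
  proof (cases "2 \<le> l")
    case True
    have "polynomial_matrix I (d 1) (d 0) (\<lambda>x. V x 1)" using W[of 0] l by auto
    then have "(\<lambda>x. det (leading_block \<delta> (V x 1))) \<in> polynomial_on I"
      by (rule polynomial_on_det[OF polynomial_matrix_leading_block]) (use True d[of 1] \<delta> in auto)
    then show ?thesis using True by simp
  qed (simp add: polynomial_on.const)
  ultimately show ?thesis unfolding genericity_def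
    by (intro polynomial_on.mult polynomial_on_prod) (simp_all add: pg(2))
qed

text \<open>Weights in normal form have identity gauges, unit pivots and unit leading blocks. This
  certifies that \<open>genericity\<close> is not the zero polynomial.\<close>

lemma genericity_normal_form: "genericity (Q_nf x) (K_nf x) (V_nf x) \<noteq> 0"
proof -
  have carr: "Q_nf x (Suc i) \<in> carrier_mat (a (Suc i)) (d i)" "K_nf x (Suc i) \<in> carrier_mat (a (Suc i)) (d i)"
    "V_nf x (Suc i) \<in> carrier_mat (d (Suc i)) (d i)" for i
    by (auto simp: Q_nf_def K_nf_def V_nf_def)
  have pivot: "pivot (Q_nf x (Suc i)) (K_nf x (Suc i)) (1\<^sub>m (d i)) = 1" if i: "i < l" for i
  proof -
    have d0: "0 < d i" "0 < \<alpha> (Suc i)" using d_ge[OF i] \<delta> \<alpha>_bounds[OF i] by auto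
    have "pivot (Q_nf x (Suc i)) (K_nf x (Suc i)) (1\<^sub>m (d i)) =
        (transpose_mat (K_nf x (Suc i)) * Q_nf x (Suc i)) $$ (0, 0)"
      unfolding pivot_def using carr[of i] by simp
    also have "\<dots> = (\<Sum>k<a (Suc i). transpose_mat (K_nf x (Suc i)) $$ (0, k) * Q_nf x (Suc i) $$ (k, 0))"
      using carr[of i] d0 by (intro mult_mat_entry[of _ "d i" _ _ "d i"]) auto
    also have "\<dots> = attention_entry x (Suc i) 0 0"
      unfolding attention_entry_eq[OF i d0(1) d0(1)]
      using d0 by (intro sum.cong refl) (simp only: transpose_mat_entry[OF carr(2)] lessThan_iff)
    also have "\<dots> = (\<Sum>k<\<alpha> (Suc i). if k = 0 then 1 else 0)"
      unfolding attention_entry_def using d0(2)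
      by (intro sum.cong) (auto simp: lower_factor_def upper_factor_def)
    also have "\<dots> = 1" using d0(2) by simp
    finally show ?thesis .
  qed
  have gauge: "i < l \<Longrightarrow> gauge (Q_nf x) (K_nf x) (V_nf x) i = 1\<^sub>m (d i)" for i
  proof (induction i)
    case (Suc i)
    then have i: "i < l" "Suc i \<noteq> l" "d (Suc i) = \<delta>" using d[of "Suc i"] by auto
    have IH: "gauge (Q_nf x) (K_nf x) (V_nf x) i = 1\<^sub>m (d i)" using Suc by simp
    show ?case
    proof (rule eq_matI)
      fix r s assume "r < dim_row (1\<^sub>m (d (Suc i)) :: real mat)" "s < dim_col (1\<^sub>m (d (Suc i)) :: real mat)"
      then have rs: "r < \<delta>" "s < \<delta>" using i by auto
      then have "s < d i" using d_ge[OF i(1)] by simp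
      have "gauge (Q_nf x) (K_nf x) (V_nf x) (Suc i) $$ (r, s) = V_nf x (Suc i) $$ (r, s)"
        using rs i carr(3)[of i] unfolding gauge.simps IH pivot[OF i(1)] by (simp del: index_mult_mat)
      also have "\<dots> = of_bool (r = s)"
        using rs i \<open>s < d i\<close> by (simp add: V_nf_def value_entry_def)
      finally show "gauge (Q_nf x) (K_nf x) (V_nf x) (Suc i) $$ (r, s) = 1\<^sub>m (d (Suc i)) $$ (r, s)"
        using rs i by simp
    qed (use i in auto)
  qed simp
  have one: "det (leading_block n M) = 1" if "\<And>r s. r < n \<Longrightarrow> s < n \<Longrightarrow> M $$ (r, s) = of_bool (r = s)" for n M
  proof -
    have "leading_block n M = 1\<^sub>m n" unfolding leading_block_def by (rule eq_matI) (auto simp: that)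
    then show ?thesis by simp
  qed
  have "det (leading_block (a (Suc i)) (K_nf x (Suc i) * gauge (Q_nf x) (K_nf x) (V_nf x) i)) = 1"
    if "i < l" "a (Suc i) < d i" for i
  proof (rule one)
    fix r s assume "r < a (Suc i)" "s < a (Suc i)"
    moreover have "\<alpha> (Suc i) = a (Suc i)" using that \<alpha>[of "Suc i"] by simp
    moreover have "K_nf x (Suc i) * gauge (Q_nf x) (K_nf x) (V_nf x) i = K_nf x (Suc i)"
      unfolding gauge[OF that(1)] by (rule right_mult_one_mat[OF carr(2)])
    ultimately show "(K_nf x (Suc i) * gauge (Q_nf x) (K_nf x) (V_nf x) i) $$ (r, s) = of_bool (r = s)"
      using that by (auto simp: K_nf_def lower_factor_def)
  qed
  moreover have "det (leading_block \<delta> (V_nf x 1)) = 1" if "2 \<le> l"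
    by (rule one) (use that d[of 1] \<delta> in \<open>auto simp: V_nf_def value_entry_def\<close>)
  ultimately show ?thesis unfolding genericity_def using gauge pivot by simp
qed

text \<open>Join the weights of \<open>F\<close> to the base point by a line. Along it
  \<open>p\<close> vanishes wherever \<open>genericity\<close> does not, so the product of the two
  univariate polynomials is zero. The second is nonzero at the base point, hence the first vanishes
  identically, in particular at \<open>F\<close>.\<close>

lemma neuromanifold_subset_closure:
  assumes F: "F \<in> neuromanifold l t d a"
    and p: "p \<in> polynomial_functions (carrier_mat (d 0) t) (hom_poly_maps (d 0) t (d l) t (3 ^ l))"
    and vanish: "\<And>x. p (normal_form x) = 0"
  shows "p F = 0"
proof -
  obtain Q K V where F_eq: "F = (\<lambda>X\<in>carrier_mat (d 0) t. attention_network Q K V l X)"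
    and W: "\<forall>i\<in>{1..l}. Q i \<in> carrier_mat (a i) (d (i - 1)) \<and>
                   K i \<in> carrier_mat (a i) (d (i - 1)) \<and> V i \<in> carrier_mat (d i) (d (i - 1))"
    using F unfolding neuromanifold_def by blast
  \<comment> \<open>The parameter of the line is a function on \<open>unit\<close>, so that the
    results on polynomial families apply with a single variable.\<close>
  define seg where "seg r c A B x = mat r c (\<lambda>p. A $$ p + x () * (B $$ p - A $$ p))"
    for r c and A B :: "real mat" and x :: "unit \<Rightarrow> real"
  define Qs where "Qs x i = seg (a i) (d (i - 1)) (Q i) (Q_nf base_point i) x" for x i
  define Ks where "Ks x i = seg (a i) (d (i - 1)) (K i) (K_nf base_point i) x" for x i
  define Vs where "Vs x i = seg (d i) (d (i - 1)) (V i) (V_nf base_point i) x" for x i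
  have seg_poly: "polynomial_matrix UNIV r c (seg r c A B)" for r c A B
  proof -
    have "(\<lambda>x. A $$ p + x () * (B $$ p - A $$ p)) \<in> polynomial_on (UNIV :: unit set)" for p
      by (intro polynomial_on.add polynomial_on.mult polynomial_on.const polynomial_on.coord) simp
    then show ?thesis by (simp add: polynomial_matrix_def seg_def)
  qed
  have poly: "polynomial_matrix UNIV (a i) (d (i - 1)) (\<lambda>x. Qs x i)"
    "polynomial_matrix UNIV (a i) (d (i - 1)) (\<lambda>x. Ks x i)"
    "polynomial_matrix UNIV (d i) (d (i - 1)) (\<lambda>x. Vs x i)" for i
    unfolding Qs_def Ks_def Vs_def using seg_poly by blast+
  define G where "G x = (\<lambda>X\<in>carrier_mat (d 0) t. attention_network (Qs x) (Ks x) (Vs x) l X)" for x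
  have "matrix_form UNIV (d 0) t (3 ^ l) (d l) t (\<lambda>x X. attention_network (Qs x) (Ks x) (Vs x) l X)"
    by (rule matrix_form_attention_network[where a = a]) (use poly in blast)
  from polynomial_functions_matrix_form[OF this p]
  have pG: "(\<lambda>x. p (G x)) \<in> polynomial_on UNIV" unfolding G_def .
  have gen: "(\<lambda>x. genericity (Qs x) (Ks x) (Vs x)) \<in> polynomial_on UNIV"
    by (rule polynomial_genericity) (use poly[of "Suc _"] in simp)
  have lin: "\<exists>q. \<forall>\<tau> :: real. \<tau> = poly q \<tau>" by (rule exI[of _ "[:0, 1:]"]) simp
  obtain q where q: "\<forall>\<tau>. p (G (\<lambda>_. \<tau>)) = poly q \<tau>"
    using polynomial_on_univariate[OF pG, where g = "\<lambda>_ \<tau>. \<tau>", OF lin] by (elim exE)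
  obtain h where h: "\<forall>\<tau>. genericity (Qs (\<lambda>_. \<tau>)) (Ks (\<lambda>_. \<tau>)) (Vs (\<lambda>_. \<tau>)) = poly h \<tau>"
    using polynomial_on_univariate[OF gen, where g = "\<lambda>_ \<tau>. \<tau>", OF lin] by (elim exE)
  have "poly q \<tau> * poly h \<tau> = 0" for \<tau>
  proof (cases "poly h \<tau> = 0")
    case False
    have "well_shaped (Qs (\<lambda>_. \<tau>)) (Ks (\<lambda>_. \<tau>)) (Vs (\<lambda>_. \<tau>))"
      by (simp add: well_shaped_def Qs_def Ks_def Vs_def seg_def)
    then obtain x where "normal_form x = G (\<lambda>_. \<tau>)"
      using generic_normal_form False h unfolding G_def by metis
    then have "poly q \<tau> = 0" using vanish[of x] q by simp
    then show ?thesis by simp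
  qed simp
  then have "poly (q * h) \<tau> = 0" for \<tau> by simp
  then have "q * h = 0" using poly_all_0_iff_0 by blast
  moreover have "h \<noteq> 0"
  proof -
    have 1: "seg r c A B (\<lambda>_. 1) = B" if "B \<in> carrier_mat r c" for r c A B
      using that unfolding seg_def by (intro eq_matI) auto
    have "Qs (\<lambda>_. 1) = Q_nf base_point" "Ks (\<lambda>_. 1) = K_nf base_point" "Vs (\<lambda>_. 1) = V_nf base_point"
      unfolding Qs_def Ks_def Vs_def by (intro ext 1; simp add: Q_nf_def K_nf_def V_nf_def)+
    then have "poly h 1 \<noteq> 0" using genericity_normal_form[of base_point] h[rule_format, of 1] by simp
    then show ?thesis by auto
  qed
  ultimately have "q = 0" by simp
  then have "p (G (\<lambda>_. 0)) = 0" using q by simp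
  moreover have "G (\<lambda>_. 0) = F"
  proof -
    have 0: "seg r c A B (\<lambda>_. 0) = A" if "A \<in> carrier_mat r c" for r c A B
      using that unfolding seg_def by (intro eq_matI) auto
    have "Qs (\<lambda>_. 0) i = Q i \<and> Ks (\<lambda>_. 0) i = K i \<and> Vs (\<lambda>_. 0) i = V i" if "i \<in> {1..l}" for i
      unfolding Qs_def Ks_def Vs_def using W that by (intro conjI 0) auto
    then show ?thesis unfolding G_def F_eq by (intro restrict_ext attention_network_cong)
  qed
  ultimately show ?thesis by simp
qed

lemma neuromanifold_subset: "neuromanifold l t d a \<subseteq> hom_poly_maps (d 0) t (d l) t (3 ^ l)"
proof
  fix F assume "F \<in> neuromanifold l t d a"
  then obtain Q K V where F: "F = (\<lambda>X\<in>carrier_mat (d 0) t. attention_network Q K V l X)"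
    and W: "\<forall>i\<in>{1..l}. Q i \<in> carrier_mat (a i) (d (i - 1)) \<and>
                   K i \<in> carrier_mat (a i) (d (i - 1)) \<and> V i \<in> carrier_mat (d i) (d (i - 1))"
    unfolding neuromanifold_def by blast
  have "matrix_form ({} :: unit set) (d 0) t (3 ^ l) (d l) t (\<lambda>_ X. attention_network Q K V l X)"
    by (rule matrix_form_attention_network[where a = a])
      (use W in \<open>auto simp: polynomial_matrix_def intro: polynomial_on.const\<close>)
  from matrix_form_hom_poly_maps[OF this] show "F \<in> hom_poly_maps (d 0) t (d l) t (3 ^ l)"
    unfolding F .
qed

lemma neuromanifold_dimension_eq: "neuromanifold_dimension l t d a = enat (card coordinates)"
proof -
  define H where "H = hom_poly_maps (d 0) t (d l) t (3 ^ l)"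
  define D where "D = (carrier_mat (d 0) t :: real mat set)"
  have sub: "neuromanifold l t d a \<subseteq> H" unfolding H_def by (rule neuromanifold_subset)
  have nf: "range normal_form \<subseteq> neuromanifold l t d a" using normal_form_in_neuromanifold by blast
  have iff: "(\<forall>G\<in>neuromanifold l t d a. p G = 0) \<longleftrightarrow> (\<forall>G\<in>range normal_form. p G = 0)"
    if p: "p \<in> polynomial_functions D H" for p
    using neuromanifold_subset_closure[OF _ p[unfolded D_def H_def]] nf by blast
  have "zariski_topology D H closure_of (neuromanifold l t d a) =
      zariski_topology D H closure_of (range normal_form)"
    unfolding closure_of_zariski[OF sub] closure_of_zariski[OF order_trans[OF nf sub]]
    using iff by (intro Collect_cong conj_cong refl ball_cong) simp
  then show ?thesis
    using dimension_normal_form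
    unfolding neuromanifold_dimension_def zariski_closure_dimension_def D_def H_def by simp
qed

section \<open>Counting the coordinates\<close>

text \<open>The two factors of an attention matrix contribute (\<alpha> d - 1) + (d - \<alpha>)
  \<alpha>. The kind in the first component keeps the families disjoint.\<close>

lemma card_coordinates:
  "int (card coordinates) =
     (\<Sum>i\<in>{1..l}. 2 * int (\<alpha> i) * int (d (i - 1)) - int (\<alpha> i) ^ 2 - 1) +
     (if 2 \<le> l then int \<delta> * (int (d 0) - int \<delta>) else 0) + int (d l) * int (d (l - 1))"
proof -
  define C0 where "C0 i = (\<lambda>(k, c). (0 :: nat, i, k, c)) ` ({..<\<alpha> i} \<times> {..<d (i - 1)} - {(0, 0)})" for i
  define C1 where "C1 i = (\<lambda>(r, k). (1 :: nat, i, r, k)) ` ({\<alpha> i..<d (i - 1)} \<times> {..<\<alpha> i})" for i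
  define C2 where "C2 = (if 2 \<le> l then (\<lambda>(r, c). (2 :: nat, 0 :: nat, r, c)) ` ({..<\<delta>} \<times> {\<delta>..<d 0}) else {})"
  define C3 where "C3 = (\<lambda>(r, c). (3 :: nat, 0 :: nat, r, c)) ` ({..<d l} \<times> {..<d (l - 1)})"
  have coords: "coordinates = (\<Union>i\<in>{1..l}. C0 i) \<union> (\<Union>i\<in>{1..l}. C1 i) \<union> C2 \<union> C3"
    unfolding coordinates_def C0_def C1_def C2_def C3_def ..
  have fin: "finite (C0 i)" "finite (C1 i)" "finite C2" "finite C3" for i
    by (auto simp: C0_def C1_def C2_def C3_def)
  have bounds: "2 \<le> \<alpha> i \<and> \<alpha> i \<le> d (i - 1)" if "i \<in> {1..l}" for i
    using \<alpha>_bounds[of "i - 1"] that by (cases i) auto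
  have c0: "int (card (C0 i)) = int (\<alpha> i) * int (d (i - 1)) - 1" if "i \<in> {1..l}" for i
  proof -
    have pos: "0 < \<alpha> i" "0 < d (i - 1)" using bounds[OF that] by auto
    have "card (C0 i) = card ({..<\<alpha> i} \<times> {..<d (i - 1)} - {(0, 0)})"
      unfolding C0_def by (rule card_image) (auto simp: inj_on_def)
    also have "\<dots> = \<alpha> i * d (i - 1) - 1" using pos by (subst card_Diff_singleton) auto
    finally show ?thesis using pos by (simp add: of_nat_diff)
  qed
  have c1: "int (card (C1 i)) = (int (d (i - 1)) - int (\<alpha> i)) * int (\<alpha> i)" if "i \<in> {1..l}" for i
  proof -
    have le: "\<alpha> i \<le> d (i - 1)" using bounds[OF that] by simp
    have "card (C1 i) = card ({\<alpha> i..<d (i - 1)} \<times> {..<\<alpha> i})"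
      unfolding C1_def by (rule card_image) (auto simp: inj_on_def)
    then show ?thesis using le by (simp add: of_nat_diff)
  qed
  have c2: "int (card C2) = (if 2 \<le> l then int \<delta> * (int (d 0) - int \<delta>) else 0)"
  proof -
    have "card ((\<lambda>(r, c). (2 :: nat, 0 :: nat, r, c)) ` ({..<\<delta>} \<times> {\<delta>..<d 0})) = card ({..<\<delta>} \<times> {\<delta>..<d 0})"
      by (rule card_image) (auto simp: inj_on_def)
    then show ?thesis using \<delta> by (simp add: C2_def of_nat_diff)
  qed
  have c3: "int (card C3) = int (d l) * int (d (l - 1))"
  proof -
    have "card C3 = card ({..<d l} \<times> {..<d (l - 1)})"
      unfolding C3_def by (rule card_image) (auto simp: inj_on_def)
    then show ?thesis by simp
  qed
  have u0: "card (\<Union>i\<in>{1..l}. C0 i) = (\<Sum>i\<in>{1..l}. card (C0 i))"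
    by (rule card_UN_disjoint) (auto simp: fin, auto simp: C0_def)
  have u1: "card (\<Union>i\<in>{1..l}. C1 i) = (\<Sum>i\<in>{1..l}. card (C1 i))"
    by (rule card_UN_disjoint) (auto simp: fin, auto simp: C1_def)
  have finU: "finite (\<Union>i\<in>{1..l}. C0 i)" "finite (\<Union>i\<in>{1..l}. C1 i)" using fin by auto
  have disj: "(\<Union>i\<in>{1..l}. C0 i) \<inter> (\<Union>i\<in>{1..l}. C1 i) = {}"
    "((\<Union>i\<in>{1..l}. C0 i) \<union> (\<Union>i\<in>{1..l}. C1 i)) \<inter> C2 = {}"
    "((\<Union>i\<in>{1..l}. C0 i) \<union> (\<Union>i\<in>{1..l}. C1 i) \<union> C2) \<inter> C3 = {}"
    by (auto simp: C0_def C1_def C2_def C3_def)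
  have "card coordinates = (\<Sum>i\<in>{1..l}. card (C0 i)) + (\<Sum>i\<in>{1..l}. card (C1 i)) + card C2 + card C3"
    unfolding coords u0[symmetric] u1[symmetric] using disj fin finU by (simp add: card_Un_disjoint)
  then have "int (card coordinates) =
      (\<Sum>i\<in>{1..l}. int (card (C0 i)) + int (card (C1 i))) + int (card C2) + int (card C3)"
    by (simp add: sum.distrib)
  also have "(\<Sum>i\<in>{1..l}. int (card (C0 i)) + int (card (C1 i))) =
      (\<Sum>i\<in>{1..l}. 2 * int (\<alpha> i) * int (d (i - 1)) - int (\<alpha> i) ^ 2 - 1)"
    by (intro sum.cong refl) (simp only: c0 c1, simp add: algebra_simps power2_eq_square)
  finally show ?thesis unfolding c2 c3 .
qed

end

text \<open>For l = 1 there is no hidden width to determine \<delta>. The value matrix has d 0 times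
  d 1 free entries, and \<delta> (d 0 + d 1) - \<delta>^2 equals this number exactly when (d 0 -
  \<delta>) (d 1 - \<delta>) = 0. Together with the lower bounds on both widths this means that
  \<delta> is their minimum.\<close>

theorem corollary3p8:
  fixes l t \<delta> :: nat and d a \<alpha> :: "nat \<Rightarrow> nat"
  assumes "l \<ge> 1" and "t \<ge> 3"
    and "\<forall>i\<in>{0..l}. d i \<ge> 1"
    and "\<forall>i\<in>{1..l}. a i \<ge> 2"
    and "\<delta> \<ge> 2"
    and "\<forall>i. 0 < i \<and> i < l \<longrightarrow> d i = \<delta>"
    and "d 0 \<ge> \<delta>" and "d l \<ge> \<delta>"
    and "l = 1 \<longrightarrow> \<delta> = min (d 0) (d l)"
    and "\<forall>i\<in>{1..l}. \<alpha> i = min (a i) (d (i - 1))"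
  shows "\<exists>n. neuromanifold_dimension l t d a = enat n \<and>
    int n = 2 * int (\<alpha> 1) * int (d 0) - int (\<alpha> 1) ^ 2 + int \<delta> * (int (d 0) + int (d l))
            - int \<delta> ^ 2 - int l
            + (\<Sum>i | 1 < i \<and> i \<le> l. 2 * int (\<alpha> i) * int \<delta> - int (\<alpha> i) ^ 2)"
proof -
  interpret architecture l t \<delta> d a \<alpha>
    by unfold_locales (use assms in auto)
  define f where "f i = 2 * int (\<alpha> i) * int (d (i - 1)) - int (\<alpha> i) ^ 2 - 1" for i
  have tail: "{i. 1 < i \<and> i \<le> l} = {2..l}" by auto
  have "(\<Sum>i\<in>{1..l}. f i) = f 1 + (\<Sum>i\<in>{2..l}. f i)"
    using assms(1) by (simp add: sum.atLeast_Suc_atMost numeral_2_eq_2)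
  also have "(\<Sum>i\<in>{2..l}. f i) = (\<Sum>i\<in>{2..l}. (2 * int (\<alpha> i) * int \<delta> - int (\<alpha> i) ^ 2) - 1)"
    unfolding f_def using assms(6) by (intro sum.cong refl) auto
  also have "\<dots> = (\<Sum>i | 1 < i \<and> i \<le> l. 2 * int (\<alpha> i) * int \<delta> - int (\<alpha> i) ^ 2) - (int l - 1)"
    unfolding tail sum_subtractf using assms(1) by (simp add: of_nat_diff)
  finally have sum_f: "(\<Sum>i\<in>{1..l}. f i) = 2 * int (\<alpha> 1) * int (d 0) - int (\<alpha> 1) ^ 2 - int l +
      (\<Sum>i | 1 < i \<and> i \<le> l. 2 * int (\<alpha> i) * int \<delta> - int (\<alpha> i) ^ 2)"
    by (simp add: f_def)
  have rest: "(if 2 \<le> l then int \<delta> * (int (d 0) - int \<delta>) else 0) + int (d l) * int (d (l - 1)) =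
      int \<delta> * (int (d 0) + int (d l)) - int \<delta> ^ 2"
  proof (cases "l = 1")
    case True
    then have "\<delta> = d 0 \<or> \<delta> = d l" using assms(9) by (auto simp: min_def)
    then show ?thesis using True by (auto simp: algebra_simps power2_eq_square)
  next
    case False
    then have "d (l - 1) = \<delta>" "2 \<le> l" using assms(1,6) by auto
    then show ?thesis by (simp add: algebra_simps power2_eq_square)
  qed
  show ?thesis
    unfolding neuromanifold_dimension_eq
    by (intro exI[of _ "card coordinates"] conjI refl)
      (use card_coordinates sum_f rest in \<open>simp add: f_def\<close>)
qed

end
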